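(* Let $X=\mathbb{R}^d$ and $\mathcal F=\mathscr H+\mathcal E_G-\mathcal E_H$ on $\mathcal P_2(X)$, and suppose the standing assumptions (i)--(iv) of the context hold with constant $\eta_0>0$. Suppose in addition that $H\in C^2(X)$ has uniformly bounded Hessian, and let $L_H$ be a Lipschitz constant of $\nabla H$. Let $\mathcal F^*$ be the optimal value of $\mathcal F$ and suppose $\mathcal F$ satisfies the Łojasiewicz condition of the context with parameters $(r_0,c,\theta)$. Let $0<\eta<\eta_0$, let $\mu_0\in\mathcal P_{2,\mathrm{abs}}(X)$ be such that $\mathcal F(\mu_0)-\mathcal F^*<r_0$, and let $(\mu_n)_{n\ge 0}$ be a sequence produced by the semi Forward-Backward Euler scheme $$\nu_{n+1}=(I+\eta\nabla H)_{\#}\mu_n,\qquad \mu_{n+1}\in \mathrm{JKO}_{\eta(\mathcal E_G+\mathscr H)}(\nu_{n+1}),\qquad n\ge 0.$$ Then $\{\mu_n\}_{n\in\mathbb N}$ is a Cauchy sequence in $(\mathcal P_2(X),W_2)$; consequently there exists $\mu^*\in\mathcal P_2(X)$ with $W_2(\mu_n,\mu^* )\to0$, and the limit $\mu^*$ is a global minimizer of $\mathcal F$. In addition: (i) if $\theta=0$, $W_2(\mu_n,\mu^* )$ converges to $0$ in a finite number of steps; (ii) if $\theta\in(0,1/2]$, $W_2(\mu_n,\mu^* )=O\left(\left(\frac{M}{M+1}\right)^n\right)$, where $M=1+\frac{(2(\eta^2L_H^2+1))^{\frac1{2\theta}}}{(1-\theta)\,\eta^{\frac{1-\theta}{\theta}}\,c^{\frac1\theta}}$;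 (iii) if $\theta\in(1/2,1)$, $W_2(\mu_n,\mu^* )=O\left(n^{-\frac{1-\theta}{2\theta-1}}\right)$.
   Context: $X=\mathbb R^d$. $\mathcal P_2(X)$ is the set of Borel probability measures on $X$ with finite second moment, $W_2$ the 2-Wasserstein distance on it, and $\mathcal P_{2,\mathrm{abs}}(X)\subset\mathcal P_2(X)$ the subset of measures absolutely continuous with respect to Lebesgue measure. $\Gamma_o(\mu,\nu)$ is the set of optimal transport plans between $\mu$ and $\nu$ for the cost $\|x-y\|^2$. For $\mu\in\mathcal P_{2,\mathrm{abs}}(X)$ and $\nu\in\mathcal P_2(X)$, $T_\mu^\nu$ is the ($\mu$-a.e. unique) optimal transport map from $\mu$ to $\nu$. $T_\#\mu$ is the pushforward, $I$ the identity map, and $L^2(X,X,\mu)$ the Hilbert space of Borel maps $\xi:X\to X$ with norm $\|\xi\|_{L^2(X,X,\mu)}=(\int\|\xi\|^2d\mu)^{1/2}<\infty$. A function $f:X\to\mathbb R$ has quadratic growth if there is $a>0$ with $|f(x)|\le a(\|x\|^2+1)$ for all $x$. For such $f$, $\mathcal E_f(\mu):=\int f\,d\mu$ for $\mu\in\mathcal P_2(X)$. For $\phi:\mathcal P_2(X)\to\mathbb R\cup\{+\infty\}$: $\mathrm{dom}(\phi)=\{\mu:\phi(\mu)<+\infty\}$; $\phi$ is proper if $\mathrm{dom}(\phi)\ne\emptyset$; $\phi$ is l.s.c. if $\liminf_n\phi(\mu_n)\ge\phi(\mu)$ whenever $W_2(\mu_n,\mu)\to0$; $\phi$ is convex along generalized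 geodesics if for all $\mu,\pi\in\mathcal P_2(X)$, $\nu\in\mathcal P_{2,\mathrm{abs}}(X)$, $t\in[0,1]$, $\phi((tT_\nu^\mu+(1-t)T_\nu^\pi)_\#\nu)\le t\phi(\mu)+(1-t)\phi(\pi)$. Fréchet subdifferential: for $\mu\in\mathrm{dom}(\phi)$, $\xi\in L^2(X,X,\mu)$ belongs to $\partial_F^-\phi(\mu)$ if for all $\nu\in\mathcal P_2(X)$, $\phi(\nu)-\phi(\mu)\ge\sup_{\gamma\in\Gamma_o(\mu,\nu)}\int\langle\xi(x),y-x\rangle d\gamma(x,y)+o(W_2(\mu,\nu))$, where $o(s)/s\to0$ as $s\to 0$. JKO operator: $\mathrm{JKO}_{\eta\phi}(\mu):=\arg\min_{\nu\in\mathcal P_2(X)}\phi(\nu)+\frac1{2\eta}W_2^2(\mu,\nu)$ (set of minimizers). Standing assumptions: $F=G-H$ and $\mathcal F(\mu)=\mathcal E_F(\mu)+\mathscr H(\mu)=\mathcal E_G(\mu)-\mathcal E_H(\mu)+\mathscr H(\mu)$, where (i) $\mathcal F$ is bounded below; (ii) $G,H:X\to\mathbb R$ are convex and have quadratic growth; (iii) $\mathscr H:\mathcal P_2(X)\to\mathbb R\cup\{+\infty\}$ is proper, l.s.c., convex along generalized geodesics, and $\mathrm{dom}(\mathscr H)\subset\mathcal P_{2,\mathrm{abs}}(X)$; (iv) there is $\eta_0>0$ such that for all $\eta\in(0,\eta_0)$ and all $\mu\in\mathcal P_2(X)$, $\mathrm{JKO}_{\eta(\mathcal E_G+\mathscr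 H)}(\mu)\neq\emptyset$. Łojasiewicz condition with parameters $(r_0,c,\theta)$: $\mathcal F^*=\inf_{\mathcal P_2(X)}\mathcal F$ is the optimal value, $r_0\in(\mathcal F^*,+\infty]$, $\theta\in[0,1)$, $c>0$, and for all $\mu\in\mathcal P_2(X)$, $$\mathcal F(\mu)-\mathcal F^*<r_0\ \Rightarrow\ c(\mathcal F(\mu)-\mathcal F^* )^\theta\le\inf\{\|\xi\|_{L^2(X,X,\mu)}:\xi\in\partial_F^-\mathcal F(\mu)\},$$ with the conventions $0^0=0$ and $\inf\emptyset=+\infty$. *)

theory Defs
  imports "HOL-Probability.Probability" "HOL-Library.Landau_Symbols"
begin

section \<open>Probability measures with finite second moment\<close>

definition P2 :: "'a::euclidean_space measure set" where
  "P2 = {\<mu>. prob_space \<mu> \<and> sets \<mu> = sets borel \<and> (\<integral>\<^sup>+x. ennreal ((norm x)\<^sup>2) \<partial>\<mu>) < \<infinity>}"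

definition P2_abs :: "'a::euclidean_space measure set" where
  "P2_abs = {\<mu> \<in> P2. absolutely_continuous lborel \<mu>}"


section \<open>Optimal transport for the squared distance\<close>

definition couplings ::
  "'a::euclidean_space measure \<Rightarrow> 'a measure \<Rightarrow> ('a \<times> 'a) measure set" where
  "couplings \<mu> \<nu> =
     {\<gamma>. sets \<gamma> = sets borel \<and> distr \<gamma> borel fst = \<mu> \<and> distr \<gamma> borel snd = \<nu>}"

definition transport_cost :: "('a::euclidean_space \<times> 'a) measure \<Rightarrow> ennreal" where
  "transport_cost \<gamma> = (\<integral>\<^sup>+z. ennreal ((norm (fst z - snd z))\<^sup>2) \<partial>\<gamma>)"

text \<open>On \<^const>\<open>P2\<close> the infimum below is finite, since the product coupling has finite cost.\<close>

definition W2 :: "'a::euclidean_space measure \<Rightarrow> 'a measure \<Rightarrow> real" where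
  "W2 \<mu> \<nu> = sqrt (enn2real (INF \<gamma>\<in>couplings \<mu> \<nu>. transport_cost \<gamma>))"

definition optimal_plans ::
  "'a::euclidean_space measure \<Rightarrow> 'a measure \<Rightarrow> ('a \<times> 'a) measure set" where
  "optimal_plans \<mu> \<nu> =
     {\<gamma> \<in> couplings \<mu> \<nu>. \<forall>\<gamma>'\<in>couplings \<mu> \<nu>. transport_cost \<gamma> \<le> transport_cost \<gamma>'}"

definition is_optimal_map ::
  "'a::euclidean_space measure \<Rightarrow> 'a measure \<Rightarrow> ('a \<Rightarrow> 'a) \<Rightarrow> bool" where
  "is_optimal_map \<mu> \<nu> T \<longleftrightarrow>
     T \<in> borel_measurable borel \<and> distr \<mu> borel T = \<nu> \<and>
     distr \<mu> borel (\<lambda>x. (x, T x)) \<in> optimal_plans \<mu> \<nu>"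

text \<open>For \<open>\<mu> \<in> P2_abs\<close> and \<open>\<nu> \<in> P2\<close> an optimal map exists and is unique up to
  \<open>\<mu>\<close>-null sets (Brenier); the choice operator selects a representative.\<close>

definition optimal_map :: "'a::euclidean_space measure \<Rightarrow> 'a measure \<Rightarrow> 'a \<Rightarrow> 'a" where
  "optimal_map \<mu> \<nu> = (SOME T. is_optimal_map \<mu> \<nu> T)"


section \<open>Functionals on the Wasserstein space\<close>

text \<open>A functional with values in \<open>\<real> \<union> {+\<infinity>}\<close> is a function into \<^typ>\<open>ereal\<close> that
  never takes the value \<open>-\<infinity>\<close> on \<^const>\<open>P2\<close>; values outside \<^const>\<open>P2\<close> are irrelevant.\<close>

definition extended_real_functional :: "('a::euclidean_space measure \<Rightarrow> ereal) \<Rightarrow> bool" where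
  "extended_real_functional \<phi> \<longleftrightarrow> (\<forall>\<mu>\<in>P2. \<phi> \<mu> \<noteq> -\<infinity>)"

definition domain :: "('a::euclidean_space measure \<Rightarrow> ereal) \<Rightarrow> 'a measure set" where
  "domain \<phi> = {\<mu> \<in> P2. \<phi> \<mu> < \<infinity>}"

definition proper :: "('a::euclidean_space measure \<Rightarrow> ereal) \<Rightarrow> bool" where
  "proper \<phi> \<longleftrightarrow> domain \<phi> \<noteq> {}"

definition lsc_W2 :: "('a::euclidean_space measure \<Rightarrow> ereal) \<Rightarrow> bool" where
  "lsc_W2 \<phi> \<longleftrightarrow>
     (\<forall>\<mu>\<in>P2. \<forall>\<mu>s. (\<forall>n. \<mu>s n \<in> P2) \<longrightarrow> (\<lambda>n. W2 (\<mu>s n) \<mu>) \<longlonglongrightarrow> 0 \<longrightarrow>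
        \<phi> \<mu> \<le> liminf (\<lambda>n. \<phi> (\<mu>s n)))"

definition convex_gen_geodesics :: "('a::euclidean_space measure \<Rightarrow> ereal) \<Rightarrow> bool" where
  "convex_gen_geodesics \<phi> \<longleftrightarrow>
     (\<forall>\<mu>\<in>P2. \<forall>\<pi>\<in>P2. \<forall>\<nu>\<in>P2_abs. \<forall>t\<in>{0..1}.
        \<phi> (distr \<nu> borel (\<lambda>x. t *\<^sub>R optimal_map \<nu> \<mu> x + (1 - t) *\<^sub>R optimal_map \<nu> \<pi> x))
          \<le> ereal t * \<phi> \<mu> + ereal (1 - t) * \<phi> \<pi>)"

definition bounded_below :: "('a::euclidean_space measure \<Rightarrow> ereal) \<Rightarrow> bool" where
  "bounded_below \<phi> \<longleftrightarrow> (\<exists>b::real. \<forall>\<mu>\<in>P2. ereal b \<le> \<phi> \<mu>)"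

definition quadratic_growth :: "('a::euclidean_space \<Rightarrow> real) \<Rightarrow> bool" where
  "quadratic_growth f \<longleftrightarrow> (\<exists>a>0. \<forall>x. \<bar>f x\<bar> \<le> a * ((norm x)\<^sup>2 + 1))"

definition potential_energy :: "('a::euclidean_space \<Rightarrow> real) \<Rightarrow> 'a measure \<Rightarrow> real" where
  "potential_energy f \<mu> = (\<integral>x. f x \<partial>\<mu>)"

definition optimal_value :: "('a::euclidean_space measure \<Rightarrow> ereal) \<Rightarrow> ereal" where
  "optimal_value \<phi> = (INF \<mu>\<in>P2. \<phi> \<mu>)"

text \<open>\<open>JKO \<eta> \<phi> \<mu>\<close> is the set usually written \<open>JKO\<close> with subscript \<open>\<eta>\<phi>\<close>.\<close>

definition JKO ::
  "real \<Rightarrow> ('a::euclidean_space measure \<Rightarrow> ereal) \<Rightarrow> 'a measure \<Rightarrow> 'a measure set" where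
  "JKO \<eta> \<phi> \<mu> =
     {\<nu>. is_arg_min (\<lambda>\<nu>. \<phi> \<nu> + ereal (1 / (2 * \<eta>) * (W2 \<mu> \<nu>)\<^sup>2)) (\<lambda>\<nu>. \<nu> \<in> P2) \<nu>}"


section \<open>Frechet subdifferential and the Lojasiewicz condition\<close>

definition L2_maps :: "'a::euclidean_space measure \<Rightarrow> ('a \<Rightarrow> 'a) set" where
  "L2_maps \<mu> = {\<xi> \<in> borel_measurable borel. (\<integral>\<^sup>+x. ennreal ((norm (\<xi> x))\<^sup>2) \<partial>\<mu>) < \<infinity>}"

definition L2_norm :: "'a::euclidean_space measure \<Rightarrow> ('a \<Rightarrow> 'a) \<Rightarrow> real" where
  "L2_norm \<mu> \<xi> = sqrt (\<integral>x. (norm (\<xi> x))\<^sup>2 \<partial>\<mu>)"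

definition frechet_subdiff ::
  "('a::euclidean_space measure \<Rightarrow> ereal) \<Rightarrow> 'a measure \<Rightarrow> ('a \<Rightarrow> 'a) set" where
  "frechet_subdiff \<phi> \<mu> =
     {\<xi> \<in> L2_maps \<mu>. \<mu> \<in> domain \<phi> \<and>
        (\<exists>r::real \<Rightarrow> real. ((\<lambda>s. r s / s) \<longlongrightarrow> 0) (at_right 0) \<and>
           (\<forall>\<nu>\<in>P2. \<phi> \<nu> - \<phi> \<mu> \<ge>
              (SUP \<gamma>\<in>optimal_plans \<mu> \<nu>. ereal (\<integral>z. \<xi> (fst z) \<bullet> (snd z - fst z) \<partial>\<gamma>))
                + ereal (r (W2 \<mu> \<nu>))))}"

text \<open>The conventions \<open>0\<^sup>0 = 0\<close> and \<open>inf {} = +\<infinity>\<close> are those of \<open>powr\<close> and of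
  \<open>Inf\<close> on \<^typ>\<open>ereal\<close>.\<close>

definition lojasiewicz ::
  "('a::euclidean_space measure \<Rightarrow> ereal) \<Rightarrow> ereal \<Rightarrow> real \<Rightarrow> real \<Rightarrow> bool" where
  "lojasiewicz \<phi> r\<^sub>0 c \<theta> \<longleftrightarrow>
     optimal_value \<phi> < r\<^sub>0 \<and> 0 \<le> \<theta> \<and> \<theta> < 1 \<and> 0 < c \<and>
     (\<forall>\<mu>\<in>P2. \<phi> \<mu> - optimal_value \<phi> < r\<^sub>0 \<longrightarrow>
        ereal (c * real_of_ereal (\<phi> \<mu> - optimal_value \<phi>) powr \<theta>)
          \<le> (INF \<xi>\<in>frechet_subdiff \<phi> \<mu>. ereal (L2_norm \<mu> \<xi>)))"


section \<open>Twice continuously differentiable functions\<close>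

definition grad :: "('a::euclidean_space \<Rightarrow> real) \<Rightarrow> 'a \<Rightarrow> 'a" where
  "grad f x = (THE g. GDERIV f x :> g)"

definition hessian :: "('a::euclidean_space \<Rightarrow> real) \<Rightarrow> 'a \<Rightarrow> ('a \<Rightarrow>\<^sub>L 'a)" where
  "hessian f x = (THE A. (grad f has_derivative blinfun_apply A) (at x))"

definition C2 :: "('a::euclidean_space \<Rightarrow> real) \<Rightarrow> bool" where
  "C2 f \<longleftrightarrow> (\<forall>x. f differentiable (at x)) \<and> (\<forall>x. grad f differentiable (at x)) \<and>
     continuous_on UNIV (hessian f)"

end

theory Submission
  imports Defs
begin

text \<open>
  Write \<open>\<Phi>\<close> for the sum of the potential energy of \<open>G\<close> and the functional \<open>\<H>\<close>, so that the functional to be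
  minimized is \<open>\<Phi>\<close> minus the potential energy of \<open>H\<close>, and let \<open>a n\<close> be its gap to the optimal value
  after \<open>n\<close> steps.

  One step.  The forward map \<open>w \<mapsto> w + \<eta> *\<^sub>R \<nabla>H w\<close> is expanding, hence injective with a Borel inverse,
  and the backward step can be read as a minimization over plans that start at \<open>\<mu> n\<close>: the measure
  \<open>\<mu> (Suc n)\<close>, together with a plan that transports \<open>w\<close> to \<open>y\<close>, minimizes \<open>\<Phi>\<close> plus the mean of
  \<open>(norm (w - y))\<^sup>2 / (2 * \<eta>) - \<nabla>H w \<bullet> (y - w)\<close> (\<open>near_minimal_exists\<close>).  Comparison with the plan that
  moves nothing shows that the step decreases the functional by at least the mean of
  \<open>(norm (w - y))\<^sup>2 / (2 * \<eta>)\<close> plus a Bregman divergence of \<open>H\<close>.  Comparison with perturbations of \<open>y\<close>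
  shows that the conditional mean, given \<open>y\<close>, of the residual \<open>(w - y) / \<eta> + \<nabla>H w - \<nabla>H y\<close> is a Frechet
  subgradient at \<open>\<mu> (Suc n)\<close>.  Co-coercivity of the gradient of \<open>H\<close> bounds the norm of the residual by
  the dissipated energy, and the Lojasiewicz condition turns this into
  \<open>a (Suc n) powr (2 * \<theta>) \<le> const * (a n - a (Suc n))\<close> (\<open>step_estimate\<close>).

  The argument runs on almost minimal plans.  Two plans with a common marginal are glued by drawing
  independently inside small cells of the common space; this preserves both plans exactly and
  identifies the two middle points up to the size of a cell (locale \<open>gluing\<close>).  Cell averages stand
  for conditional means; they are subgradients up to small errors, and a minimal-norm argument in
  \<open>L\<^sup>2\<close> extracts an exact subgradient from them (\<open>frechet_subdiff_of_approximate\<close>).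

  The sequence.  The recursion for \<open>a\<close> makes the step lengths summable and bounds the remaining length
  by powers of the gap (locale \<open>lojasiewicz_sequence\<close>).  The space of measures is complete, because a
  sequence of near-optimal plans is realized by one chain of random variables that is Cauchy in
  \<open>L\<^sup>2\<close> (\<open>W2_complete\<close>), so the iterates converge; the gaps tend to zero and the functional is lower
  semicontinuous, so the limit is a minimizer.

  Rates.  For \<open>\<theta> = 0\<close> the gap vanishes after finitely many steps, for \<open>\<theta> < 1/2\<close> it decays faster than
  geometrically, and for \<open>\<theta> > 1/2\<close> it is compared with a power of \<open>n\<close>.  The constant \<open>M\<close> matters only
  for \<open>\<theta> = 1/2\<close>.  It corresponds to the recursion with the constant \<open>2 * (1 + l\<^sup>2) / (\<eta> * c\<^sup>2)\<close>, where
  \<open>l = \<eta> * L\<^sub>H\<close>, while the argument above yields \<open>2 * (1 + l) / (\<eta> * c\<^sup>2)\<close>, which is larger if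
  \<open>0 < l < 1\<close>.  The difference is made up by the backward problem with step size \<open>\<eta> / 2\<close>: the minimal
  value drops between the two step sizes, by an amount that the slope at the intermediate minimizer
  controls (\<open>step_estimate_half\<close>).
\<close>

section \<open>Square-integrable vector fields\<close>

definition sq_integrable :: "'b measure \<Rightarrow> ('b \<Rightarrow> 'a::euclidean_space) \<Rightarrow> bool" where
  "sq_integrable M f \<longleftrightarrow> f \<in> borel_measurable M \<and> integrable M (\<lambda>x. (norm (f x))\<^sup>2)"

text \<open>Unlike \<^const>\<open>L2_norm\<close>, this norm is also used for fields on spaces of plans.\<close>

definition l2norm :: "'b measure \<Rightarrow> ('b \<Rightarrow> 'a::euclidean_space) \<Rightarrow> real" where
  "l2norm M f = sqrt (\<integral>x. (norm (f x))\<^sup>2 \<partial>M)"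

lemma sq_integrableD:
  assumes "sq_integrable M f"
  shows "f \<in> borel_measurable M" "integrable M (\<lambda>x. (norm (f x))\<^sup>2)"
  using assms unfolding sq_integrable_def by auto

lemma l2norm_nonneg [simp]: "0 \<le> l2norm M f"
  by (simp add: l2norm_def)

lemma l2norm_power2: "(l2norm M f)\<^sup>2 = (\<integral>x. (norm (f x))\<^sup>2 \<partial>M)"
  by (simp add: l2norm_def)

lemma l2norm_le_iff: "0 \<le> b \<Longrightarrow> l2norm M f \<le> b \<longleftrightarrow> (\<integral>x. (norm (f x))\<^sup>2 \<partial>M) \<le> b\<^sup>2"
  unfolding l2norm_def by (metis real_sqrt_le_iff real_sqrt_unique)

lemma norm_add_sq_le: "(norm (x + y))\<^sup>2 \<le> 2 * (norm x)\<^sup>2 + 2 * (norm (y::'a::real_inner))\<^sup>2"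
proof -
  have "(norm (x + y))\<^sup>2 + (norm (x - y))\<^sup>2 = 2 * (norm x)\<^sup>2 + 2 * (norm y)\<^sup>2"
    by (simp add: power2_norm_eq_inner inner_simps inner_commute)
  then show ?thesis
    using zero_le_power2[of "norm (x - y)"] by linarith
qed

lemma sq_integrable_dominated:
  assumes "integrable M h" "f \<in> borel_measurable M" "\<And>x. x \<in> space M \<Longrightarrow> (norm (f x))\<^sup>2 \<le> h x"
  shows "sq_integrable M f"
  unfolding sq_integrable_def
proof (intro conjI assms(2) Bochner_Integration.integrable_bound[OF assms(1)])
  show "(\<lambda>x. (norm (f x))\<^sup>2) \<in> borel_measurable M"
    using assms(2) by measurable
  show "AE x in M. norm ((norm (f x))\<^sup>2) \<le> norm (h x)"
  proof (intro AE_I2)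
    fix x assume "x \<in> space M"
    from assms(3)[OF this] show "norm ((norm (f x))\<^sup>2) \<le> norm (h x)"
      by simp
  qed
qed

lemma sq_integrable_add:
  assumes "sq_integrable M f" "sq_integrable M g"
  shows "sq_integrable M (\<lambda>x. f x + g x)"
proof (rule sq_integrable_dominated)
  show "integrable M (\<lambda>x. 2 * (norm (f x))\<^sup>2 + 2 * (norm (g x))\<^sup>2)"
    using assms[THEN sq_integrableD(2)] by simp
  show "(\<lambda>x. f x + g x) \<in> borel_measurable M"
    using assms[THEN sq_integrableD(1)] by measurable
qed (rule norm_add_sq_le)

lemma sq_integrable_scaleR:
  assumes "sq_integrable M f"
  shows "sq_integrable M (\<lambda>x. c *\<^sub>R f x)"
proof -
  note [measurable] = sq_integrableD(1)[OF assms]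
  show ?thesis
    using sq_integrableD(2)[OF assms] unfolding sq_integrable_def
    by (auto simp: power_mult_distrib)
qed

lemma sq_integrable_diff:
  assumes "sq_integrable M f" "sq_integrable M g"
  shows "sq_integrable M (\<lambda>x. f x - g x)"
  using sq_integrable_add[OF assms(1) sq_integrable_scaleR[OF assms(2), of "-1"]] by simp

lemma (in finite_measure) sq_integrable_linear_growth:
  assumes "sq_integrable M f" "g \<in> borel_measurable M"
    and "\<And>x. x \<in> space M \<Longrightarrow> norm (g x) \<le> a + b * norm (f x)"
  shows "sq_integrable M g"
proof (rule sq_integrable_dominated)
  show "integrable M (\<lambda>x. 2 * a\<^sup>2 + 2 * b\<^sup>2 * (norm (f x))\<^sup>2)"
    using sq_integrableD(2)[OF assms(1)] by auto
  show "(norm (g x))\<^sup>2 \<le> 2 * a\<^sup>2 + 2 * b\<^sup>2 * (norm (f x))\<^sup>2" if "x \<in> space M" for x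
  proof -
    have "(norm (g x))\<^sup>2 \<le> (a + b * norm (f x))\<^sup>2"
      using assms(3)[OF that] by (simp add: power_mono)
    also have "\<dots> \<le> 2 * a\<^sup>2 + 2 * (b * norm (f x))\<^sup>2"
      using norm_add_sq_le[of a "b * norm (f x)"] by simp
    finally show ?thesis by (simp add: power_mult_distrib)
  qed
qed (rule assms(2))

lemma (in finite_measure) sq_integrable_const: "sq_integrable M (\<lambda>x. c)"
  unfolding sq_integrable_def by auto

lemma integrable_mult_norms:
  assumes "sq_integrable M f" "sq_integrable M g"
  shows "integrable M (\<lambda>x. norm (f x) * norm (g x))"
proof (rule Bochner_Integration.integrable_bound)
  show "integrable M (\<lambda>x. (norm (f x))\<^sup>2 + (norm (g x))\<^sup>2)"
    using assms by (auto dest: sq_integrableD)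
  show "(\<lambda>x. norm (f x) * norm (g x)) \<in> borel_measurable M"
    using assms[THEN sq_integrableD(1)] by measurable
  have "a * b \<le> a\<^sup>2 + b\<^sup>2" if "0 \<le> a" "0 \<le> b" for a b :: real
    using sum_squares_bound[of a b] mult_nonneg_nonneg[OF that] by linarith
  then show "AE x in M. norm (norm (f x) * norm (g x)) \<le> norm ((norm (f x))\<^sup>2 + (norm (g x))\<^sup>2)"
    by (intro AE_I2) simp
qed

lemma integrable_inner_sq:
  fixes f g :: "'b \<Rightarrow> 'a::euclidean_space"
  assumes "sq_integrable M f" "sq_integrable M g"
  shows "integrable M (\<lambda>x. f x \<bullet> g x)"
proof (rule Bochner_Integration.integrable_bound[OF integrable_mult_norms[OF assms]])
  show "(\<lambda>x. f x \<bullet> g x) \<in> borel_measurable M"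
    using assms[THEN sq_integrableD(1)] by measurable
qed (auto simp: Cauchy_Schwarz_ineq2)

lemma (in finite_measure) integrable_norm_sq:
  assumes "sq_integrable M f" shows "integrable M (\<lambda>x. norm (f x))"
  using integrable_mult_norms[OF assms sq_integrable_const[of "1::real"]] by simp

lemma integral_mult_norms_le:
  assumes "sq_integrable M f" "sq_integrable M g"
  shows "(\<integral>x. norm (f x) * norm (g x) \<partial>M) \<le> l2norm M f * l2norm M g"
proof -
  note [measurable] = assms[THEN sq_integrableD(1)]
  note i = assms[THEN sq_integrableD(2)]
  have "(\<integral>\<^sup>+x. ennreal (norm (f x)) * ennreal (norm (g x)) \<partial>M)\<^sup>2
      \<le> (\<integral>\<^sup>+x. (ennreal (norm (f x)))\<^sup>2 \<partial>M) * (\<integral>\<^sup>+x. (ennreal (norm (g x)))\<^sup>2 \<partial>M)"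
    by (rule Cauchy_Schwarz_nn_integral) auto
  also have "(\<integral>\<^sup>+x. (ennreal (norm (f x)))\<^sup>2 \<partial>M) = ennreal ((l2norm M f)\<^sup>2)"
    using nn_integral_eq_integral[OF i(1)] by (simp add: ennreal_power l2norm_power2)
  also have "(\<integral>\<^sup>+x. (ennreal (norm (g x)))\<^sup>2 \<partial>M) = ennreal ((l2norm M g)\<^sup>2)"
    using nn_integral_eq_integral[OF i(2)] by (simp add: ennreal_power l2norm_power2)
  also have "(\<integral>\<^sup>+x. ennreal (norm (f x)) * ennreal (norm (g x)) \<partial>M)
      = ennreal (\<integral>x. norm (f x) * norm (g x) \<partial>M)"
    using nn_integral_eq_integral[OF integrable_mult_norms[OF assms]]
    by (simp add: ennreal_mult)
  finally have "(\<integral>x. norm (f x) * norm (g x) \<partial>M)\<^sup>2 \<le> (l2norm M f * l2norm M g)\<^sup>2"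
    by (simp add: ennreal_power ennreal_mult[symmetric] power_mult_distrib)
  then show ?thesis
    by (rule power2_le_imp_le) simp
qed

lemma integral_inner_le:
  fixes f g :: "'b \<Rightarrow> 'a::euclidean_space"
  assumes "sq_integrable M f" "sq_integrable M g"
  shows "\<bar>\<integral>x. f x \<bullet> g x \<partial>M\<bar> \<le> l2norm M f * l2norm M g"
proof -
  have "\<bar>\<integral>x. f x \<bullet> g x \<partial>M\<bar> \<le> (\<integral>x. \<bar>f x \<bullet> g x\<bar> \<partial>M)"
    by (rule integral_abs_bound)
  also have "\<dots> \<le> (\<integral>x. norm (f x) * norm (g x) \<partial>M)"
    using integrable_inner_sq[OF assms] integrable_mult_norms[OF assms]
    by (intro integral_mono) (auto simp: Cauchy_Schwarz_ineq2)
  finally show ?thesis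
    using integral_mult_norms_le[OF assms] by linarith
qed

lemma l2norm_add_power2:
  fixes f g :: "'b \<Rightarrow> 'a::euclidean_space"
  assumes "sq_integrable M f" "sq_integrable M g"
  shows "(l2norm M (\<lambda>x. f x + g x))\<^sup>2 = (l2norm M f)\<^sup>2 + 2 * (\<integral>x. f x \<bullet> g x \<partial>M) + (l2norm M g)\<^sup>2"
proof -
  have "(norm (f x + g x))\<^sup>2 = (norm (f x))\<^sup>2 + 2 * (f x \<bullet> g x) + (norm (g x))\<^sup>2" for x
    by (simp add: power2_norm_eq_inner inner_simps inner_commute)
  then show ?thesis
    using assms[THEN sq_integrableD(2)] integrable_inner_sq[OF assms]
    by (simp add: l2norm_power2)
qed

lemma l2norm_triangle:
  fixes f g :: "'b \<Rightarrow> 'a::euclidean_space"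
  assumes "sq_integrable M f" "sq_integrable M g"
  shows "l2norm M (\<lambda>x. f x + g x) \<le> l2norm M f + l2norm M g"
proof (rule power2_le_imp_le)
  show "(l2norm M (\<lambda>x. f x + g x))\<^sup>2 \<le> (l2norm M f + l2norm M g)\<^sup>2"
    unfolding l2norm_add_power2[OF assms] power2_sum
    using integral_inner_le[OF assms] by linarith
qed simp

lemma l2norm_scaleR: "l2norm M (\<lambda>x. c *\<^sub>R f x) = \<bar>c\<bar> * l2norm M f"
  by (simp add: l2norm_def power_mult_distrib real_sqrt_mult)

lemma l2norm_mono:
  assumes "sq_integrable M f" "sq_integrable M g" "AE x in M. norm (f x) \<le> norm (g x)"
  shows "l2norm M f \<le> l2norm M g"
  unfolding l2norm_def real_sqrt_le_iff
  using assms by (intro integral_mono_AE) (auto dest: sq_integrableD intro: power_mono)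

lemma (in prob_space) l2norm_const [simp]: "l2norm M (\<lambda>x. c) = norm c"
  by (simp add: l2norm_def prob_space)

lemma (in prob_space) integral_norm_le_l2norm:
  assumes "sq_integrable M f"
  shows "(\<integral>x. norm (f x) \<partial>M) \<le> l2norm M f"
  using integral_mult_norms_le[OF assms sq_integrable_const[of "1::real"]] by simp

lemma (in prob_space) norm_integral_le_l2norm:
  assumes "sq_integrable M f"
  shows "norm (\<integral>x. f x \<partial>M) \<le> l2norm M f"
  using integral_norm_bound[of M f] integral_norm_le_l2norm[OF assms] by linarith

text \<open>Riesz--Fischer: a subsequence whose increments have summable mean converges almost everywhere,
  and Fatou's lemma turns the Cauchy condition into convergence to the pointwise limit.\<close>

lemma (in prob_space) l2_complete:
  fixes f :: "nat \<Rightarrow> 'a \<Rightarrow> 'b::euclidean_space"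
  assumes f: "\<And>n. sq_integrable M (f n)"
    and Cauchy: "\<And>e. 0 < e \<Longrightarrow> \<exists>N. \<forall>m\<ge>N. \<forall>n\<ge>N. l2norm M (\<lambda>x. f m x - f n x) < e"
  obtains g where "sq_integrable M g" "(\<lambda>n. l2norm M (\<lambda>x. f n x - g x)) \<longlonglongrightarrow> 0"
proof -
  note [measurable] = sq_integrableD(1)[OF f]
  have "\<forall>k. \<exists>N. \<forall>m\<ge>N. \<forall>n\<ge>N. l2norm M (\<lambda>x. f m x - f n x) < (1/2)^k"
    using Cauchy by simp
  then obtain N where N: "\<And>k m n. N k \<le> m \<Longrightarrow> N k \<le> n \<Longrightarrow> l2norm M (\<lambda>x. f m x - f n x) < (1/2)^k"
    by metis
  define s where "s = rec_nat (N 0) (\<lambda>k r. max (Suc r) (N (Suc k)))"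
  have s_Suc: "s (Suc k) = max (Suc (s k)) (N (Suc k))" for k
    by (simp add: s_def)
  have sN: "N k \<le> s k" for k
    by (cases k) (auto simp: s_def)
  have s_mono: "strict_mono s"
    by (rule strict_mono_Suc_iff[THEN iffD2]) (auto simp: s_Suc less_max_iff_disj)
  define d where "d k x = f (s (Suc k)) x - f (s k) x" for k x
  have d_sq: "sq_integrable M (d k)" for k
    unfolding d_def by (intro sq_integrable_diff f)
  have d_small: "(\<integral>x. norm (d k x) \<partial>M) \<le> (1/2)^k" for k
  proof -
    have "s k \<le> s (Suc k)"
      using s_mono by (simp add: strict_mono_less_eq)
    then have "l2norm M (d k) < (1/2)^k"
      unfolding d_def by (intro N) (meson order_trans sN)+
    then show ?thesis
      using integral_norm_le_l2norm[OF d_sq[of k]] by linarith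
  qed
  have [measurable]: "d k \<in> borel_measurable M" for k
    by (rule sq_integrableD(1)[OF d_sq])
  have "(\<integral>\<^sup>+x. (\<Sum>k. ennreal (norm (d k x))) \<partial>M) = (\<Sum>k. \<integral>\<^sup>+x. ennreal (norm (d k x)) \<partial>M)"
    by (rule nn_integral_suminf) auto
  also have "\<dots> \<le> (\<Sum>k. ennreal ((1/2)^k))"
    using d_small
    by (intro suminf_le) (auto simp: nn_integral_eq_integral integrable_norm_sq[OF d_sq] intro!: ennreal_leI)
  also have "\<dots> < \<infinity>"
    by (simp add: suminf_ennreal_eq[of _ 2] geometric_sums[of "1/2::real", simplified])
  finally have "(\<integral>\<^sup>+x. (\<Sum>k. ennreal (norm (d k x))) \<partial>M) \<noteq> \<infinity>"
    by simp
  then have "AE x in M. (\<Sum>k. ennreal (norm (d k x))) \<noteq> \<infinity>"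
    by (intro nn_integral_PInf_AE) auto
  then have conv: "AE x in M. convergent (\<lambda>k. f (s k) x)"
  proof eventually_elim
    case (elim x)
    then have "summable (\<lambda>k. norm (d k x))"
      by (intro summable_suminf_not_top) auto
    then have "summable (\<lambda>k. d k x)"
      by (rule summable_norm_cancel)
    then have "convergent (\<lambda>n. f (s 0) x + (\<Sum>k<n. d k x))"
      by (intro convergent_add convergent_const) (simp add: summable_iff_convergent)
    moreover have "f (s 0) x + (\<Sum>k<n. d k x) = f (s n) x" for n
      unfolding d_def by (simp add: sum_lessThan_telescope[of "\<lambda>k. f (s k) x"])
    ultimately show ?case by simp
  qed
  define g where "g x = lim (\<lambda>k. f (s k) x)" for x
  have [measurable]: "g \<in> borel_measurable M"
    unfolding g_def by measurable
  have lim: "AE x in M. (\<lambda>k. f (s k) x) \<longlonglongrightarrow> g x"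
    using conv by eventually_elim (simp add: g_def convergent_LIMSEQ_iff)
  have fatou: "(\<integral>\<^sup>+x. ennreal ((norm (f n x - g x))\<^sup>2) \<partial>M) \<le> ennreal (((1/2)^j)\<^sup>2)"
    if n: "N j \<le> n" for n j
  proof -
    have "(\<integral>\<^sup>+x. ennreal ((norm (f n x - g x))\<^sup>2) \<partial>M)
        = (\<integral>\<^sup>+x. liminf (\<lambda>k. ennreal ((norm (f n x - f (s k) x))\<^sup>2)) \<partial>M)"
    proof (intro nn_integral_cong_AE, use lim in eventually_elim)
      case (elim x)
      have "(\<lambda>k. ennreal ((norm (f n x - f (s k) x))\<^sup>2)) \<longlonglongrightarrow> ennreal ((norm (f n x - g x))\<^sup>2)"
        by (intro tendsto_ennrealI tendsto_intros elim)
      then show ?case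
        by (intro lim_imp_Liminf[symmetric]) simp_all
    qed
    also have "\<dots> \<le> liminf (\<lambda>k. \<integral>\<^sup>+x. ennreal ((norm (f n x - f (s k) x))\<^sup>2) \<partial>M)"
      by (intro nn_integral_liminf) auto
    also have "\<dots> \<le> ennreal (((1/2)^j)\<^sup>2)"
    proof (rule Liminf_le)
      have "(\<integral>\<^sup>+x. ennreal ((norm (f n x - f (s k) x))\<^sup>2) \<partial>M) \<le> ennreal (((1/2)^j)\<^sup>2)"
        if "j \<le> k" for k
      proof -
        have "N j \<le> s k"
          using sN[of j] s_mono that by (meson order_trans strict_mono_less_eq)
        then have "l2norm M (\<lambda>x. f n x - f (s k) x) \<le> (1/2)^j"
          using N[OF n] by (simp add: less_imp_le)
        moreover have "(\<integral>\<^sup>+x. ennreal ((norm (f n x - f (s k) x))\<^sup>2) \<partial>M)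
            = ennreal ((l2norm M (\<lambda>x. f n x - f (s k) x))\<^sup>2)"
          using sq_integrableD(2)[OF sq_integrable_diff[OF f f]]
          by (simp add: nn_integral_eq_integral l2norm_power2)
        ultimately show ?thesis
          by (auto intro!: ennreal_leI power_mono)
      qed
      then show "\<forall>\<^sub>F k in sequentially.
          (\<integral>\<^sup>+x. ennreal ((norm (f n x - f (s k) x))\<^sup>2) \<partial>M) \<le> ennreal (((1/2)^j)\<^sup>2)"
        by (rule eventually_sequentiallyI)
    qed simp
    finally show ?thesis .
  qed
  have diff_sq: "sq_integrable M (\<lambda>x. f n x - g x)" if "N j \<le> n" for n j
    unfolding sq_integrable_def
  proof (intro conjI integrableI_nonneg)
    show "(\<integral>\<^sup>+x. ennreal ((norm (f n x - g x))\<^sup>2) \<partial>M) < \<infinity>"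
      using fatou[OF that] by (rule order_le_less_trans) simp
  qed auto
  have "sq_integrable M (\<lambda>x. f (N 0) x - (f (N 0) x - g x))"
    by (intro sq_integrable_diff f diff_sq[of 0]) auto
  then have g: "sq_integrable M g" by simp
  have "(\<lambda>n. l2norm M (\<lambda>x. f n x - g x)) \<longlonglongrightarrow> 0"
  proof (rule LIMSEQ_I)
    fix r :: real assume "0 < r"
    then obtain j where j: "(1/2)^j < r"
      using real_arch_pow_inv[of r "1/2"] by auto
    have "l2norm M (\<lambda>x. f n x - g x) \<le> (1/2)^j" if "N j \<le> n" for n
    proof -
      have "ennreal (\<integral>x. (norm (f n x - g x))\<^sup>2 \<partial>M) \<le> ennreal (((1/2)^j)\<^sup>2)"
        using fatou[OF that] sq_integrableD(2)[OF diff_sq[OF that]]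
        by (simp add: nn_integral_eq_integral)
      then show ?thesis
        by (simp add: l2norm_le_iff)
    qed
    then show "\<exists>no. \<forall>n\<ge>no. norm (l2norm M (\<lambda>x. f n x - g x) - 0) < r"
      using j by (intro exI[of _ "N j"]) (auto intro: le_less_trans)
  qed
  with g show thesis ..
qed

section \<open>Convex functions\<close>

text \<open>The slope of a convex function between \<open>x\<close> and \<open>y\<close> is at most its slope from \<open>x\<close> to a point further
  along the ray; the quadratic bound at a distance comparable to the size of the points gives a
  slope of linear growth.\<close>

lemma convex_quadratic_growth_lipschitz_bound:
  fixes G :: "'a::euclidean_space \<Rightarrow> real"
  assumes "convex_on UNIV G" "quadratic_growth G"
  obtains C where "0 \<le> C" "\<And>x y. \<bar>G x - G y\<bar> \<le> C * (1 + norm x + norm y) * norm (x - y)"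
proof -
  obtain a where a: "0 < a" "\<And>x. \<bar>G x\<bar> \<le> a * ((norm x)\<^sup>2 + 1)"
    using assms(2) unfolding quadratic_growth_def by blast
  have one: "G y - G x \<le> 7 * a * (1 + norm x + norm y) * norm (x - y)" for x y
  proof (cases "x = y")
    case False
    define d where "d = norm (y - x)"
    define R where "R = 1 + norm x + norm y"
    define z where "z = y + (R / d) *\<^sub>R (y - x)"
    define l where "l = d / (d + R)"
    have d: "0 < d" using False by (simp add: d_def)
    have R: "1 \<le> R" by (simp add: R_def)
    have l: "0 \<le> l" "l \<le> 1" "l \<le> d / R"
      using d R by (simp_all add: l_def frac_le)
    \<comment> \<open>Past \<open>y\<close> on the ray from \<open>x\<close>, at distance \<open>R\<close>, a point \<open>z\<close> with norm of order \<open>R\<close>.\<close>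
    have "(1 - l) *\<^sub>R x + l *\<^sub>R z = x + (l * (1 + R / d)) *\<^sub>R (y - x)"
      by (simp add: z_def algebra_simps)
    also have "l * (1 + R / d) = 1"
    proof -
      have "1 + R / d = (d + R) / d" using d by (simp add: field_simps)
      then show ?thesis using d R by (simp add: l_def)
    qed
    finally have "(1 - l) *\<^sub>R x + l *\<^sub>R z = y" by simp
    then have "G y \<le> (1 - l) * G x + l * G z"
      using convex_onD[OF assms(1) l(1,2), of x z] by simp
    then have "G y - G x \<le> l * (G z - G x)" by (simp add: algebra_simps)
    also have "\<dots> \<le> l * (a * ((2 * R)\<^sup>2 + 1) + a * (R\<^sup>2 + 1))"
    proof (intro mult_left_mono l)
      have "norm z \<le> norm y + norm ((R / d) *\<^sub>R (y - x))"
        unfolding z_def by (rule norm_triangle_ineq)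
      also have "norm ((R / d) *\<^sub>R (y - x)) = R"
        using d R by (simp add: d_def)
      also have "norm y + R \<le> 2 * R" by (simp add: R_def)
      finally have "(norm z)\<^sup>2 \<le> (2 * R)\<^sup>2" by (rule power_mono) simp
      moreover have "(norm x)\<^sup>2 \<le> R\<^sup>2" by (simp add: R_def power_mono)
      ultimately have "a * ((norm z)\<^sup>2 + 1) \<le> a * ((2 * R)\<^sup>2 + 1)" "a * ((norm x)\<^sup>2 + 1) \<le> a * (R\<^sup>2 + 1)"
        using a(1) by simp_all
      then show "G z - G x \<le> a * ((2 * R)\<^sup>2 + 1) + a * (R\<^sup>2 + 1)"
        using a(2)[of z] a(2)[of x] by linarith
    qed
    also have "\<dots> \<le> (d / R) * (a * ((2 * R)\<^sup>2 + 1) + a * (R\<^sup>2 + 1))"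
      using l a(1) by (intro mult_right_mono) auto
    also have "\<dots> \<le> (d / R) * (7 * a * R\<^sup>2)"
    proof (intro mult_left_mono)
      have "1 \<le> R\<^sup>2" using R by simp
      then have "a * 1 \<le> a * R\<^sup>2" using a(1) by (intro mult_left_mono) auto
      then show "a * ((2 * R)\<^sup>2 + 1) + a * (R\<^sup>2 + 1) \<le> 7 * a * R\<^sup>2"
        by (simp add: algebra_simps power2_eq_square)
    qed (use d R in auto)
    also have "\<dots> = 7 * a * R * d"
      using R by (simp add: power2_eq_square)
    finally show ?thesis
      by (simp add: d_def R_def norm_minus_commute)
  qed simp
  have "\<bar>G x - G y\<bar> \<le> 7 * a * (1 + norm x + norm y) * norm (x - y)" for x y
  proof -
    have "norm (y - x) = norm (x - y)" "1 + norm y + norm x = 1 + norm x + norm y"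
      by (simp_all add: norm_minus_commute)
    then show ?thesis using one[of x y] one[of y x] by (simp only: abs_le_iff minus_diff_eq)
  qed
  with a(1) show thesis by (intro that[of "7 * a"]) auto
qed

lemma grad_eqI:
  assumes "GDERIV f x :> D" shows "grad f x = D"
proof -
  have "E = D" if "GDERIV f x :> E" for E
  proof -
    have "(\<lambda>h. h \<bullet> E) = (\<lambda>h. h \<bullet> D)"
      using has_derivative_unique[OF that[unfolded gderiv_def] assms[unfolded gderiv_def]] .
    then have "(E - D) \<bullet> E = (E - D) \<bullet> D" by (rule fun_cong)
    then have "(E - D) \<bullet> (E - D) = 0" by (simp add: inner_diff_right)
    then show ?thesis by simp
  qed
  with assms show ?thesis
    unfolding grad_def by (rule the_equality[where P = "gderiv f x"])
qed

lemma GDERIV_grad: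
  fixes f :: "'a::euclidean_space \<Rightarrow> real"
  assumes "f differentiable (at x)"
  shows "GDERIV f x :> grad f x"
proof -
  obtain f' where f': "(f has_derivative f') (at x)"
    using assms unfolding differentiable_def by blast
  then have lin: "linear f'" by (rule has_derivative_linear)
  define D where "D = (\<Sum>b\<in>Basis. f' b *\<^sub>R b)"
  have "f' h = h \<bullet> D" for h
  proof -
    have "f' h = f' (\<Sum>b\<in>Basis. (h \<bullet> b) *\<^sub>R b)" by (simp add: euclidean_representation)
    also have "\<dots> = (\<Sum>b\<in>Basis. (h \<bullet> b) * f' b)"
      by (simp add: linear_sum[OF lin] linear_scale[OF lin])
    finally show ?thesis by (simp add: D_def inner_sum_right mult.commute)
  qed
  then have "f' = (\<lambda>h. h \<bullet> D)" by (rule ext)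
  with f' have "GDERIV f x :> D"
    unfolding gderiv_def by simp
  then show ?thesis using grad_eqI[of f x] by simp
qed

text \<open>The error of the first-order expansion of \<open>H\<close> at \<open>x\<close> with gradient \<open>g\<close>: the Bregman
  divergence.\<close>

definition bregman :: "('a::euclidean_space \<Rightarrow> real) \<Rightarrow> ('a \<Rightarrow> 'a) \<Rightarrow> 'a \<Rightarrow> 'a \<Rightarrow> real" where
  "bregman H g y x = H y - H x - g x \<bullet> (y - x)"

locale smooth_convex =
  fixes H :: "'a::euclidean_space \<Rightarrow> real" and g :: "'a \<Rightarrow> 'a" and L :: real
  assumes convex: "convex_on UNIV H"
    and gderiv: "\<And>x. GDERIV H x :> g x"
    and lipschitz: "\<And>x y. norm (g x - g y) \<le> L * norm (x - y)"
    and L_nonneg: "0 \<le> L"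
begin

lemma DERIV_line: "((\<lambda>t. H (x + t *\<^sub>R v)) has_real_derivative g (x + t *\<^sub>R v) \<bullet> v) (at t)"
proof -
  have "((\<lambda>t. H (x + t *\<^sub>R v)) has_derivative (\<lambda>s. (s *\<^sub>R v) \<bullet> g (x + t *\<^sub>R v))) (at t)"
    by (rule has_derivative_compose[where f = "\<lambda>t. x + t *\<^sub>R v", OF _ gderiv[unfolded gderiv_def]])
       (auto intro!: derivative_eq_intros)
  moreover have "(\<lambda>s. (s *\<^sub>R v) \<bullet> g (x + t *\<^sub>R v)) = (*) (g (x + t *\<^sub>R v) \<bullet> v)"
    by (simp add: fun_eq_iff inner_commute)
  ultimately show ?thesis
    unfolding has_field_derivative_def by simp
qed

text \<open>The difference quotients at \<open>x\<close> in the direction of \<open>y\<close> stay below \<open>H y - H x\<close>.\<close>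

lemma bregman_nonneg: "0 \<le> bregman H g y x"
proof -
  define v where "v = y - x"
  have "((\<lambda>t. (H (x + t *\<^sub>R v) - H x) / t) \<longlongrightarrow> g x \<bullet> v) (at_right 0)"
  proof -
    have "((\<lambda>t. (H (x + t *\<^sub>R v) - H x) / t) \<longlongrightarrow> g x \<bullet> v) (at 0)"
      using DERIV_line[of x v 0] unfolding has_field_derivative_iff by simp
    then show ?thesis by (rule filterlim_mono) (simp_all add: at_within_le_at)
  qed
  moreover have "\<forall>\<^sub>F t in at_right 0. (H (x + t *\<^sub>R v) - H x) / t \<le> H y - H x"
    unfolding eventually_at_right_field
  proof (intro exI[of _ 1] conjI allI impI)
    fix t :: real assume t: "0 < t" "t < 1"
    have "x + t *\<^sub>R v = (1 - t) *\<^sub>R x + t *\<^sub>R y" by (simp add: v_def algebra_simps)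
    then have "H (x + t *\<^sub>R v) \<le> (1 - t) * H x + t * H y"
      using convex_onD[OF convex, of t x y] t by simp
    then show "(H (x + t *\<^sub>R v) - H x) / t \<le> H y - H x"
      using t by (simp add: field_simps)
  qed simp
  ultimately have "g x \<bullet> v \<le> H y - H x"
    by (rule tendsto_upperbound) simp
  then show ?thesis by (simp add: bregman_def v_def)
qed

text \<open>The derivative of the error along the segment, at \<open>x + t *\<^sub>R (y - x)\<close>, is at most
  \<open>L * t * (norm (y - x))\<^sup>2\<close>.\<close>

lemma bregman_le: "bregman H g y x \<le> L / 2 * (norm (y - x))\<^sup>2"
proof -
  define v where "v = y - x"
  define p where "p t = H (x + t *\<^sub>R v) - t * (g x \<bullet> v) - L / 2 * (norm v)\<^sup>2 * t\<^sup>2" for t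
  have "p 1 \<le> p 0"
  proof (rule DERIV_nonpos_imp_nonincreasing[of 0 1 p])
    fix t :: real assume t: "0 \<le> t" "t \<le> 1"
    have "(p has_real_derivative g (x + t *\<^sub>R v) \<bullet> v - g x \<bullet> v - L * (norm v)\<^sup>2 * t) (at t)"
    proof -
      have "(p has_real_derivative g (x + t *\<^sub>R v) \<bullet> v - 1 * (g x \<bullet> v)
          - L / 2 * (norm v)\<^sup>2 * (real 2 * t ^ (2 - Suc 0))) (at t)"
        unfolding p_def
        by (intro DERIV_diff DERIV_line DERIV_cmult_right DERIV_ident DERIV_cmult DERIV_pow)
      then show ?thesis by (simp add: mult.assoc)
    qed
    moreover have "g (x + t *\<^sub>R v) \<bullet> v - g x \<bullet> v \<le> L * (norm v)\<^sup>2 * t"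
    proof -
      have "g (x + t *\<^sub>R v) \<bullet> v - g x \<bullet> v \<le> norm (g (x + t *\<^sub>R v) - g x) * norm v"
        by (metis inner_diff_left norm_cauchy_schwarz)
      also have "\<dots> \<le> L * norm (t *\<^sub>R v) * norm v"
        using lipschitz[of "x + t *\<^sub>R v" x] by (intro mult_right_mono) auto
      finally show ?thesis using t by (simp add: power2_eq_square mult_ac)
    qed
    ultimately show "\<exists>d. (p has_real_derivative d) (at t) \<and> d \<le> 0"
      by (intro exI[of _ "g (x + t *\<^sub>R v) \<bullet> v - g x \<bullet> v - L * (norm v)\<^sup>2 * t"]) auto
  qed simp
  then show ?thesis by (simp add: p_def bregman_def v_def)
qed

text \<open>Co-coercivity of the gradient: move from \<open>y\<close> by the gradient step of length \<open>1/L\<close> that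
  decreases \<open>z \<mapsto> bregman H g z x\<close>; this function stays nonnegative.\<close>

lemma bregman_ge: "(norm (g y - g x))\<^sup>2 \<le> 2 * L * bregman H g y x"
proof (cases "L = 0")
  case True then show ?thesis using lipschitz[of y x] by simp
next
  case False
  then have L: "0 < L" using L_nonneg by simp
  define p where "p = g y - g x"
  define z where "z = y - (1 / L) *\<^sub>R p"
  have "bregman H g z x = bregman H g y x + bregman H g z y - (1 / L) * (p \<bullet> p)"
    by (simp add: bregman_def z_def p_def algebra_simps)
  also have "bregman H g z y \<le> L / 2 * (norm (z - y))\<^sup>2" by (rule bregman_le)
  also have "L / 2 * (norm (z - y))\<^sup>2 = (1 / (2 * L)) * (p \<bullet> p)"
    using L by (simp add: z_def power_mult_distrib dot_square_norm power2_eq_square)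
  finally have "0 \<le> bregman H g y x + (1 / (2 * L) * (p \<bullet> p) - 1 / L * (p \<bullet> p))"
    using bregman_nonneg[of z x] by linarith
  also have "1 / (2 * L) * (p \<bullet> p) - 1 / L * (p \<bullet> p) = - ((p \<bullet> p) / (2 * L))"
    using L by (simp add: field_simps)
  finally show ?thesis
    using L by (simp add: p_def dot_square_norm pos_divide_le_eq mult_ac)
qed

lemma g_monotone: "0 \<le> (g x - g y) \<bullet> (x - y)"
  using bregman_nonneg[of x y] bregman_nonneg[of y x]
  by (simp add: bregman_def algebra_simps)

lemma continuous_g: "continuous_on UNIV g"
proof -
  have "L-lipschitz_on UNIV g"
    using lipschitz L_nonneg by (auto simp: lipschitz_on_def dist_norm)
  then show ?thesis by (rule lipschitz_on_continuous_on)
qed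

lemma measurable_g [measurable]: "g \<in> borel_measurable borel"
  using continuous_g by (rule borel_measurable_continuous_onI)

lemma measurable_H [measurable]: "H \<in> borel_measurable borel"
  using convex_on_continuous[OF open_UNIV convex] by (rule borel_measurable_continuous_onI)

lemma g_linear_growth: "norm (g x) \<le> norm (g 0) + L * norm x"
  using norm_triangle_ineq[of "g x - g 0" "g 0"] lipschitz[of x 0] by simp

text \<open>The forward step is expanding because the gradient of a convex function is monotone, so it has
  closed range and a continuous inverse there.\<close>

lemma forward_step_inverse:
  assumes "0 \<le> \<tau>"
  obtains R where "R \<in> borel_measurable borel" "\<And>x. R (x + \<tau> *\<^sub>R g x) = x"
proof -
  define S where "S x = x + \<tau> *\<^sub>R g x" for x
  have expand: "norm (x - y) \<le> norm (S x - S y)" for x y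
  proof (cases "x = y")
    case False
    have "norm (x - y) * norm (x - y) = (x - y) \<bullet> (x - y)"
      by (simp add: norm_eq_sqrt_inner)
    also have "\<dots> \<le> (x - y) \<bullet> (x - y) + \<tau> * ((g x - g y) \<bullet> (x - y))"
      using g_monotone assms by simp
    also have "\<dots> = (S x - S y) \<bullet> (x - y)"
      by (simp add: S_def algebra_simps)
    also have "\<dots> \<le> norm (S x - S y) * norm (x - y)"
      by (rule norm_cauchy_schwarz)
    finally show ?thesis using False by simp
  qed simp
  have inj: "inj S"
  proof (rule injI)
    fix x y assume "S x = S y" then show "x = y" using expand[of x y] by simp
  qed
  have contS: "continuous_on UNIV S"
    unfolding S_def by (intro continuous_intros continuous_g)
  have "closed (range S)"
  proof -
    have "l' \<in> range S" if f: "\<forall>n. f n \<in> range S" "f \<longlonglongrightarrow> l'" for f l'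
    proof -
      define x where "x n = inv S (f n)" for n
      have fx: "f n = S (x n)" for n
        using f(1) by (simp add: x_def f_inv_into_f)
      have "Cauchy x"
        unfolding Cauchy_def
      proof (intro allI impI)
        fix e :: real assume "0 < e"
        then obtain M where M: "\<forall>m\<ge>M. \<forall>n\<ge>M. dist (f m) (f n) < e"
          using LIMSEQ_imp_Cauchy[OF f(2)] unfolding Cauchy_def by blast
        have "dist (x m) (x n) < e" if "m \<ge> M" "n \<ge> M" for m n
        proof -
          have "dist (x m) (x n) \<le> dist (f m) (f n)"
            using expand[of "x m" "x n"] by (simp add: fx dist_norm)
          then show ?thesis using M that by (meson le_less_trans)
        qed
        then show "\<exists>M. \<forall>m\<ge>M. \<forall>n\<ge>M. dist (x m) (x n) < e" by blast
      qed
      then obtain l where "x \<longlonglongrightarrow> l" using Cauchy_convergent convergent_def by blast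
      then have "f \<longlonglongrightarrow> S l"
        unfolding fx by (intro continuous_on_tendsto_compose[OF contS]) auto
      then have "l' = S l" using f(2) by (rule LIMSEQ_unique[rotated])
      then show ?thesis by blast
    qed
    then show ?thesis unfolding closed_sequential_limits by blast
  qed
  then have range_borel: "range S \<in> sets borel" by simp
  have "continuous_on (range S) (inv S)"
  proof -
    have "1-lipschitz_on (range S) (inv S)"
    proof (rule lipschitz_onI)
      fix u v assume "u \<in> range S" "v \<in> range S"
      then have "S (inv S u) = u" "S (inv S v) = v" by (simp_all add: f_inv_into_f)
      then show "dist (inv S u) (inv S v) \<le> 1 * dist u v"
        using expand[of "inv S u" "inv S v"] by (simp add: dist_norm)
    qed simp
    then show ?thesis by (rule lipschitz_on_continuous_on)
  qed
  then have "(\<lambda>z. if z \<in> range S then inv S z else 0) \<in> borel_measurable borel"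
    by (intro borel_measurable_continuous_on_if range_borel) auto
  moreover have "(if S x \<in> range S then inv S (S x) else 0) = x" for x
    using inv_f_f[OF inj] by simp
  ultimately show thesis
    by (rule that[unfolded S_def[symmetric]])
qed

end

section \<open>Couplings and the Wasserstein distance\<close>

lemma P2_iff:
  "\<mu> \<in> P2 \<longleftrightarrow> prob_space \<mu> \<and> sets \<mu> = sets borel \<and> sq_integrable \<mu> (\<lambda>x. x)"
proof -
  have "(\<integral>\<^sup>+x. ennreal ((norm x)\<^sup>2) \<partial>\<mu>) < \<infinity> \<longleftrightarrow> sq_integrable \<mu> (\<lambda>x. x)"
    if s: "sets \<mu> = sets borel"
  proof -
    have "(\<lambda>x. x) \<in> borel_measurable \<mu>" using s by measurable
    then show ?thesis
      unfolding sq_integrable_def by (simp add: integrable_iff_bounded)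
  qed
  then show ?thesis unfolding P2_def by auto
qed

lemma P2D:
  assumes "\<mu> \<in> P2"
  shows "prob_space \<mu>" "sets \<mu> = sets borel" "sq_integrable \<mu> (\<lambda>x. x)" "space \<mu> = UNIV"
  using assms sets_eq_imp_space_eq[of \<mu> borel] by (auto simp: P2_iff)

lemma sq_integrable_distr_iff:
  assumes "X \<in> borel_measurable M" "f \<in> borel_measurable borel"
  shows "sq_integrable (distr M borel X) f \<longleftrightarrow> sq_integrable M (\<lambda>\<omega>. f (X \<omega>))"
  using assms by (simp add: sq_integrable_def integrable_distr_eq)

lemma l2norm_distr:
  assumes "X \<in> measurable M N" "f \<in> borel_measurable N"
  shows "l2norm (distr M N X) f = l2norm M (\<lambda>\<omega>. f (X \<omega>))"
  unfolding l2norm_def using assms by (subst integral_distr) auto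

lemma distr_in_P2:
  assumes "prob_space M" "sq_integrable M X"
  shows "distr M borel X \<in> P2"
  using assms sq_integrableD(1)[OF assms(2)]
  by (auto simp: P2_iff sq_integrable_distr_iff intro: prob_space.prob_space_distr)

lemma couplingsD:
  fixes \<gamma> :: "('a::euclidean_space \<times> 'a) measure"
  assumes "\<gamma> \<in> couplings \<mu> \<nu>" "\<mu> \<in> P2" "\<nu> \<in> P2"
  shows "prob_space \<gamma>" "sets \<gamma> = sets borel" "space \<gamma> = UNIV"
    "distr \<gamma> borel fst = \<mu>" "distr \<gamma> borel snd = \<nu>"
    "fst \<in> borel_measurable \<gamma>" "snd \<in> borel_measurable \<gamma>"
    "sq_integrable \<gamma> fst" "sq_integrable \<gamma> snd"
proof -
  show s: "sets \<gamma> = sets borel" and d: "distr \<gamma> borel fst = \<mu>" "distr \<gamma> borel snd = \<nu>"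
    using assms(1) by (auto simp: couplings_def)
  show "space \<gamma> = UNIV" using sets_eq_imp_space_eq[OF s] by simp
  have "fst \<in> borel_measurable (borel :: ('a \<times> 'a) measure)"
    "snd \<in> borel_measurable (borel :: ('a \<times> 'a) measure)"
    by (simp_all add: borel_prod[symmetric])
  then show m: "fst \<in> borel_measurable \<gamma>" "snd \<in> borel_measurable \<gamma>"
    by (simp_all add: measurable_cong_sets[OF s refl])
  show "prob_space \<gamma>"
    using prob_space_distrD[OF m(1)] d(1) P2D(1)[OF assms(2)] by simp
  show "sq_integrable \<gamma> fst" "sq_integrable \<gamma> snd"
    using sq_integrable_distr_iff[OF m(1), of "\<lambda>x. x"] sq_integrable_distr_iff[OF m(2), of "\<lambda>x. x"]
      d P2D(3)[OF assms(2)] P2D(3)[OF assms(3)] by auto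
qed

lemma distr_pair_in_couplings:
  fixes X Y :: "'b \<Rightarrow> 'a::euclidean_space"
  assumes [measurable]: "X \<in> borel_measurable M" "Y \<in> borel_measurable M"
  shows "distr M borel (\<lambda>\<omega>. (X \<omega>, Y \<omega>)) \<in> couplings (distr M borel X) (distr M borel Y)"
  unfolding couplings_def
  by (auto simp: distr_distr comp_def borel_prod[symmetric])

lemma transport_cost_eq_l2norm:
  assumes "sq_integrable \<gamma> (\<lambda>z. fst z - snd z)"
  shows "transport_cost \<gamma> = ennreal ((l2norm \<gamma> (\<lambda>z. fst z - snd z))\<^sup>2)"
  unfolding transport_cost_def l2norm_power2
  using sq_integrableD(2)[OF assms] by (simp add: nn_integral_eq_integral)

lemma coupling_cost:
  assumes "\<gamma> \<in> couplings \<mu> \<nu>" "\<mu> \<in> P2" "\<nu> \<in> P2"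
  shows "transport_cost \<gamma> = ennreal ((l2norm \<gamma> (\<lambda>z. fst z - snd z))\<^sup>2)"
  using couplingsD(8,9)[OF assms] by (intro transport_cost_eq_l2norm sq_integrable_diff)

lemma distr_pair_snd:
  assumes "prob_space M" "sigma_finite_measure N"
  shows "distr (M \<Otimes>\<^sub>M N) N snd = N"
proof (rule measure_eqI)
  interpret M: prob_space M by fact
  interpret N: sigma_finite_measure N by fact
  fix A assume "A \<in> sets (distr (M \<Otimes>\<^sub>M N) N snd)"
  then have A: "A \<in> sets N" by simp
  have "snd -` A \<inter> space (M \<Otimes>\<^sub>M N) = space M \<times> A"
    using sets.sets_into_space[OF A] by (auto simp: space_pair_measure)
  then show "emeasure (distr (M \<Otimes>\<^sub>M N) N snd) A = emeasure N A"
    using A by (simp add: emeasure_distr N.emeasure_pair_measure_Times M.emeasure_space_1)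
qed simp

lemma couplings_nonempty:
  assumes "\<mu> \<in> P2" "\<nu> \<in> P2" shows "couplings \<mu> \<nu> \<noteq> {}"
proof -
  interpret \<mu>: prob_space \<mu> using P2D(1)[OF assms(1)] .
  interpret \<nu>: prob_space \<nu> using P2D(1)[OF assms(2)] .
  interpret pair_prob_space \<mu> \<nu> ..
  note [measurable_cong] = P2D(2)[OF assms(1)] P2D(2)[OF assms(2)]
  have "distr (\<mu> \<Otimes>\<^sub>M \<nu>) borel fst = distr (\<mu> \<Otimes>\<^sub>M \<nu>) \<mu> fst"
    "distr (\<mu> \<Otimes>\<^sub>M \<nu>) borel snd = distr (\<mu> \<Otimes>\<^sub>M \<nu>) \<nu> snd"
    using P2D(2)[OF assms(1)] P2D(2)[OF assms(2)] by (auto intro!: distr_cong)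
  then have "distr (\<mu> \<Otimes>\<^sub>M \<nu>) borel fst = \<mu>" "distr (\<mu> \<Otimes>\<^sub>M \<nu>) borel snd = \<nu>"
    by (simp_all add: \<nu>.distr_pair_fst distr_pair_snd \<mu>.prob_space_axioms \<nu>.sigma_finite_measure_axioms)
  then show ?thesis
    using distr_pair_in_couplings[of fst "\<mu> \<Otimes>\<^sub>M \<nu>" snd] by auto
qed

lemma W2_nonneg [simp]: "0 \<le> W2 \<mu> \<nu>"
  by (simp add: W2_def)

lemma W2_le_coupling:
  assumes "\<gamma> \<in> couplings \<mu> \<nu>" "\<mu> \<in> P2" "\<nu> \<in> P2"
  shows "W2 \<mu> \<nu> \<le> l2norm \<gamma> (\<lambda>z. fst z - snd z)"
proof -
  have "(INF \<gamma>\<in>couplings \<mu> \<nu>. transport_cost \<gamma>) \<le> ennreal ((l2norm \<gamma> (\<lambda>z. fst z - snd z))\<^sup>2)"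
    unfolding coupling_cost[OF assms, symmetric] by (rule INF_lower[OF assms(1)])
  then have "enn2real (INF \<gamma>\<in>couplings \<mu> \<nu>. transport_cost \<gamma>) \<le> (l2norm \<gamma> (\<lambda>z. fst z - snd z))\<^sup>2"
    by (simp add: enn2real_leI)
  then show ?thesis
    unfolding W2_def by (simp add: real_le_lsqrt)
qed

lemma W2_le_random_variables:
  fixes X Y :: "'b \<Rightarrow> 'a::euclidean_space"
  assumes "prob_space M" "sq_integrable M X" "sq_integrable M Y"
  shows "W2 (distr M borel X) (distr M borel Y) \<le> l2norm M (\<lambda>\<omega>. X \<omega> - Y \<omega>)"
proof -
  note [measurable] = assms(2,3)[THEN sq_integrableD(1)]
  have "W2 (distr M borel X) (distr M borel Y)
      \<le> l2norm (distr M borel (\<lambda>\<omega>. (X \<omega>, Y \<omega>))) (\<lambda>z. fst z - snd z)"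
    by (intro W2_le_coupling distr_pair_in_couplings distr_in_P2 assms) measurable
  also have "\<dots> = l2norm M (\<lambda>\<omega>. X \<omega> - Y \<omega>)"
    by (subst l2norm_distr) (auto simp: borel_prod[symmetric])
  finally show ?thesis .
qed

lemma W2_near_optimal:
  assumes "\<mu> \<in> P2" "\<nu> \<in> P2" "0 < e"
  obtains \<gamma> where "\<gamma> \<in> couplings \<mu> \<nu>" "l2norm \<gamma> (\<lambda>z. fst z - snd z) < W2 \<mu> \<nu> + e"
proof -
  define I where "I = (INF \<gamma>\<in>couplings \<mu> \<nu>. transport_cost \<gamma>)"
  obtain \<gamma>0 where \<gamma>0: "\<gamma>0 \<in> couplings \<mu> \<nu>"
    using couplings_nonempty[OF assms(1,2)] by blast
  have "I \<le> transport_cost \<gamma>0" unfolding I_def by (rule INF_lower[OF \<gamma>0])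
  also have "\<dots> < \<infinity>" using coupling_cost[OF \<gamma>0 assms(1,2)] by simp
  finally have "I < \<infinity>" .
  moreover have "(W2 \<mu> \<nu>)\<^sup>2 = enn2real I"
    unfolding W2_def I_def[symmetric] by (rule real_sqrt_pow2) simp
  ultimately have I: "I = ennreal ((W2 \<mu> \<nu>)\<^sup>2)" by simp
  have pos: "0 \<le> W2 \<mu> \<nu> + e"
    using W2_nonneg[of \<mu> \<nu>] assms(3) by linarith
  have "(W2 \<mu> \<nu>)\<^sup>2 < (W2 \<mu> \<nu> + e)\<^sup>2"
    using assms(3) by (intro power_strict_mono) auto
  then have "I < ennreal ((W2 \<mu> \<nu> + e)\<^sup>2)"
    unfolding I by (simp add: ennreal_less_iff)
  then obtain \<gamma> where \<gamma>: "\<gamma> \<in> couplings \<mu> \<nu>" "transport_cost \<gamma> < ennreal ((W2 \<mu> \<nu> + e)\<^sup>2)"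
    unfolding I_def INF_less_iff by blast
  then have "(l2norm \<gamma> (\<lambda>z. fst z - snd z))\<^sup>2 < (W2 \<mu> \<nu> + e)\<^sup>2"
    using coupling_cost[OF \<gamma>(1) assms(1,2)] by (simp add: ennreal_less_iff)
  then have "l2norm \<gamma> (\<lambda>z. fst z - snd z) < W2 \<mu> \<nu> + e"
    by (rule power2_less_imp_less[OF _ pos])
  with \<gamma>(1) show thesis by (rule that)
qed

lemma optimal_plan_cost:
  assumes "\<gamma> \<in> optimal_plans \<mu> \<nu>" "\<mu> \<in> P2" "\<nu> \<in> P2"
  shows "l2norm \<gamma> (\<lambda>z. fst z - snd z) = W2 \<mu> \<nu>"
proof (rule antisym)
  have \<gamma>: "\<gamma> \<in> couplings \<mu> \<nu>" using assms(1) by (simp add: optimal_plans_def)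
  show "W2 \<mu> \<nu> \<le> l2norm \<gamma> (\<lambda>z. fst z - snd z)"
    using W2_le_coupling[OF \<gamma> assms(2,3)] .
  show "l2norm \<gamma> (\<lambda>z. fst z - snd z) \<le> W2 \<mu> \<nu>"
  proof (rule field_le_epsilon)
    fix e :: real assume "0 < e"
    then obtain \<gamma>' where \<gamma>': "\<gamma>' \<in> couplings \<mu> \<nu>" "l2norm \<gamma>' (\<lambda>z. fst z - snd z) < W2 \<mu> \<nu> + e"
      using W2_near_optimal[OF assms(2,3)] by blast
    have "transport_cost \<gamma> \<le> transport_cost \<gamma>'"
      using assms(1) \<gamma>'(1) by (simp add: optimal_plans_def)
    then have "l2norm \<gamma> (\<lambda>z. fst z - snd z) \<le> l2norm \<gamma>' (\<lambda>z. fst z - snd z)"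
      unfolding coupling_cost[OF \<gamma> assms(2,3)] coupling_cost[OF \<gamma>'(1) assms(2,3)]
      by (simp add: power2_le_iff_abs_le)
    with \<gamma>'(2) show "l2norm \<gamma> (\<lambda>z. fst z - snd z) \<le> W2 \<mu> \<nu> + e" by simp
  qed
qed

lemma W2_sym:
  assumes "\<mu> \<in> P2" "\<nu> \<in> P2" shows "W2 \<mu> \<nu> = W2 \<nu> \<mu>"
proof -
  have le: "W2 \<nu> \<mu> \<le> W2 \<mu> \<nu>" if P: "\<mu> \<in> P2" "\<nu> \<in> P2" for \<mu> \<nu> :: "'a measure"
  proof (rule field_le_epsilon)
    fix e :: real assume "0 < e"
    then obtain \<gamma> where \<gamma>: "\<gamma> \<in> couplings \<mu> \<nu>" "l2norm \<gamma> (\<lambda>z. fst z - snd z) < W2 \<mu> \<nu> + e"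
      using W2_near_optimal[OF P] by blast
    note c = couplingsD[OF \<gamma>(1) P]
    have "W2 \<nu> \<mu> \<le> l2norm \<gamma> (\<lambda>z. snd z - fst z)"
      using W2_le_random_variables[OF c(1) c(9,8)] c(4,5) by simp
    also have "\<dots> = l2norm \<gamma> (\<lambda>z. fst z - snd z)"
      by (simp add: l2norm_def norm_minus_commute)
    finally show "W2 \<nu> \<mu> \<le> W2 \<mu> \<nu> + e" using \<gamma>(2) by simp
  qed
  show ?thesis using le[OF assms] le[OF assms(2,1)] by simp
qed

lemma potential_energy_distr:
  assumes "X \<in> borel_measurable M" "f \<in> borel_measurable borel"
  shows "potential_energy f (distr M borel X) = (\<integral>\<omega>. f (X \<omega>) \<partial>M)"
  unfolding potential_energy_def using assms by (rule integral_distr)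

lemma potential_energy_coupling:
  assumes "\<gamma> \<in> couplings \<mu> \<nu>" "\<mu> \<in> P2" "\<nu> \<in> P2" "f \<in> borel_measurable borel"
  shows "potential_energy f \<mu> = (\<integral>z. f (fst z) \<partial>\<gamma>)" "potential_energy f \<nu> = (\<integral>z. f (snd z) \<partial>\<gamma>)"
  using potential_energy_distr[OF couplingsD(6)[OF assms(1-3)] assms(4)]
    potential_energy_distr[OF couplingsD(7)[OF assms(1-3)] assms(4)] couplingsD(4,5)[OF assms(1-3)]
  by auto

lemma (in prob_space) integrable_quadratic_growth:
  assumes "quadratic_growth f" "f \<in> borel_measurable borel" "sq_integrable M X"
  shows "integrable M (\<lambda>\<omega>. f (X \<omega>))"
proof -
  obtain a where a: "0 < a" "\<And>x. \<bar>f x\<bar> \<le> a * ((norm x)\<^sup>2 + 1)"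
    using assms(1) unfolding quadratic_growth_def by blast
  note [measurable] = assms(2) sq_integrableD(1)[OF assms(3)]
  show ?thesis
  proof (rule Bochner_Integration.integrable_bound)
    show "integrable M (\<lambda>\<omega>. a * ((norm (X \<omega>))\<^sup>2 + 1))"
      using sq_integrableD(2)[OF assms(3)] by simp
    have "\<bar>f (X \<omega>)\<bar> \<le> \<bar>a * ((norm (X \<omega>))\<^sup>2 + 1)\<bar>" for \<omega>
      using a(2)[of "X \<omega>"] by (rule order_trans) simp
    then show "AE \<omega> in M. norm (f (X \<omega>)) \<le> norm (a * ((norm (X \<omega>))\<^sup>2 + 1))"
      by simp
  qed measurable
qed

section \<open>Approximate gluing of couplings\<close>

text \<open>A partition into countably many Borel cells of diameter at most \<open>\<delta>\<close>: the cell of \<open>x\<close> is the first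
  member of a dense sequence that is \<open>\<delta> / 2\<close>-close to \<open>x\<close>.\<close>

lemma countable_cells:
  fixes \<delta> :: real
  assumes "0 < \<delta>"
  obtains idx :: "'a::euclidean_space \<Rightarrow> nat" where
    "idx \<in> measurable borel (count_space UNIV)" "\<And>x y. idx x = idx y \<Longrightarrow> dist x y \<le> \<delta>"
proof -
  obtain D :: "'a set" where D: "countable D" "\<And>U. open U \<Longrightarrow> U \<noteq> {} \<Longrightarrow> \<exists>d\<in>D. d \<in> U"
    using countable_dense_setE by blast
  then have "D \<noteq> {}" using open_UNIV by blast
  define d where "d = from_nat_into D"
  define idx where "idx x = (LEAST n. dist x (d n) < \<delta> / 2)" for x
  have near: "dist x (d (idx x)) < \<delta> / 2" for x
  proof -
    obtain y where "y \<in> D" "y \<in> ball x (\<delta> / 2)"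
      using D(2)[of "ball x (\<delta> / 2)"] assms by auto
    moreover then obtain n where "y = d n"
      using from_nat_into_surj[OF D(1), of y] d_def by metis
    ultimately have "dist x (d n) < \<delta> / 2" by simp
    then show ?thesis unfolding idx_def by (rule LeastI)
  qed
  show thesis
  proof (rule that)
    show "idx \<in> measurable borel (count_space UNIV)"
      unfolding idx_def by measurable
    fix x y assume "idx x = idx y"
    then have "dist x (d (idx x)) < \<delta> / 2" "dist y (d (idx x)) < \<delta> / 2"
      using near[of x] near[of y] by simp_all
    then show "dist x y \<le> \<delta>"
      using dist_triangle2[of x y "d (idx x)"] by linarith
  qed
qed

text \<open>The density, with respect to \<open>\<mu> \<Otimes> \<mu>\<close>, of the coupling of \<open>\<mu>\<close> with itself that draws a cell
  and then two independent points of that cell.\<close>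

definition cell_weight :: "'a measure \<Rightarrow> ('a \<Rightarrow> nat) \<Rightarrow> 'a \<Rightarrow> 'a \<Rightarrow> real" where
  "cell_weight \<mu> idx y y' = (if idx y = idx y' then 1 / measure \<mu> (idx -` {idx y}) else 0)"

lemma cell_weight_nonneg [simp]: "0 \<le> cell_weight \<mu> idx y y'"
  by (simp add: cell_weight_def)

lemma cell_weight_sym: "cell_weight \<mu> idx y y' = cell_weight \<mu> idx y' y"
  by (simp add: cell_weight_def)

lemma cell_weight_measurable [measurable]:
  assumes [measurable]: "idx \<in> measurable N (count_space UNIV)" "f \<in> measurable M N" "g \<in> measurable M N"
  shows "(\<lambda>x. cell_weight \<mu> idx (f x) (g x)) \<in> borel_measurable M"
proof -
  have f: "(\<lambda>x. idx (f x)) \<in> measurable M (count_space UNIV)"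
    and g: "(\<lambda>x. idx (g x)) \<in> measurable M (count_space UNIV)"
    by (rule measurable_compose[OF assms(2,1)], rule measurable_compose[OF assms(3,1)])
  have "(\<lambda>x. if i = idx (g x) then 1 / measure \<mu> (idx -` {i}) else 0) \<in> borel_measurable M" for i
    using measurable_compose[OF g, of "\<lambda>j. if i = j then 1 / measure \<mu> (idx -` {i}) else 0" borel]
    by simp
  from measurable_compose_countable[OF this f] show ?thesis
    unfolding cell_weight_def .
qed

text \<open>There are countably many cells, so the union of those of measure zero is a null set.\<close>

lemma cells_positive:
  fixes idx :: "'a::euclidean_space \<Rightarrow> nat"
  assumes "prob_space \<mu>" "sets \<mu> = sets borel" "idx \<in> measurable borel (count_space UNIV)"
  shows "AE y in \<mu>. 0 < measure \<mu> (idx -` {idx y})"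
proof -
  interpret prob_space \<mu> by fact
  have sp: "space \<mu> = UNIV" using sets_eq_imp_space_eq[OF assms(2)] by simp
  have cell: "idx -` {i} \<in> sets \<mu>" for i
    using measurable_sets[OF assms(3), of "{i}"] assms(2) by simp
  have "AE y in \<mu>. \<forall>i. measure \<mu> (idx -` {i}) = 0 \<longrightarrow> y \<notin> idx -` {i}"
  proof (subst AE_all_countable, intro allI)
    fix i show "AE y in \<mu>. measure \<mu> (idx -` {i}) = 0 \<longrightarrow> y \<notin> idx -` {i}"
    proof (cases "measure \<mu> (idx -` {i}) = 0")
      case True
      then have "idx -` {i} \<in> null_sets \<mu>" using cell by (auto simp: emeasure_eq_measure)
      from AE_not_in[OF this] show ?thesis by simp
    qed simp
  qed
  then show ?thesis
  proof eventually_elim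
    case (elim y)
    then have "measure \<mu> (idx -` {idx y}) \<noteq> 0" by auto
    then show ?case by (simp add: zero_less_measure_iff)
  qed
qed

lemma cell_weight_total:
  fixes idx :: "'a::euclidean_space \<Rightarrow> nat"
  assumes "prob_space \<mu>" "sets \<mu> = sets borel" "idx \<in> measurable borel (count_space UNIV)"
    and pos: "0 < measure \<mu> (idx -` {idx y})"
  shows "(\<integral>\<^sup>+y'. ennreal (cell_weight \<mu> idx y y') \<partial>\<mu>) = 1"
proof -
  interpret prob_space \<mu> by fact
  have cell: "idx -` {i} \<in> sets \<mu>" for i
    using measurable_sets[OF assms(3), of "{i}"] assms(2) by simp
  let ?m = "measure \<mu> (idx -` {idx y})"
  have "(\<integral>\<^sup>+y'. ennreal (cell_weight \<mu> idx y y') \<partial>\<mu>)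
      = (\<integral>\<^sup>+y'. ennreal (1 / ?m) * indicator (idx -` {idx y}) y' \<partial>\<mu>)"
    by (intro nn_integral_cong) (auto simp: cell_weight_def indicator_def)
  also have "\<dots> = ennreal (1 / ?m) * ennreal ?m"
    using cell by (simp add: nn_integral_cmult emeasure_eq_measure)
  also have "\<dots> = 1"
    using pos by (simp add: ennreal_mult[symmetric])
  finally show ?thesis .
qed

text \<open>Two probability spaces with random variables \<open>Y1\<close> and \<open>Y2\<close> of the same law \<open>\<mu>\<close> are coupled by the
  density \<open>cell_weight\<close> with respect to their product.  Both projections of the coupling are exact,
  and \<open>Y1\<close> and \<open>Y2\<close> fall into the same cell.\<close>

locale gluing =
  fixes \<gamma>1 :: "'b measure" and Y1 :: "'b \<Rightarrow> 'a::euclidean_space"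
    and \<gamma>2 :: "'c measure" and Y2 :: "'c \<Rightarrow> 'a"
    and \<mu> :: "'a measure" and idx :: "'a \<Rightarrow> nat"
  assumes prob1: "prob_space \<gamma>1" and prob2: "prob_space \<gamma>2"
    and Y1 [measurable]: "Y1 \<in> borel_measurable \<gamma>1" and Y2 [measurable]: "Y2 \<in> borel_measurable \<gamma>2"
    and marginal1: "distr \<gamma>1 borel Y1 = \<mu>" and marginal2: "distr \<gamma>2 borel Y2 = \<mu>"
    and idx [measurable]: "idx \<in> measurable borel (count_space UNIV)"
begin

sublocale \<gamma>1: prob_space \<gamma>1 by (rule prob1)
sublocale \<gamma>2: prob_space \<gamma>2 by (rule prob2)
sublocale pair_prob_space \<gamma>1 \<gamma>2 ..

lemma prob_mu: "prob_space \<mu>"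
  unfolding marginal1[symmetric] by (intro \<gamma>1.prob_space_distr Y1)

lemma sets_mu: "sets \<mu> = sets borel"
  unfolding marginal1[symmetric] by simp

abbreviation w :: "'b \<Rightarrow> 'c \<Rightarrow> real" where
  "w p q \<equiv> cell_weight \<mu> idx (Y1 p) (Y2 q)"

definition glued :: "('b \<times> 'c) measure" where
  "glued = density (\<gamma>1 \<Otimes>\<^sub>M \<gamma>2) (\<lambda>p. ennreal (w (fst p) (snd p)))"

lemma sets_glued [measurable_cong]: "sets glued = sets (\<gamma>1 \<Otimes>\<^sub>M \<gamma>2)"
  by (simp add: glued_def)

lemma positive1: "AE p in \<gamma>1. 0 < measure \<mu> (idx -` {idx (Y1 p)})"
  using cells_positive[OF prob_mu sets_mu idx] AE_distrD[OF Y1] unfolding marginal1 by blast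

lemma positive2: "AE q in \<gamma>2. 0 < measure \<mu> (idx -` {idx (Y2 q)})"
  using cells_positive[OF prob_mu sets_mu idx] AE_distrD[OF Y2] unfolding marginal2 by blast

lemma weight_total2:
  assumes "0 < measure \<mu> (idx -` {idx (Y1 p)})"
  shows "(\<integral>\<^sup>+q. ennreal (w p q) \<partial>\<gamma>2) = 1"
proof -
  have "(\<integral>\<^sup>+q. ennreal (w p q) \<partial>\<gamma>2) = (\<integral>\<^sup>+y'. ennreal (cell_weight \<mu> idx (Y1 p) y') \<partial>\<mu>)"
    unfolding marginal2[symmetric] by (subst nn_integral_distr) auto
  then show ?thesis
    using cell_weight_total[OF prob_mu sets_mu idx assms] by simp
qed

lemma weight_total1:
  assumes "0 < measure \<mu> (idx -` {idx y})"
  shows "(\<integral>\<^sup>+p. ennreal (cell_weight \<mu> idx (Y1 p) y) \<partial>\<gamma>1) = 1"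
proof -
  have "(\<integral>\<^sup>+p. ennreal (cell_weight \<mu> idx (Y1 p) y) \<partial>\<gamma>1) = (\<integral>\<^sup>+y'. ennreal (cell_weight \<mu> idx y y') \<partial>\<mu>)"
    unfolding marginal1[symmetric] cell_weight_sym[of _ _ y] by (subst nn_integral_distr) auto
  then show ?thesis
    using cell_weight_total[OF prob_mu sets_mu idx assms] by simp
qed

lemma nn_integral_glued_fst:
  assumes [measurable]: "f \<in> borel_measurable \<gamma>1"
  shows "(\<integral>\<^sup>+p. f p * (\<integral>\<^sup>+q. ennreal (w p q) \<partial>\<gamma>2) \<partial>\<gamma>1) = (\<integral>\<^sup>+p. f p \<partial>\<gamma>1)"
proof (intro nn_integral_cong_AE, use positive1 in eventually_elim)
  case (elim p)
  then show ?case by (simp add: weight_total2)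
qed

lemma nn_integral_glued_snd:
  assumes [measurable]: "f \<in> borel_measurable \<gamma>2"
  shows "(\<integral>\<^sup>+p. (\<integral>\<^sup>+q. ennreal (w p q) * f q \<partial>\<gamma>2) \<partial>\<gamma>1) = (\<integral>\<^sup>+q. f q \<partial>\<gamma>2)"
proof -
  have "(\<integral>\<^sup>+p. (\<integral>\<^sup>+q. ennreal (w p q) * f q \<partial>\<gamma>2) \<partial>\<gamma>1)
      = (\<integral>\<^sup>+q. (\<integral>\<^sup>+p. ennreal (w p q) * f q \<partial>\<gamma>1) \<partial>\<gamma>2)"
    by (rule Fubini'[symmetric]) measurable
  also have "\<dots> = (\<integral>\<^sup>+q. f q \<partial>\<gamma>2)"
  proof (intro nn_integral_cong_AE, use positive2 in eventually_elim)
    case (elim q)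
    have "(\<integral>\<^sup>+p. ennreal (w p q) * f q \<partial>\<gamma>1) = (\<integral>\<^sup>+p. ennreal (w p q) \<partial>\<gamma>1) * f q"
      by (rule nn_integral_multc) measurable
    then show ?case using weight_total1[OF elim] by simp
  qed
  finally show ?thesis .
qed

lemma distr_glued_fst: "distr glued \<gamma>1 fst = \<gamma>1"
proof (rule measure_eqI)
  fix A assume "A \<in> sets (distr glued \<gamma>1 fst)"
  then have A [measurable]: "A \<in> sets \<gamma>1" by simp
  have "emeasure (distr glued \<gamma>1 fst) A = (\<integral>\<^sup>+p. indicator A (fst p) \<partial>glued)"
    by (subst nn_integral_indicator[symmetric], simp, subst nn_integral_distr) auto
  also have "\<dots> = (\<integral>\<^sup>+p. ennreal (w (fst p) (snd p)) * indicator A (fst p) \<partial>(\<gamma>1 \<Otimes>\<^sub>M \<gamma>2))"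
    unfolding glued_def by (subst nn_integral_density) auto
  also have "\<dots> = (\<integral>\<^sup>+p. (\<integral>\<^sup>+q. ennreal (w p q) * indicator A p \<partial>\<gamma>2) \<partial>\<gamma>1)"
    by (subst \<gamma>2.nn_integral_fst[symmetric]) auto
  also have "\<dots> = (\<integral>\<^sup>+p. indicator A p * (\<integral>\<^sup>+q. ennreal (w p q) \<partial>\<gamma>2) \<partial>\<gamma>1)"
    by (subst nn_integral_multc) (auto simp: mult.commute)
  also have "\<dots> = emeasure \<gamma>1 A"
    by (subst nn_integral_glued_fst) auto
  finally show "emeasure (distr glued \<gamma>1 fst) A = emeasure \<gamma>1 A" .
qed simp

lemma distr_glued_snd: "distr glued \<gamma>2 snd = \<gamma>2"
proof (rule measure_eqI)
  fix A assume "A \<in> sets (distr glued \<gamma>2 snd)"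
  then have A [measurable]: "A \<in> sets \<gamma>2" by simp
  have "emeasure (distr glued \<gamma>2 snd) A = (\<integral>\<^sup>+p. indicator A (snd p) \<partial>glued)"
    by (subst nn_integral_indicator[symmetric], simp, subst nn_integral_distr) auto
  also have "\<dots> = (\<integral>\<^sup>+p. ennreal (w (fst p) (snd p)) * indicator A (snd p) \<partial>(\<gamma>1 \<Otimes>\<^sub>M \<gamma>2))"
    unfolding glued_def by (subst nn_integral_density) auto
  also have "\<dots> = (\<integral>\<^sup>+p. (\<integral>\<^sup>+q. ennreal (w p q) * indicator A q \<partial>\<gamma>2) \<partial>\<gamma>1)"
    by (subst \<gamma>2.nn_integral_fst[symmetric]) auto
  also have "\<dots> = emeasure \<gamma>2 A"
    by (subst nn_integral_glued_snd) auto
  finally show "emeasure (distr glued \<gamma>2 snd) A = emeasure \<gamma>2 A" .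
qed simp

lemma prob_glued: "prob_space glued"
  using prob_space_distrD[of fst glued \<gamma>1] distr_glued_fst prob1 by simp

lemma AE_glued_same_cell: "AE p in glued. idx (Y1 (fst p)) = idx (Y2 (snd p))"
proof -
  have "(\<lambda>p. ennreal (w (fst p) (snd p))) \<in> borel_measurable (\<gamma>1 \<Otimes>\<^sub>M \<gamma>2)" by measurable
  from AE_density[OF this] show ?thesis
    unfolding glued_def by (simp add: cell_weight_def)
qed

lemma glued_fst:
  assumes "f \<in> borel_measurable \<gamma>1"
  shows "sq_integrable glued (\<lambda>p. f (fst p)) \<longleftrightarrow> sq_integrable \<gamma>1 f"
    "l2norm glued (\<lambda>p. f (fst p)) = l2norm \<gamma>1 f"
proof -
  have "integrable (distr glued \<gamma>1 fst) (\<lambda>x. (norm (f x))\<^sup>2) \<longleftrightarrow> integrable glued (\<lambda>p. (norm (f (fst p)))\<^sup>2)"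
    using assms by (intro integrable_distr_eq) auto
  then show "sq_integrable glued (\<lambda>p. f (fst p)) \<longleftrightarrow> sq_integrable \<gamma>1 f"
    using assms by (auto simp: sq_integrable_def distr_glued_fst)
  show "l2norm glued (\<lambda>p. f (fst p)) = l2norm \<gamma>1 f"
    using l2norm_distr[of fst glued \<gamma>1 f] assms by (simp add: distr_glued_fst)
qed

lemma glued_snd:
  assumes "f \<in> borel_measurable \<gamma>2"
  shows "sq_integrable glued (\<lambda>p. f (snd p)) \<longleftrightarrow> sq_integrable \<gamma>2 f"
    "l2norm glued (\<lambda>p. f (snd p)) = l2norm \<gamma>2 f"
proof -
  have "integrable (distr glued \<gamma>2 snd) (\<lambda>x. (norm (f x))\<^sup>2) \<longleftrightarrow> integrable glued (\<lambda>p. (norm (f (snd p)))\<^sup>2)"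
    using assms by (intro integrable_distr_eq) auto
  then show "sq_integrable glued (\<lambda>p. f (snd p)) \<longleftrightarrow> sq_integrable \<gamma>2 f"
    using assms by (auto simp: sq_integrable_def distr_glued_snd)
  show "l2norm glued (\<lambda>p. f (snd p)) = l2norm \<gamma>2 f"
    using l2norm_distr[of snd glued \<gamma>2 f] assms by (simp add: distr_glued_snd)
qed

text \<open>Averaging a field on the first space over cells: a discrete substitute for the conditional
  expectation given \<open>Y1\<close>.\<close>

definition cell_average :: "('b \<Rightarrow> 'a) \<Rightarrow> 'a \<Rightarrow> 'a" where
  "cell_average f y = (\<integral>p. cell_weight \<mu> idx (Y1 p) y *\<^sub>R f p \<partial>\<gamma>1)"

lemma cell_average_measurable:
  assumes [measurable]: "f \<in> borel_measurable \<gamma>1"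
  shows "cell_average f \<in> borel_measurable borel"
  unfolding cell_average_def
  by (rule \<gamma>1.borel_measurable_lebesgue_integral) measurable

lemma norm_cell_average_measurable:
  assumes "f \<in> borel_measurable \<gamma>1"
  shows "(\<lambda>y. (norm (cell_average f y))\<^sup>2) \<in> borel_measurable \<mu>"
proof -
  note [measurable] = cell_average_measurable[OF assms]
  have "(\<lambda>y. (norm (cell_average f y))\<^sup>2) \<in> borel_measurable borel" by measurable
  then show ?thesis by (simp add: measurable_cong_sets[OF sets_mu refl])
qed

text \<open>Jensen's inequality on each cell.\<close>

lemma nn_integral_cell_average_le:
  assumes f: "sq_integrable \<gamma>1 f"
  shows "(\<integral>\<^sup>+y. ennreal ((norm (cell_average f y))\<^sup>2) \<partial>\<mu>) \<le> ennreal ((l2norm \<gamma>1 f)\<^sup>2)"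
proof -
  note [measurable] = sq_integrableD(1)[OF f] cell_average_measurable[OF sq_integrableD(1)[OF f]]
  have "(\<integral>\<^sup>+y. ennreal ((norm (cell_average f y))\<^sup>2) \<partial>\<mu>)
      = (\<integral>\<^sup>+q. ennreal ((norm (cell_average f (Y2 q)))\<^sup>2) \<partial>\<gamma>2)"
    using nn_integral_distr[OF Y2, of "\<lambda>y. ennreal ((norm (cell_average f y))\<^sup>2)"]
    norm_cell_average_measurable[OF sq_integrableD(1)[OF f]]
    by (simp add: marginal2)
  also have "\<dots> \<le> (\<integral>\<^sup>+q. (\<integral>\<^sup>+p. ennreal (w p q) * ennreal ((norm (f p))\<^sup>2) \<partial>\<gamma>1) \<partial>\<gamma>2)"
  proof (intro nn_integral_mono_AE, use positive2 in eventually_elim)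
    case (elim q)
    define K where "K = density \<gamma>1 (\<lambda>p. ennreal (w p q))"
    have "emeasure K (space K) = 1"
      using weight_total1[OF elim] by (simp add: K_def emeasure_density cong: nn_integral_cong)
    then interpret K: prob_space K by (rule prob_spaceI)
    have bounded: "w p q \<le> 1 / measure \<mu> (idx -` {idx (Y2 q)})" for p
      by (simp add: cell_weight_def)
    have "integrable \<gamma>1 (\<lambda>p. w p q * (norm (f p))\<^sup>2)"
    proof (rule Bochner_Integration.integrable_bound)
      show "integrable \<gamma>1 (\<lambda>p. 1 / measure \<mu> (idx -` {idx (Y2 q)}) * (norm (f p))\<^sup>2)"
        using sq_integrableD(2)[OF f] by (rule integrable_mult_right)
      show "AE p in \<gamma>1. norm (w p q * (norm (f p))\<^sup>2) \<le> norm (1 / measure \<mu> (idx -` {idx (Y2 q)}) * (norm (f p))\<^sup>2)"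
        by (intro AE_I2) (simp add: abs_mult mult_right_mono[OF bounded] del: times_divide_eq_left)
    qed measurable
    then have sq: "sq_integrable K f"
      unfolding sq_integrable_def K_def by (auto simp: integrable_density)
    have "cell_average f (Y2 q) = (\<integral>p. f p \<partial>K)"
      unfolding cell_average_def K_def by (subst integral_density) auto
    then have "(norm (cell_average f (Y2 q)))\<^sup>2 \<le> (l2norm K f)\<^sup>2"
      using K.norm_integral_le_l2norm[OF sq] by (simp add: power_mono)
    then have "ennreal ((norm (cell_average f (Y2 q)))\<^sup>2) \<le> ennreal (\<integral>p. (norm (f p))\<^sup>2 \<partial>K)"
      unfolding l2norm_power2 by (rule ennreal_leI)
    also have "\<dots> = (\<integral>\<^sup>+p. ennreal ((norm (f p))\<^sup>2) \<partial>K)"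
      using sq_integrableD(2)[OF sq] by (simp add: nn_integral_eq_integral)
    also have "\<dots> = (\<integral>\<^sup>+p. ennreal (w p q) * ennreal ((norm (f p))\<^sup>2) \<partial>\<gamma>1)"
      unfolding K_def by (subst nn_integral_density) auto
    finally show ?case .
  qed
  also have "\<dots> = (\<integral>\<^sup>+p. (\<integral>\<^sup>+q. ennreal (w p q) * ennreal ((norm (f p))\<^sup>2) \<partial>\<gamma>2) \<partial>\<gamma>1)"
    by (rule Fubini') measurable
  also have "\<dots> = (\<integral>\<^sup>+p. ennreal ((norm (f p))\<^sup>2) * (\<integral>\<^sup>+q. ennreal (w p q) \<partial>\<gamma>2) \<partial>\<gamma>1)"
    by (subst nn_integral_multc) (auto simp: mult.commute)
  also have "\<dots> = (\<integral>\<^sup>+p. ennreal ((norm (f p))\<^sup>2) \<partial>\<gamma>1)"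
    by (rule nn_integral_glued_fst) measurable
  also have "\<dots> = ennreal ((l2norm \<gamma>1 f)\<^sup>2)"
    using sq_integrableD(2)[OF f] by (simp add: nn_integral_eq_integral l2norm_power2)
  finally show ?thesis by simp
qed

lemma sq_integrable_cell_average:
  assumes f: "sq_integrable \<gamma>1 f"
  shows "sq_integrable \<mu> (cell_average f)" "l2norm \<mu> (cell_average f) \<le> l2norm \<gamma>1 f"
proof -
  note [measurable] = cell_average_measurable[OF sq_integrableD(1)[OF f]]
  have m: "cell_average f \<in> borel_measurable \<mu>"
    by (simp add: measurable_cong_sets[OF sets_mu refl])
  show sq: "sq_integrable \<mu> (cell_average f)"
    unfolding sq_integrable_def
  proof (intro conjI integrableI_nonneg m)
    show "(\<integral>\<^sup>+y. ennreal ((norm (cell_average f y))\<^sup>2) \<partial>\<mu>) < \<infinity>"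
      by (rule order_le_less_trans[OF nn_integral_cell_average_le[OF f]]) simp
    show "(\<lambda>y. (norm (cell_average f y))\<^sup>2) \<in> borel_measurable \<mu>"
      by (rule norm_cell_average_measurable[OF sq_integrableD(1)[OF f]])
  qed auto
  have "ennreal ((l2norm \<mu> (cell_average f))\<^sup>2) \<le> ennreal ((l2norm \<gamma>1 f)\<^sup>2)"
    using nn_integral_cell_average_le[OF f] sq_integrableD(2)[OF sq]
    by (simp add: nn_integral_eq_integral l2norm_power2)
  then have "(l2norm \<mu> (cell_average f))\<^sup>2 \<le> (l2norm \<gamma>1 f)\<^sup>2" by simp
  then show "l2norm \<mu> (cell_average f) \<le> l2norm \<gamma>1 f" by (rule power2_le_imp_le) simp
qed

text \<open>Given the second component, the first one is distributed over the cell of \<open>Y2\<close>, so a field on the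
  first space may be replaced by its cell average when it is paired with a field on the second.\<close>

lemma integral_inner_glued:
  assumes f: "sq_integrable \<gamma>1 f" and g: "sq_integrable \<gamma>2 g"
  shows "(\<integral>p. f (fst p) \<bullet> g (snd p) \<partial>glued) = (\<integral>q. cell_average f (Y2 q) \<bullet> g q \<partial>\<gamma>2)"
proof -
  note [measurable] = sq_integrableD(1)[OF f] sq_integrableD(1)[OF g]
  have "integrable glued (\<lambda>p. f (fst p) \<bullet> g (snd p))"
    using f g by (intro integrable_inner_sq) (simp_all add: glued_fst glued_snd)
  then have int: "integrable (\<gamma>1 \<Otimes>\<^sub>M \<gamma>2) (\<lambda>p. w (fst p) (snd p) * (f (fst p) \<bullet> g (snd p)))"
    unfolding glued_def by (subst (asm) integrable_density) auto
  have "(\<integral>p. f (fst p) \<bullet> g (snd p) \<partial>glued)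
      = (\<integral>p. w (fst p) (snd p) * (f (fst p) \<bullet> g (snd p)) \<partial>(\<gamma>1 \<Otimes>\<^sub>M \<gamma>2))"
    unfolding glued_def by (subst integral_density) auto
  also have "\<dots> = (\<integral>q. (\<integral>p. w p q * (f p \<bullet> g q) \<partial>\<gamma>1) \<partial>\<gamma>2)"
    using integral_snd[of "\<lambda>p q. w p q * (f p \<bullet> g q)"] int by (simp add: case_prod_beta')
  also have "\<dots> = (\<integral>q. cell_average f (Y2 q) \<bullet> g q \<partial>\<gamma>2)"
  proof (intro Bochner_Integration.integral_cong refl)
    fix q
    have "integrable \<gamma>1 (\<lambda>p. w p q *\<^sub>R f p)"
    proof (rule Bochner_Integration.integrable_bound)
      show "integrable \<gamma>1 (\<lambda>p. 1 / measure \<mu> (idx -` {idx (Y2 q)}) * norm (f p))"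
        using \<gamma>1.integrable_norm_sq[OF f] by (rule integrable_mult_right)
      have "w p q \<le> 1 / measure \<mu> (idx -` {idx (Y2 q)})" for p
        by (simp add: cell_weight_def)
      then show "AE p in \<gamma>1. norm (w p q *\<^sub>R f p) \<le> norm (1 / measure \<mu> (idx -` {idx (Y2 q)}) * norm (f p))"
        by (intro AE_I2) (simp add: abs_mult mult_right_mono del: times_divide_eq_left)
    qed measurable
    then show "(\<integral>p. w p q * (f p \<bullet> g q) \<partial>\<gamma>1) = cell_average f (Y2 q) \<bullet> g q"
      unfolding cell_average_def by (simp flip: integral_inner_left)
  qed
  finally show ?thesis .
qed

end

text \<open>In the glued plan the two copies of the middle variable differ by at most the diameter of a
  cell, which is arbitrarily small.\<close>

lemma W2_triangle:
  assumes "\<mu> \<in> P2" "\<nu> \<in> P2" "\<rho> \<in> P2"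
  shows "W2 \<mu> \<rho> \<le> W2 \<mu> \<nu> + W2 \<nu> \<rho>"
proof (rule field_le_epsilon)
  fix e :: real assume "0 < e"
  then have e: "0 < e / 3" by simp
  obtain \<gamma>1 where \<gamma>1: "\<gamma>1 \<in> couplings \<mu> \<nu>" "l2norm \<gamma>1 (\<lambda>z. fst z - snd z) < W2 \<mu> \<nu> + e / 3"
    using W2_near_optimal[OF assms(1,2) e] by blast
  obtain \<gamma>2 where \<gamma>2: "\<gamma>2 \<in> couplings \<nu> \<rho>" "l2norm \<gamma>2 (\<lambda>z. fst z - snd z) < W2 \<nu> \<rho> + e / 3"
    using W2_near_optimal[OF assms(2,3) e] by blast
  obtain idx :: "'a \<Rightarrow> nat" where cells: "idx \<in> measurable borel (count_space UNIV)"
    "\<And>x y. idx x = idx y \<Longrightarrow> dist x y \<le> e / 3"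
    using countable_cells[OF e] by blast
  note c1 = couplingsD[OF \<gamma>1(1) assms(1,2)] and c2 = couplingsD[OF \<gamma>2(1) assms(2,3)]
  interpret gluing \<gamma>1 snd \<gamma>2 fst \<nu> idx
    by (rule gluing.intro[OF c1(1) c2(1) c1(7) c2(6) c1(5) c2(4) cells(1)])
  interpret glued: prob_space glued by (rule prob_glued)
  have sX: "sq_integrable glued (\<lambda>p. fst (fst p))" "sq_integrable glued (\<lambda>p. snd (fst p))"
    "sq_integrable glued (\<lambda>p. fst (snd p))" "sq_integrable glued (\<lambda>p. snd (snd p))"
    using c1(6-9) c2(6-9) by (simp_all add: glued_fst glued_snd)
  have "distr glued borel (\<lambda>p. fst (fst p)) = distr (distr glued \<gamma>1 fst) borel fst"
    using c1(6) by (subst distr_distr) (auto simp: comp_def)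
  then have dX: "distr glued borel (\<lambda>p. fst (fst p)) = \<mu>"
    by (simp add: distr_glued_fst c1)
  have "distr glued borel (\<lambda>p. snd (snd p)) = distr (distr glued \<gamma>2 snd) borel snd"
    using c2(7) by (subst distr_distr) (auto simp: comp_def)
  then have dZ: "distr glued borel (\<lambda>p. snd (snd p)) = \<rho>"
    by (simp add: distr_glued_snd c2)
  have n1: "l2norm glued (\<lambda>p. fst (fst p) - snd (fst p)) = l2norm \<gamma>1 (\<lambda>z. fst z - snd z)"
    by (rule glued_fst) (intro borel_measurable_diff c1)
  have n2: "l2norm glued (\<lambda>p. fst (snd p) - snd (snd p)) = l2norm \<gamma>2 (\<lambda>z. fst z - snd z)"
    by (rule glued_snd) (intro borel_measurable_diff c2)
  have n3: "l2norm glued (\<lambda>p. snd (fst p) - fst (snd p)) \<le> e / 3"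
  proof -
    have "l2norm glued (\<lambda>p. snd (fst p) - fst (snd p)) \<le> l2norm glued (\<lambda>p. e / 3 :: real)"
    proof (rule l2norm_mono)
      show "AE p in glued. norm (snd (fst p) - fst (snd p)) \<le> norm (e / 3)"
        using AE_glued_same_cell
      proof eventually_elim
        case (elim p)
        then show ?case using cells(2)[OF elim] e by (simp add: dist_norm)
      qed
    qed (intro sq_integrable_diff sX glued.sq_integrable_const)+
    then show ?thesis using e by simp
  qed
  have "W2 \<mu> \<rho> \<le> l2norm glued (\<lambda>p. fst (fst p) - snd (snd p))"
    using W2_le_random_variables[OF prob_glued sX(1) sX(4)] dX dZ by simp
  also have "(\<lambda>p. fst (fst p) - snd (snd p) :: 'a) =
      (\<lambda>p. (fst (fst p) - snd (fst p)) + ((snd (fst p) - fst (snd p)) + (fst (snd p) - snd (snd p))))"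
    by (rule ext) (simp add: algebra_simps)
  also have "l2norm glued \<dots> \<le> l2norm glued (\<lambda>p. fst (fst p) - snd (fst p)) +
      (l2norm glued (\<lambda>p. snd (fst p) - fst (snd p)) + l2norm glued (\<lambda>p. fst (snd p) - snd (snd p)))"
    by (intro order_trans[OF l2norm_triangle] add_left_mono l2norm_triangle sq_integrable_add
        sq_integrable_diff sX)
  finally show "W2 \<mu> \<rho> \<le> W2 \<mu> \<nu> + W2 \<nu> \<rho> + e"
    using n1 n2 n3 \<gamma>1(2) \<gamma>2(2) by linarith
qed

section \<open>Completeness of the Wasserstein space\<close>

context gluing
begin

text \<open>The transition kernel of the glued plan, as a function of the cell of the first middle
  variable; cells of measure zero get an arbitrary value.\<close>

definition kernel :: "nat \<Rightarrow> 'c measure" where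
  "kernel i = (if 0 < measure \<mu> (idx -` {i})
     then density \<gamma>2 (\<lambda>q. ennreal (if i = idx (Y2 q) then 1 / measure \<mu> (idx -` {i}) else 0)) else \<gamma>2)"

lemma sets_kernel [simp]: "sets (kernel i) = sets \<gamma>2"
  by (simp add: kernel_def)

lemma kernel_eq:
  assumes "0 < measure \<mu> (idx -` {idx (Y1 p)})"
  shows "kernel (idx (Y1 p)) = density \<gamma>2 (\<lambda>q. ennreal (w p q))"
  using assms by (simp add: kernel_def cell_weight_def)

lemma prob_kernel: "prob_space (kernel i)"
proof (cases "0 < measure \<mu> (idx -` {i})")
  case True
  then have "idx -` {i} \<noteq> {}" by (metis less_irrefl measure_empty)
  then obtain y where y: "i = idx y" by blast
  have "(\<integral>\<^sup>+q. ennreal (cell_weight \<mu> idx y (Y2 q)) \<partial>\<gamma>2) = (\<integral>\<^sup>+y'. ennreal (cell_weight \<mu> idx y y') \<partial>\<mu>)"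
    unfolding marginal2[symmetric] by (subst nn_integral_distr) auto
  also have "\<dots> = 1"
    using cell_weight_total[OF prob_mu sets_mu idx] True y by simp
  finally have *: "(\<integral>\<^sup>+q. ennreal (cell_weight \<mu> idx y (Y2 q)) \<partial>\<gamma>2) = 1" .
  have "kernel i = density \<gamma>2 (\<lambda>q. ennreal (cell_weight \<mu> idx y (Y2 q)))"
    using True by (simp add: kernel_def cell_weight_def y)
  then show ?thesis
    using * by (intro prob_spaceI) (simp add: emeasure_density cong: nn_integral_cong)
next
  case False then show ?thesis by (simp add: kernel_def prob2)
qed

lemma nn_integral_kernel:
  assumes [measurable]: "f \<in> borel_measurable \<gamma>2"
  shows "(\<integral>\<^sup>+p. (\<integral>\<^sup>+q. f q \<partial>kernel (idx (Y1 p))) \<partial>\<gamma>1) = (\<integral>\<^sup>+q. f q \<partial>\<gamma>2)"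
proof -
  have "(\<integral>\<^sup>+p. (\<integral>\<^sup>+q. f q \<partial>kernel (idx (Y1 p))) \<partial>\<gamma>1) = (\<integral>\<^sup>+p. (\<integral>\<^sup>+q. ennreal (w p q) * f q \<partial>\<gamma>2) \<partial>\<gamma>1)"
  proof (intro nn_integral_cong_AE, use positive1 in eventually_elim)
    case (elim p)
    then show ?case by (simp add: kernel_eq nn_integral_density)
  qed
  then show ?thesis by (simp add: nn_integral_glued_snd)
qed

lemma kernel_same_cell:
  "AE p in \<gamma>1. emeasure (kernel (idx (Y1 p))) {q \<in> space \<gamma>2. idx (Y2 q) \<noteq> idx (Y1 p)} = 0"
  using positive1
proof eventually_elim
  case (elim p)
  let ?A = "{q \<in> space \<gamma>2. idx (Y2 q) \<noteq> idx (Y1 p)}"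
  have [measurable]: "(\<lambda>q. idx (Y2 q)) \<in> measurable \<gamma>2 (count_space UNIV)"
    by (rule measurable_compose[OF Y2 idx])
  have A [measurable]: "?A \<in> sets \<gamma>2" by measurable
  have "emeasure (kernel (idx (Y1 p))) ?A = (\<integral>\<^sup>+q. ennreal (w p q) * indicator ?A q \<partial>\<gamma>2)"
    unfolding kernel_eq[OF elim] by (intro emeasure_density A) measurable
  also have "\<dots> = (\<integral>\<^sup>+q. 0 \<partial>\<gamma>2)"
    by (intro nn_integral_cong) (auto simp: cell_weight_def indicator_def)
  finally show ?case by simp
qed

end

text \<open>A sequence of couplings with matching marginals is realised, up to the approximate gluing, by
  one sequence of random pairs: the Ionescu-Tulcea extension of the gluing kernels.\<close>

lemma chain_of_couplings:
  fixes \<mu> :: "nat \<Rightarrow> 'a::euclidean_space measure"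
  assumes \<mu>: "\<And>n. \<mu> n \<in> P2" and \<gamma>: "\<And>n. \<gamma> n \<in> couplings (\<mu> n) (\<mu> (Suc n))"
    and \<delta>: "\<And>n. 0 < (\<delta> n :: real)"
  obtains \<Omega> :: "(nat \<Rightarrow> 'a \<times> 'a) measure" where "prob_space \<Omega>"
    "\<And>n. (\<lambda>\<omega>. \<omega> n) \<in> borel_measurable \<Omega>" "\<And>n. distr \<Omega> borel (\<lambda>\<omega>. \<omega> n) = \<gamma> n"
    "\<And>n. AE \<omega> in \<Omega>. dist (snd (\<omega> n)) (fst (\<omega> (Suc n))) \<le> \<delta> n"
proof -
  have "\<exists>idx :: 'a \<Rightarrow> nat. idx \<in> measurable borel (count_space UNIV) \<and>
      (\<forall>x y. idx x = idx y \<longrightarrow> dist x y \<le> \<delta> n)" for n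
    by (rule countable_cells[OF \<delta>[of n], where 'a = 'a]) blast
  then obtain idx :: "nat \<Rightarrow> 'a \<Rightarrow> nat" where idx: "\<And>n. idx n \<in> measurable borel (count_space UNIV)"
    and idx_dist: "\<And>n x y. idx n x = idx n y \<Longrightarrow> dist x y \<le> \<delta> n"
    by metis
  note c = couplingsD[OF \<gamma> \<mu> \<mu>]
  have glu: "gluing (\<gamma> n) snd (\<gamma> (Suc n)) fst (\<mu> (Suc n)) (idx n)" for n
    by (rule gluing.intro[OF c(1) c(1) c(7) c(6) c(5) c(4) idx])
  define K where "K n = gluing.kernel (\<gamma> (Suc n)) fst (\<mu> (Suc n)) (idx n)" for n
  define M where "M = (\<lambda>i::nat. borel :: ('a \<times> 'a) measure)"
  \<comment> \<open>The pair with index \<open>Suc n\<close> is drawn from \<open>\<gamma> (Suc n)\<close>, restricted to the cell of the second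
    component of the pair with index \<open>n\<close>.\<close>
  define P where "P m \<omega> = (case m of 0 \<Rightarrow> \<gamma> 0 | Suc n \<Rightarrow> K n (idx n (snd (\<omega> n))))"
    for m and \<omega> :: "nat \<Rightarrow> 'a \<times> 'a"
  have K_sets: "sets (K n i) = sets borel" for n i
    using gluing.sets_kernel[OF glu] c(2) by (simp add: K_def)
  have K_prob: "prob_space (K n i)" for n i
    using gluing.prob_kernel[OF glu] by (simp add: K_def)
  have P_prob: "prob_space (P m \<omega>)" for m \<omega>
    by (cases m) (simp_all add: P_def c(1) K_prob)
  have in_subprob: "N \<in> space (subprob_algebra borel)" if "prob_space N" "sets N = sets borel"
    for N :: "('a \<times> 'a) measure"
    using that by (simp add: space_subprob_algebra prob_space_imp_subprob_space)
  have borel_fst: "fst \<in> borel_measurable (borel :: ('a \<times> 'a) measure)"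
    and borel_snd: "snd \<in> borel_measurable (borel :: ('a \<times> 'a) measure)"
    by (simp_all add: borel_prod[symmetric])
  have coord: "(\<lambda>\<omega>. \<omega> i) \<in> measurable (PiM J M) borel" if "i \<in> J" for i J
    using measurable_component_singleton[OF that, of M] by (simp add: M_def)
  have cell_meas: "(\<lambda>\<omega>. idx n (snd (\<omega> n))) \<in> measurable (PiM J M) (count_space UNIV)" if "n \<in> J" for n J
    by (rule measurable_compose[OF measurable_compose[OF coord[OF that] borel_snd] idx])
  have P_meas: "P m \<in> measurable (PiM {0..<m} M) (subprob_algebra (M m))" for m
  proof (cases m)
    case 0
    then have "P m = (\<lambda>\<omega>. \<gamma> 0)" by (simp add: fun_eq_iff P_def)
    then show ?thesis using in_subprob[OF c(1,2)] by (simp add: M_def)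
  next
    case (Suc n)
    have "K n \<in> measurable (count_space UNIV) (subprob_algebra borel)"
      using in_subprob[OF K_prob K_sets] by simp
    from measurable_compose[OF cell_meas[of n "{0..<Suc n}"] this]
    have "(\<lambda>\<omega>. K n (idx n (snd (\<omega> n)))) \<in> measurable (PiM {0..<Suc n} M) (subprob_algebra borel)"
      by simp
    moreover have "P m = (\<lambda>\<omega>. K n (idx n (snd (\<omega> n))))" by (simp add: fun_eq_iff P_def Suc)
    ultimately show ?thesis by (simp add: M_def Suc)
  qed
  interpret IT: Ionescu_Tulcea P M
    by (rule Ionescu_Tulcea.intro) (rule P_meas, rule P_prob)
  define \<Omega> where "\<Omega> = IT.PF.lim"
  define u where "u = (\<lambda>x::nat. undefined :: 'a \<times> 'a)"
  have u: "u \<in> space (PiM {0..<0} M)" by (simp add: u_def space_PiM)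
  have sets_\<Omega>: "sets \<Omega> = sets (PiM UNIV M)" by (simp add: \<Omega>_def)
  have coord_\<Omega>: "(\<lambda>\<omega>. \<omega> i) \<in> borel_measurable \<Omega>" for i
    using coord[of i UNIV] by (simp add: measurable_cong_sets[OF sets_\<Omega> refl])
  have restr: "distr \<Omega> (PiM {0..<m} M) (\<lambda>\<omega>. restrict \<omega> {0..<m}) = IT.C 0 m u" for m
  proof -
    have up: "IT.up_to {0..<m} = m"
    proof (rule antisym)
      show "IT.up_to {0..<m} \<le> m" by (simp add: IT.up_to_iff)
      show "m \<le> IT.up_to {0..<m}" using IT.up_to[of "{0..<m}"] by (cases "m = 0") simp_all
    qed
    have "distr \<Omega> (PiM {0..<m} M) (\<lambda>\<omega>. restrict \<omega> {0..<m}) = IT.CI {0..<m}"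
      unfolding \<Omega>_def by (rule IT.distr_lim) simp
    also have "\<dots> = distr (IT.C 0 m u) (PiM {0..<m} M) (\<lambda>\<omega>. restrict \<omega> {0..<m})"
      unfolding IT.CI_def up u_def ..
    also have "\<dots> = IT.C 0 m u"
      using IT.distr_C[OF order_refl u, of m] by simp
    finally show ?thesis .
  qed
  have restr_meas: "(\<lambda>\<omega>. restrict \<omega> {0..<m}) \<in> measurable \<Omega> (PiM {0..<m} M)" for m
    by (simp add: measurable_cong_sets[OF sets_\<Omega> refl] measurable_restrict_subset)
  have integral_restr: "(\<integral>\<^sup>+\<omega>. f (restrict \<omega> {0..<m}) \<partial>\<Omega>) = (\<integral>\<^sup>+\<omega>. f \<omega> \<partial>IT.C 0 m u)"
    if "f \<in> borel_measurable (PiM {0..<m} M)" for f m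
    unfolding restr[symmetric] using that by (subst nn_integral_distr[OF restr_meas]) simp_all
  have step: "(\<integral>\<^sup>+\<omega>. f \<omega> \<partial>IT.C 0 (Suc m) u) = (\<integral>\<^sup>+\<omega>. (\<integral>\<^sup>+x. f (fun_upd \<omega> m x) \<partial>P m \<omega>) \<partial>IT.C 0 m u)"
    if f: "f \<in> borel_measurable (PiM {0..<Suc m} M)" for f m
  proof -
    have eP: "IT.eP m \<in> measurable (IT.C 0 m u) (subprob_algebra (PiM {0..<Suc m} M))"
      using IT.measurable_eP[of m] unfolding measurable_cong_sets[OF IT.sets_C[OF u, of m] refl] by simp
    have "(\<integral>\<^sup>+\<omega>. f \<omega> \<partial>IT.C 0 (Suc m) u) = (\<integral>\<^sup>+\<omega>. (\<integral>\<^sup>+\<omega>'. f \<omega>' \<partial>IT.eP m \<omega>) \<partial>IT.C 0 m u)"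
      using nn_integral_bind[OF f eP] by simp
    also have "\<dots> = (\<integral>\<^sup>+\<omega>. (\<integral>\<^sup>+x. f (fun_upd \<omega> m x) \<partial>P m \<omega>) \<partial>IT.C 0 m u)"
      using IT.space_C[OF u, of m] by (intro nn_integral_cong IT.nn_integral_eP f) simp
    finally show ?thesis .
  qed
  have law: "(\<integral>\<^sup>+\<omega>. h (\<omega> m) \<partial>IT.C 0 (Suc m) u) = (\<integral>\<^sup>+q. h q \<partial>\<gamma> m)"
    if h: "h \<in> borel_measurable borel" for h m
    using h
  proof (induction m arbitrary: h)
    case 0
    have "(\<integral>\<^sup>+\<omega>. h (\<omega> 0) \<partial>IT.C 0 (Suc 0) u) = (\<integral>\<^sup>+\<omega>. (\<integral>\<^sup>+x. h (fun_upd \<omega> 0 x 0) \<partial>P 0 \<omega>) \<partial>IT.C 0 0 u)"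
      by (rule step) (rule measurable_compose[OF coord 0], simp)
    also have "\<dots> = (\<integral>\<^sup>+\<omega>. (\<integral>\<^sup>+x. h x \<partial>\<gamma> 0) \<partial>IT.C 0 0 u)" by (simp add: P_def)
    also have "\<dots> = (\<integral>\<^sup>+x. h x \<partial>\<gamma> 0)"
      using prob_space.emeasure_space_1[OF IT.prob_space_C[OF u, of 0]] by simp
    finally show ?case .
  next
    case (Suc n)
    have "(\<integral>\<^sup>+\<omega>. h (\<omega> (Suc n)) \<partial>IT.C 0 (Suc (Suc n)) u)
        = (\<integral>\<^sup>+\<omega>. (\<integral>\<^sup>+x. h (fun_upd \<omega> (Suc n) x (Suc n)) \<partial>P (Suc n) \<omega>) \<partial>IT.C 0 (Suc n) u)"
      by (rule step) (rule measurable_compose[OF coord Suc.prems], simp)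
    also have "\<dots> = (\<integral>\<^sup>+\<omega>. (\<integral>\<^sup>+x. h x \<partial>K n (idx n (snd (\<omega> n)))) \<partial>IT.C 0 (Suc n) u)"
      by (simp add: P_def)
    also have "\<dots> = (\<integral>\<^sup>+q. (\<integral>\<^sup>+x. h x \<partial>K n (idx n (snd q))) \<partial>\<gamma> n)"
    proof (rule Suc.IH)
      show "(\<lambda>q :: 'a \<times> 'a. \<integral>\<^sup>+x. h x \<partial>K n (idx n (snd q))) \<in> borel_measurable borel"
        using measurable_compose[OF measurable_compose[OF borel_snd idx[of n]],
            of "\<lambda>i. \<integral>\<^sup>+x. h x \<partial>K n i" borel] by simp
    qed
    also have "\<dots> = (\<integral>\<^sup>+x. h x \<partial>\<gamma> (Suc n))"
      unfolding K_def
      by (rule gluing.nn_integral_kernel[OF glu]) (simp add: measurable_cong_sets[OF c(2) refl] Suc.prems)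
    finally show ?case .
  qed
  have law_\<Omega>: "distr \<Omega> borel (\<lambda>\<omega>. \<omega> n) = \<gamma> n" for n
  proof (rule measure_eqI)
    fix A assume "A \<in> sets (distr \<Omega> borel (\<lambda>\<omega>. \<omega> n))"
    then have A [measurable]: "A \<in> sets borel" by simp
    have "emeasure (distr \<Omega> borel (\<lambda>\<omega>. \<omega> n)) A = (\<integral>\<^sup>+\<omega>. indicator A (\<omega> n) \<partial>\<Omega>)"
      using nn_integral_distr[OF coord_\<Omega>, of "indicator A" n] by simp
    also have "\<dots> = (\<integral>\<^sup>+\<omega>. indicator A ((restrict \<omega> {0..<Suc n}) n) \<partial>\<Omega>)" by simp
    also have "\<dots> = (\<integral>\<^sup>+\<omega>. indicator A (\<omega> n) \<partial>IT.C 0 (Suc n) u)"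
      by (rule integral_restr) (rule measurable_compose[OF coord], simp_all)
    also have "\<dots> = emeasure (\<gamma> n) A"
      using law[of "indicator A" n] c(2) by simp
    finally show "emeasure (distr \<Omega> borel (\<lambda>\<omega>. \<omega> n)) A = emeasure (\<gamma> n) A" .
  qed (simp add: c(2))
  have prob: "prob_space \<Omega>"
    using prob_space_distrD[OF coord_\<Omega>[of 0]] law_\<Omega>[of 0] c(1)[of 0] by simp
  have close: "AE \<omega> in \<Omega>. dist (snd (\<omega> n)) (fst (\<omega> (Suc n))) \<le> \<delta> n" for n
  proof -
    \<comment> \<open>The event that the chain leaves the cell between the pairs \<open>n\<close> and \<open>Suc n\<close> has measure zero.\<close>
    define B where "B \<omega> \<longleftrightarrow> idx n (fst (\<omega> (Suc n))) \<noteq> idx n (snd (\<omega> n))" for \<omega> :: "nat \<Rightarrow> 'a \<times> 'a"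
    have cell1: "(\<lambda>\<omega>. idx n (fst (\<omega> (Suc n)))) \<in> measurable (PiM J M) (count_space UNIV)" if "Suc n \<in> J" for J
      by (rule measurable_compose[OF measurable_compose[OF coord[OF that] borel_fst] idx])
    have B_meas: "Measurable.pred (PiM J M) B" if "n \<in> J" "Suc n \<in> J" for J
    proof -
      note [measurable] = cell1[OF that(2)] cell_meas[OF that(1)]
      show ?thesis unfolding B_def by measurable
    qed
    define b :: "(nat \<Rightarrow> 'a \<times> 'a) \<Rightarrow> ennreal" where "b \<omega> = (if B \<omega> then 1 else 0)" for \<omega>
    have b_meas: "b \<in> borel_measurable (PiM J M)" if "n \<in> J" "Suc n \<in> J" for J
    proof -
      note [measurable] = B_meas[OF that]
      show ?thesis unfolding b_def by measurable
    qed
    have "(\<integral>\<^sup>+\<omega>. b \<omega> \<partial>\<Omega>) = (\<integral>\<^sup>+\<omega>. b (restrict \<omega> {0..<Suc (Suc n)}) \<partial>\<Omega>)"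
      by (simp add: b_def B_def)
    also have "\<dots> = (\<integral>\<^sup>+\<omega>. b \<omega> \<partial>IT.C 0 (Suc (Suc n)) u)"
      by (rule integral_restr[OF b_meas]) simp_all
    also have "\<dots> = (\<integral>\<^sup>+\<omega>. (\<integral>\<^sup>+x. b (fun_upd \<omega> (Suc n) x) \<partial>P (Suc n) \<omega>) \<partial>IT.C 0 (Suc n) u)"
      by (rule step[OF b_meas]) simp_all
    also have "\<dots> = (\<integral>\<^sup>+\<omega>. emeasure (K n (idx n (snd (\<omega> n)))) {q \<in> space (\<gamma> (Suc n)). idx n (fst q) \<noteq> idx n (snd (\<omega> n))} \<partial>IT.C 0 (Suc n) u)"
    proof (intro nn_integral_cong)
      fix \<omega> :: "nat \<Rightarrow> 'a \<times> 'a"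
      let ?A = "{q :: 'a \<times> 'a. idx n (fst q) \<noteq> idx n (snd (\<omega> n))}"
      have [measurable]: "(\<lambda>q::'a \<times> 'a. idx n (fst q)) \<in> measurable borel (count_space UNIV)"
        by (rule measurable_compose[OF borel_fst idx])
      have A: "?A \<in> sets (K n (idx n (snd (\<omega> n))))" unfolding K_sets by measurable
      have "(\<integral>\<^sup>+x. b (fun_upd \<omega> (Suc n) x) \<partial>P (Suc n) \<omega>)
          = (\<integral>\<^sup>+x. indicator ?A x \<partial>K n (idx n (snd (\<omega> n))))"
        unfolding P_def by (simp add: b_def B_def indicator_def of_bool_def)
      also have "\<dots> = emeasure (K n (idx n (snd (\<omega> n)))) ?A"
        using A by (rule nn_integral_indicator)
      finally show "(\<integral>\<^sup>+x. b (fun_upd \<omega> (Suc n) x) \<partial>P (Suc n) \<omega>)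
          = emeasure (K n (idx n (snd (\<omega> n)))) {q \<in> space (\<gamma> (Suc n)). idx n (fst q) \<noteq> idx n (snd (\<omega> n))}"
        by (simp add: c(3))
    qed
    also have "\<dots> = (\<integral>\<^sup>+p. emeasure (K n (idx n (snd p))) {q \<in> space (\<gamma> (Suc n)). idx n (fst q) \<noteq> idx n (snd p)} \<partial>\<gamma> n)"
    proof (rule law)
      show "(\<lambda>p :: 'a \<times> 'a. emeasure (K n (idx n (snd p))) {q \<in> space (\<gamma> (Suc n)). idx n (fst q) \<noteq> idx n (snd p)}) \<in> borel_measurable borel"
        using measurable_compose[OF measurable_compose[OF borel_snd idx[of n]],
            of "\<lambda>i. emeasure (K n i) {q \<in> space (\<gamma> (Suc n)). idx n (fst q) \<noteq> i}" borel] by simp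
    qed
    also have "\<dots> = (\<integral>\<^sup>+p. 0 \<partial>\<gamma> n)"
      unfolding K_def by (rule nn_integral_cong_AE) (rule gluing.kernel_same_cell[OF glu])
    finally have "(\<integral>\<^sup>+\<omega>. b \<omega> \<partial>\<Omega>) = 0" by simp
    moreover have "b \<in> borel_measurable \<Omega>"
      using b_meas[of UNIV] by (simp add: measurable_cong_sets[OF sets_\<Omega> refl])
    ultimately have "AE \<omega> in \<Omega>. b \<omega> = 0"
      by (simp add: nn_integral_0_iff_AE)
    then show ?thesis
    proof eventually_elim
      case (elim \<omega>)
      then have "idx n (snd (\<omega> n)) = idx n (fst (\<omega> (Suc n)))"
        by (simp add: b_def B_def split: if_splits)
      then show ?case by (rule idx_dist)
    qed
  qed
  show thesis
    by (rule that[OF prob coord_\<Omega> law_\<Omega> close])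
qed

text \<open>Near-optimal plans between successive measures are realized on one probability space.  Along the
  chain the first components have the given laws and summable \<open>L\<^sup>2\<close> increments; the law of their
  \<open>L\<^sup>2\<close> limit is the limit measure.\<close>

lemma W2_complete:
  fixes \<mu> :: "nat \<Rightarrow> 'a::euclidean_space measure"
  assumes \<mu>: "\<And>n. \<mu> n \<in> P2" and summable: "summable (\<lambda>n. W2 (\<mu> n) (\<mu> (Suc n)))"
  obtains \<mu>' where "\<mu>' \<in> P2" "(\<lambda>n. W2 (\<mu> n) \<mu>') \<longlonglongrightarrow> 0"
proof -
  define \<delta> :: "nat \<Rightarrow> real" where "\<delta> n = (1/2)^n" for n
  have \<delta>: "0 < \<delta> n" for n by (simp add: \<delta>_def)
  have "\<exists>\<gamma>. \<gamma> \<in> couplings (\<mu> n) (\<mu> (Suc n)) \<and> l2norm \<gamma> (\<lambda>z. fst z - snd z) < W2 (\<mu> n) (\<mu> (Suc n)) + \<delta> n" for n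
    by (rule W2_near_optimal[OF \<mu> \<mu> \<delta>[of n]]) blast
  then obtain \<gamma> where \<gamma>: "\<And>n. \<gamma> n \<in> couplings (\<mu> n) (\<mu> (Suc n))"
    and cost: "\<And>n. l2norm (\<gamma> n) (\<lambda>z. fst z - snd z) < W2 (\<mu> n) (\<mu> (Suc n)) + \<delta> n"
    by metis
  note c = couplingsD[OF \<gamma> \<mu> \<mu>]
  obtain \<Omega> :: "(nat \<Rightarrow> 'a \<times> 'a) measure" where \<Omega>: "prob_space \<Omega>"
    and coord: "\<And>n. (\<lambda>\<omega>. \<omega> n) \<in> borel_measurable \<Omega>"
    and law: "\<And>n. distr \<Omega> borel (\<lambda>\<omega>. \<omega> n) = \<gamma> n"
    and close: "\<And>n. AE \<omega> in \<Omega>. dist (snd (\<omega> n)) (fst (\<omega> (Suc n))) \<le> \<delta> n"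
    by (rule chain_of_couplings[of \<mu> \<gamma> \<delta>, OF \<mu> \<gamma> \<delta>]) (rule that; assumption)
  interpret prob_space \<Omega> by (rule \<Omega>)
  have borel_fst: "fst \<in> borel_measurable (borel :: ('a \<times> 'a) measure)"
    and borel_snd: "snd \<in> borel_measurable (borel :: ('a \<times> 'a) measure)"
    by (simp_all add: borel_prod[symmetric])
  define X where "X n \<omega> = fst (\<omega> n)" for n and \<omega> :: "nat \<Rightarrow> 'a \<times> 'a"
  define Z where "Z n \<omega> = snd (\<omega> n)" for n and \<omega> :: "nat \<Rightarrow> 'a \<times> 'a"
  have sX: "sq_integrable \<Omega> (X n)" and sZ: "sq_integrable \<Omega> (Z n)" for n
    using sq_integrable_distr_iff[OF coord[of n] borel_fst] sq_integrable_distr_iff[OF coord[of n] borel_snd]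
      c(8,9)[of n] unfolding X_def Z_def law by auto
  have XZ: "l2norm \<Omega> (\<lambda>\<omega>. X n \<omega> - Z n \<omega>) \<le> W2 (\<mu> n) (\<mu> (Suc n)) + \<delta> n" for n
    using l2norm_distr[OF coord[of n], of "\<lambda>z. fst z - snd z"] cost[of n] borel_fst borel_snd
    unfolding law X_def Z_def by simp
  have ZX: "l2norm \<Omega> (\<lambda>\<omega>. Z n \<omega> - X (Suc n) \<omega>) \<le> \<delta> n" for n
  proof -
    have "l2norm \<Omega> (\<lambda>\<omega>. Z n \<omega> - X (Suc n) \<omega>) \<le> l2norm \<Omega> (\<lambda>\<omega>. \<delta> n)"
    proof (rule l2norm_mono)
      show "AE \<omega> in \<Omega>. norm (Z n \<omega> - X (Suc n) \<omega>) \<le> norm (\<delta> n)"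
        using close[of n] by eventually_elim (simp add: X_def Z_def dist_norm \<delta>_def)
    qed (intro sq_integrable_diff sX sZ sq_integrable_const)+
    then show ?thesis using \<delta>[of n] by simp
  qed
  define b where "b n = W2 (\<mu> n) (\<mu> (Suc n)) + 2 * \<delta> n" for n
  have b_summable: "summable b"
    unfolding b_def \<delta>_def by (intro summable_add summable summable_mult summable_geometric) simp
  have b: "l2norm \<Omega> (\<lambda>\<omega>. X n \<omega> - X (Suc n) \<omega>) \<le> b n" for n
  proof -
    have "(\<lambda>\<omega>. X n \<omega> - X (Suc n) \<omega>) = (\<lambda>\<omega>. (X n \<omega> - Z n \<omega>) + (Z n \<omega> - X (Suc n) \<omega>))"
      by (simp add: fun_eq_iff)
    then have "l2norm \<Omega> (\<lambda>\<omega>. X n \<omega> - X (Suc n) \<omega>)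
        \<le> l2norm \<Omega> (\<lambda>\<omega>. X n \<omega> - Z n \<omega>) + l2norm \<Omega> (\<lambda>\<omega>. Z n \<omega> - X (Suc n) \<omega>)"
      using l2norm_triangle[OF sq_integrable_diff[OF sX[of n] sZ[of n]]
          sq_integrable_diff[OF sZ[of n] sX[of "Suc n"]]] by simp
    then show ?thesis using XZ[of n] ZX[of n] by (simp add: b_def)
  qed
  have chain: "l2norm \<Omega> (\<lambda>\<omega>. X m \<omega> - X (m + k) \<omega>) \<le> (\<Sum>i<k. b (m + i))" for m k
  proof (induction k)
    case (Suc k)
    have "(\<lambda>\<omega>. X m \<omega> - X (m + Suc k) \<omega>) = (\<lambda>\<omega>. (X m \<omega> - X (m + k) \<omega>) + (X (m + k) \<omega> - X (Suc (m + k)) \<omega>))"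
      by (simp add: fun_eq_iff)
    then have "l2norm \<Omega> (\<lambda>\<omega>. X m \<omega> - X (m + Suc k) \<omega>)
        \<le> l2norm \<Omega> (\<lambda>\<omega>. X m \<omega> - X (m + k) \<omega>) + l2norm \<Omega> (\<lambda>\<omega>. X (m + k) \<omega> - X (Suc (m + k)) \<omega>)"
      using l2norm_triangle[OF sq_integrable_diff[OF sX[of m] sX[of "m + k"]]
          sq_integrable_diff[OF sX[of "m + k"] sX[of "Suc (m + k)"]]] by simp
    then show ?case using Suc b[of "m + k"] by simp
  qed (simp add: l2norm_def)
  have b_nonneg: "0 \<le> b n" for n using \<delta>[of n] by (simp add: b_def)
  have Cauchy: "\<exists>N. \<forall>m\<ge>N. \<forall>n\<ge>N. l2norm \<Omega> (\<lambda>\<omega>. X m \<omega> - X n \<omega>) < e" if "0 < e" for e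
  proof -
    obtain N where N: "\<And>m n. N \<le> m \<Longrightarrow> norm (\<Sum>i=m..<n. b i) < e"
      using b_summable \<open>0 < e\<close> unfolding summable_Cauchy by blast
    have le: "l2norm \<Omega> (\<lambda>\<omega>. X m \<omega> - X n \<omega>) < e" if "N \<le> m" "m \<le> n" for m n
    proof -
      have "(\<Sum>i<n - m. b (m + i)) = (\<Sum>i=m..<n. b i)"
        using sum.shift_bounds_nat_ivl[of b 0 m "n - m"] that(2) by (simp add: lessThan_atLeast0 add.commute)
      then show ?thesis
        using chain[of m "n - m"] N[OF that(1), of n] that(2) by simp
    qed
    have "l2norm \<Omega> (\<lambda>\<omega>. X m \<omega> - X n \<omega>) < e" if "N \<le> m" "N \<le> n" for m n
    proof (cases "m \<le> n")
      case False
      then have "l2norm \<Omega> (\<lambda>\<omega>. X n \<omega> - X m \<omega>) < e" using le that by simp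
      then show ?thesis by (simp add: l2norm_def norm_minus_commute)
    qed (use le that in simp)
    then show ?thesis by blast
  qed
  obtain g where g: "sq_integrable \<Omega> g" "(\<lambda>n. l2norm \<Omega> (\<lambda>\<omega>. X n \<omega> - g \<omega>)) \<longlonglongrightarrow> 0"
    using l2_complete[OF sX Cauchy] by blast
  have dX: "distr \<Omega> borel (X n) = \<mu> n" for n
  proof -
    have "distr \<Omega> borel (X n) = distr (distr \<Omega> borel (\<lambda>\<omega>. \<omega> n)) borel fst"
      using coord[of n] borel_fst by (subst distr_distr) (auto simp: comp_def X_def[abs_def])
    then show ?thesis by (simp add: law c(4))
  qed
  show thesis
  proof (rule that)
    show "distr \<Omega> borel g \<in> P2" by (rule distr_in_P2[OF \<Omega> g(1)])
    have "W2 (\<mu> n) (distr \<Omega> borel g) \<le> l2norm \<Omega> (\<lambda>\<omega>. X n \<omega> - g \<omega>)" for n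
      using W2_le_random_variables[OF \<Omega> sX[of n] g(1)] by (simp add: dX)
    then show "(\<lambda>n. W2 (\<mu> n) (distr \<Omega> borel g)) \<longlonglongrightarrow> 0"
      by (intro tendsto_sandwich[OF _ _ tendsto_const g(2)]) auto
  qed
qed

section \<open>Exact subgradients from approximate ones\<close>

text \<open>A weak-compactness statement in \<open>L\<^sup>2\<close> proved by minimal norms: the fields that satisfy all
  constraints up to \<open>e\<close> form convex sets decreasing with \<open>e\<close>, and by the parallelogram law almost
  minimal elements of these sets form a Cauchy sequence.\<close>

lemma (in prob_space) l2_constraints_limit:
  fixes l :: "'i \<Rightarrow> ('a \<Rightarrow> 'b::euclidean_space) \<Rightarrow> real"
  assumes mid: "\<And>i f g. i \<in> I \<Longrightarrow> sq_integrable M f \<Longrightarrow> sq_integrable M g \<Longrightarrow>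
      l i (\<lambda>x. (1/2) *\<^sub>R (f x + g x)) \<le> (l i f + l i g) / 2"
    and lip: "\<And>i f g. i \<in> I \<Longrightarrow> sq_integrable M f \<Longrightarrow> sq_integrable M g \<Longrightarrow>
      \<bar>l i f - l i g\<bar> \<le> K i * l2norm M (\<lambda>x. f x - g x)"
    and approx: "\<And>e. 0 < e \<Longrightarrow> \<exists>f. sq_integrable M f \<and> l2norm M f \<le> b \<and> (\<forall>i\<in>I. l i f \<le> a i + e)"
  obtains f where "sq_integrable M f" "l2norm M f \<le> b" "\<And>i. i \<in> I \<Longrightarrow> l i f \<le> a i"
proof -
  define e :: "nat \<Rightarrow> real" where "e k = 1 / (real k + 1)" for k
  have e_pos: "0 < e k" for k by (simp add: e_def)
  have e_mono: "e j \<le> e k" if "k \<le> j" for j k using that by (simp add: e_def frac_le)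
  have e_lim: "e \<longlonglongrightarrow> 0"
    unfolding e_def using LIMSEQ_inverse_real_of_nat by (simp add: inverse_eq_divide add.commute)
  define C where "C k = {f. sq_integrable M f \<and> l2norm M f \<le> b \<and> (\<forall>i\<in>I. l i f \<le> a i + e k)}" for k
  have C_ne: "C k \<noteq> {}" for k
    using approx[OF e_pos[of k]] by (auto simp: C_def)
  have C_anti: "C j \<subseteq> C k" if "k \<le> j" for j k
    using e_mono[OF that] by (force simp: C_def)
  define Q where "Q k = (\<lambda>f. (l2norm M f)\<^sup>2) ` C k" for k
  define d where "d k = Inf (Q k)" for k
  have Q_bdd: "bdd_below (Q k)" for k unfolding Q_def by (rule bdd_belowI2[of _ 0]) simp
  have d_le: "d k \<le> (l2norm M f)\<^sup>2" if "f \<in> C k" for f k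
    unfolding d_def using that by (intro cInf_lower Q_bdd) (simp add: Q_def)
  have "\<exists>f. f \<in> C k \<and> (l2norm M f)\<^sup>2 < d k + e k" for k
  proof -
    have "Inf (Q k) < d k + e k" using e_pos[of k] by (simp add: d_def)
    then obtain q where "q \<in> Q k" "q < d k + e k"
      using C_ne[of k] by (subst (asm) cInf_less_iff[OF _ Q_bdd]) (auto simp: Q_def)
    then show ?thesis by (auto simp: Q_def)
  qed
  then obtain f where f: "\<And>k. f k \<in> C k" and f_min: "\<And>k. (l2norm M (f k))\<^sup>2 < d k + e k"
    by metis
  have sq: "sq_integrable M (f k)" and fb: "l2norm M (f k) \<le> b" for k
    using f[of k] by (auto simp: C_def)
  have d_mono: "d k \<le> d j" if "k \<le> j" for k j
    unfolding d_def[of j]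
  proof (rule cInf_greatest)
    show "Q j \<noteq> {}" using C_ne by (simp add: Q_def)
    fix q assume "q \<in> Q j"
    then show "d k \<le> q" using d_le C_anti[OF that] by (auto simp: Q_def)
  qed
  have d_bound: "d k \<le> b\<^sup>2" for k
    using d_le[OF f[of k]] fb[of k] power_mono[of "l2norm M (f k)" b 2] by simp
  have "convergent d"
    using d_mono d_bound by (intro Bseq_mono_convergent incseq_bounded)
      (auto simp: incseq_def Bseq_eq_bounded intro: order_trans)
  then obtain D where D: "d \<longlonglongrightarrow> D" by (auto simp: convergent_def)
  have dD: "d k \<le> D" for k using D d_mono by (intro incseq_le) (auto simp: incseq_def)
  have close: "(l2norm M (\<lambda>x. f j x - f k x))\<^sup>2 \<le> 2 * (D - d k) + 4 * e k" if kj: "k \<le> j" for j k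
  proof -
    define h where "h x = (1/2) *\<^sub>R (f j x + f k x)" for x
    have sum: "sq_integrable M (\<lambda>x. f j x + f k x)" by (intro sq_integrable_add sq)
    have n_sum: "l2norm M h = l2norm M (\<lambda>x. f j x + f k x) / 2"
      unfolding h_def by (simp add: l2norm_scaleR)
    have fj: "f j \<in> C k" using f C_anti[OF kj] by blast
    have "h \<in> C k"
      unfolding C_def
    proof (intro CollectI conjI ballI)
      show "sq_integrable M h" unfolding h_def by (intro sq_integrable_scaleR sum)
      show "l2norm M h \<le> b"
        using l2norm_triangle[OF sq[of j] sq[of k]] fb[of j] fb[of k] n_sum by simp
      fix i assume i: "i \<in> I"
      have "l i h \<le> (l i (f j) + l i (f k)) / 2" unfolding h_def by (rule mid[OF i sq sq])
      moreover have "l i (f j) \<le> a i + e k" "l i (f k) \<le> a i + e k"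
        using fj f[of k] i by (auto simp: C_def)
      ultimately show "l i h \<le> a i + e k" by (simp add: field_simps)
    qed
    then have "4 * d k \<le> (l2norm M (\<lambda>x. f j x + f k x))\<^sup>2"
      using d_le[of h k] n_sum by (simp add: power_divide)
    moreover have "(l2norm M (\<lambda>x. f j x + f k x))\<^sup>2 + (l2norm M (\<lambda>x. f j x - f k x))\<^sup>2
        = 2 * (l2norm M (f j))\<^sup>2 + 2 * (l2norm M (f k))\<^sup>2"
      using l2norm_add_power2[OF sq[of j] sq[of k]]
        l2norm_add_power2[OF sq[of j] sq_integrable_scaleR[OF sq[of k], of "-1"]]
        l2norm_scaleR[of M "-1" "f k"] by simp
    moreover have "(l2norm M (f j))\<^sup>2 \<le> D + e k"
      using f_min[of j] dD[of j] e_mono[OF kj] by linarith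
    moreover have "(l2norm M (f k))\<^sup>2 \<le> d k + e k"
      using f_min[of k] by linarith
    ultimately show ?thesis unfolding right_diff_distrib by linarith
  qed
  have Cauchy: "\<exists>N. \<forall>m\<ge>N. \<forall>n\<ge>N. l2norm M (\<lambda>x. f m x - f n x) < r" if r: "0 < r" for r
  proof -
    have "(\<lambda>k. 2 * (D - d k) + 4 * e k) \<longlonglongrightarrow> 2 * (D - D) + 4 * 0"
      by (intro tendsto_intros D e_lim)
    moreover have "2 * (D - D) + 4 * 0 < r\<^sup>2" using zero_less_power[OF r, of 2] by simp
    ultimately have "\<forall>\<^sub>F k in sequentially. 2 * (D - d k) + 4 * e k < r\<^sup>2"
      by (rule order_tendstoD(2))
    then obtain N where N: "\<And>k. N \<le> k \<Longrightarrow> 2 * (D - d k) + 4 * e k < r\<^sup>2"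
      unfolding eventually_sequentially by blast
    have lt: "l2norm M (\<lambda>x. f m x - f n x) < r" if "n \<le> m" "N \<le> n" for m n
    proof (rule power2_less_imp_less)
      show "(l2norm M (\<lambda>x. f m x - f n x))\<^sup>2 < r\<^sup>2"
        using close[OF that(1)] N[OF that(2)] by linarith
    qed (use r in simp)
    have "l2norm M (\<lambda>x. f m x - f n x) < r" if "N \<le> m" "N \<le> n" for m n
    proof (cases "n \<le> m")
      case False
      then have "l2norm M (\<lambda>x. f n x - f m x) < r" using lt that by simp
      then show ?thesis by (simp add: l2norm_def norm_minus_commute)
    qed (use lt that in simp)
    then show ?thesis by blast
  qed
  obtain g where g: "sq_integrable M g" "(\<lambda>n. l2norm M (\<lambda>x. f n x - g x)) \<longlonglongrightarrow> 0"
    using l2_complete[OF sq Cauchy] by blast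
  show thesis
  proof (rule that[OF g(1)])
    have "l2norm M g \<le> b + l2norm M (\<lambda>x. f n x - g x)" for n
    proof -
      have "l2norm M g = l2norm M (\<lambda>x. f n x + (-1) *\<^sub>R (f n x - g x))" by simp
      also have "\<dots> \<le> l2norm M (f n) + l2norm M (\<lambda>x. (-1) *\<^sub>R (f n x - g x))"
        by (intro l2norm_triangle sq sq_integrable_scaleR sq_integrable_diff g(1))
      also have "l2norm M (\<lambda>x. (-1) *\<^sub>R (f n x - g x)) = l2norm M (\<lambda>x. f n x - g x)"
        by (subst l2norm_scaleR) simp
      finally show ?thesis using fb[of n] by linarith
    qed
    moreover have "(\<lambda>n. b + l2norm M (\<lambda>x. f n x - g x)) \<longlonglongrightarrow> b + 0"
      by (intro tendsto_intros g(2))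
    ultimately show "l2norm M g \<le> b"
      by (intro LIMSEQ_le_const[of _ b]) auto
    fix i assume i: "i \<in> I"
    have "l i g \<le> a i + e n + K i * l2norm M (\<lambda>x. f n x - g x)" for n
      using lip[OF i sq[of n] g(1)] f[of n] i by (auto simp: C_def)
    moreover have "(\<lambda>n. a i + e n + K i * l2norm M (\<lambda>x. f n x - g x)) \<longlonglongrightarrow> a i + 0 + K i * 0"
      by (intro tendsto_intros g(2) e_lim)
    ultimately show "l i g \<le> a i"
      by (intro LIMSEQ_le_const[of _ "a i"]) auto
  qed
qed

text \<open>The linear term in the definition of \<^const>\<open>frechet_subdiff\<close>.\<close>

definition displacement_pairing :: "('a \<times> 'a) measure \<Rightarrow> ('a::euclidean_space \<Rightarrow> 'a) \<Rightarrow> real" where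
  "displacement_pairing \<gamma> \<xi> = (\<integral>z. \<xi> (fst z) \<bullet> (snd z - fst z) \<partial>\<gamma>)"

lemma displacement_pairing_lipschitz:
  assumes "\<gamma> \<in> couplings \<mu> \<nu>" "\<mu> \<in> P2" "\<nu> \<in> P2" "sq_integrable \<mu> f" "sq_integrable \<mu> g"
  shows "\<bar>displacement_pairing \<gamma> f - displacement_pairing \<gamma> g\<bar>
      \<le> l2norm \<gamma> (\<lambda>z. fst z - snd z) * l2norm \<mu> (\<lambda>x. f x - g x)"
    and "displacement_pairing \<gamma> (\<lambda>x. (1/2) *\<^sub>R (f x + g x))
      = (displacement_pairing \<gamma> f + displacement_pairing \<gamma> g) / 2"
proof -
  note c = couplingsD[OF assms(1-3)]
  have borel: "h \<in> borel_measurable borel" if "sq_integrable \<mu> h" for h :: "'a \<Rightarrow> 'a"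
    using sq_integrableD(1)[OF that] by (simp add: measurable_cong_sets[OF P2D(2)[OF assms(2)] refl])
  have sq: "sq_integrable \<gamma> (\<lambda>z. h (fst z))" if "sq_integrable \<mu> h" for h :: "'a \<Rightarrow> 'a"
    using that sq_integrable_distr_iff[OF c(6) borel[OF that]] c(4) by simp
  have sd: "sq_integrable \<gamma> (\<lambda>z. snd z - fst z)" by (intro sq_integrable_diff c)
  note int = integrable_inner_sq[OF sq[OF assms(4)] sd] integrable_inner_sq[OF sq[OF assms(5)] sd]
  have "displacement_pairing \<gamma> f - displacement_pairing \<gamma> g = (\<integral>z. (f (fst z) - g (fst z)) \<bullet> (snd z - fst z) \<partial>\<gamma>)"
    unfolding displacement_pairing_def using int by (simp add: inner_diff_left)
  also have "\<bar>\<dots>\<bar> \<le> l2norm \<gamma> (\<lambda>z. f (fst z) - g (fst z)) * l2norm \<gamma> (\<lambda>z. snd z - fst z)"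
    by (intro integral_inner_le sq_integrable_diff sq assms sd)
  also have "l2norm \<gamma> (\<lambda>z. f (fst z) - g (fst z)) = l2norm \<mu> (\<lambda>x. f x - g x)"
    using l2norm_distr[OF c(6), of "\<lambda>x. f x - g x"] borel[OF assms(4)] borel[OF assms(5)] c(4) by simp
  also have "l2norm \<gamma> (\<lambda>z. snd z - fst z) = l2norm \<gamma> (\<lambda>z. fst z - snd z)"
    by (simp add: l2norm_def norm_minus_commute)
  finally show "\<bar>displacement_pairing \<gamma> f - displacement_pairing \<gamma> g\<bar>
      \<le> l2norm \<gamma> (\<lambda>z. fst z - snd z) * l2norm \<mu> (\<lambda>x. f x - g x)"
    by (simp add: mult.commute)
  show "displacement_pairing \<gamma> (\<lambda>x. (1/2) *\<^sub>R (f x + g x))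
      = (displacement_pairing \<gamma> f + displacement_pairing \<gamma> g) / 2"
    unfolding displacement_pairing_def using int by (simp add: inner_add_left add_divide_distrib)
qed

text \<open>Every plan contributes one affine constraint on the subgradient, with remainder
  \<open>- C * s\<^sup>2\<close>; the exact constraints are the limit of the approximate ones.\<close>

lemma frechet_subdiff_of_approximate:
  assumes \<mu>: "\<mu> \<in> P2" and \<phi>\<mu>: "\<phi> \<mu> = ereal p"
    and approx: "\<And>e. 0 < e \<Longrightarrow> \<exists>\<xi>. sq_integrable \<mu> \<xi> \<and> l2norm \<mu> \<xi> \<le> b \<and>
      (\<forall>\<nu>\<in>P2. \<forall>\<gamma>\<in>optimal_plans \<mu> \<nu>.
        ereal (p + displacement_pairing \<gamma> \<xi> - C * (W2 \<mu> \<nu>)\<^sup>2 - e) \<le> \<phi> \<nu>)"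
  obtains \<xi> where "\<xi> \<in> frechet_subdiff \<phi> \<mu>" "L2_norm \<mu> \<xi> \<le> b"
proof -
  interpret prob_space \<mu> by (rule P2D(1)[OF \<mu>])
  define I where "I = {(\<nu>, \<gamma>). \<nu> \<in> P2 \<and> \<gamma> \<in> optimal_plans \<mu> \<nu> \<and> \<phi> \<nu> \<noteq> \<infinity>}"
  define a where "a = (\<lambda>(\<nu>, \<gamma> :: ('a \<times> 'a) measure). real_of_ereal (\<phi> \<nu>) - p + C * (W2 \<mu> \<nu>)\<^sup>2)"
  have fin: "ereal (real_of_ereal (\<phi> \<nu>)) = \<phi> \<nu>" if "(\<nu>, \<gamma>) \<in> I" for \<nu> \<gamma>
  proof -
    have "\<phi> \<nu> \<noteq> -\<infinity>" using approx[of 1] that by (auto simp: I_def)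
    then show ?thesis using that by (auto simp: I_def ereal_real)
  qed
  have coup: "\<gamma> \<in> couplings \<mu> \<nu>" "\<nu> \<in> P2" if "(\<nu>, \<gamma>) \<in> I" for \<nu> \<gamma>
    using that by (auto simp: I_def optimal_plans_def)
  obtain \<xi> where \<xi>: "sq_integrable \<mu> \<xi>" "l2norm \<mu> \<xi> \<le> b"
    "\<And>i. i \<in> I \<Longrightarrow> displacement_pairing (snd i) \<xi> \<le> a i"
  proof (rule l2_constraints_limit[where I = I and l = "\<lambda>i. displacement_pairing (snd i)" and a = a
        and b = b and K = "\<lambda>i. l2norm (snd i) (\<lambda>z. fst z - snd z)"])
    fix i and f g :: "'a \<Rightarrow> 'a" assume i: "i \<in> I" and fg: "sq_integrable \<mu> f" "sq_integrable \<mu> g"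
    obtain \<nu> \<gamma> where [simp]: "i = (\<nu>, \<gamma>)" by (cases i)
    have "(\<nu>, \<gamma>) \<in> I" using i by simp
    note L = displacement_pairing_lipschitz[OF coup(1)[OF this] \<mu> coup(2)[OF this] fg]
    show "displacement_pairing (snd i) (\<lambda>x. (1/2) *\<^sub>R (f x + g x))
        \<le> (displacement_pairing (snd i) f + displacement_pairing (snd i) g) / 2"
      using L(2) i by simp
    show "\<bar>displacement_pairing (snd i) f - displacement_pairing (snd i) g\<bar>
        \<le> l2norm (snd i) (\<lambda>z. fst z - snd z) * l2norm \<mu> (\<lambda>x. f x - g x)"
      using L(1) i by simp
  next
    fix e :: real assume "0 < e"
    then obtain \<xi> where \<xi>: "sq_integrable \<mu> \<xi>" "l2norm \<mu> \<xi> \<le> b"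
      "\<And>\<nu> \<gamma>. \<nu> \<in> P2 \<Longrightarrow> \<gamma> \<in> optimal_plans \<mu> \<nu> \<Longrightarrow>
        ereal (p + displacement_pairing \<gamma> \<xi> - C * (W2 \<mu> \<nu>)\<^sup>2 - e) \<le> \<phi> \<nu>"
      using approx by metis
    have "displacement_pairing (snd i) \<xi> \<le> a i + e" if i: "i \<in> I" for i
    proof -
      obtain \<nu> \<gamma> where [simp]: "i = (\<nu>, \<gamma>)" by (cases i)
      have "ereal (p + displacement_pairing \<gamma> \<xi> - C * (W2 \<mu> \<nu>)\<^sup>2 - e) \<le> ereal (real_of_ereal (\<phi> \<nu>))"
        using \<xi>(3)[of \<nu> \<gamma>] fin[of \<nu> \<gamma>] i by (simp add: I_def)
      then show ?thesis by (simp add: a_def)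
    qed
    then show "\<exists>f. sq_integrable \<mu> f \<and> l2norm \<mu> f \<le> b \<and> (\<forall>i\<in>I. displacement_pairing (snd i) f \<le> a i + e)"
      using \<xi>(1,2) by blast
  qed blast
  have \<xi>_borel: "\<xi> \<in> borel_measurable borel"
    using sq_integrableD(1)[OF \<xi>(1)] by (simp add: measurable_cong_sets[OF P2D(2)[OF \<mu>] refl])
  have maps: "\<xi> \<in> L2_maps \<mu>"
    using sq_integrableD[OF \<xi>(1)] \<xi>_borel unfolding L2_maps_def
    by (simp add: integrable_iff_bounded)
  have ineq: "\<phi> \<nu> - \<phi> \<mu> \<ge> (SUP \<gamma>\<in>optimal_plans \<mu> \<nu>. ereal (\<integral>z. \<xi> (fst z) \<bullet> (snd z - fst z) \<partial>\<gamma>))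
      + ereal (- C * (W2 \<mu> \<nu>)\<^sup>2)" if \<nu>: "\<nu> \<in> P2" for \<nu>
  proof (cases "\<phi> \<nu> = \<infinity>")
    case True then show ?thesis by (simp add: \<phi>\<mu>)
  next
    case False
    show ?thesis
    proof (cases "optimal_plans \<mu> \<nu> = {}")
      case True then show ?thesis by (simp add: bot_ereal_def)
    next
      case ne: False
      then obtain \<gamma>0 where "(\<nu>, \<gamma>0) \<in> I" using False \<nu> by (auto simp: I_def)
      then have r: "\<phi> \<nu> = ereal (real_of_ereal (\<phi> \<nu>))" using fin by simp
      have "(SUP \<gamma>\<in>optimal_plans \<mu> \<nu>. ereal (\<integral>z. \<xi> (fst z) \<bullet> (snd z - fst z) \<partial>\<gamma>))
          \<le> ereal (real_of_ereal (\<phi> \<nu>) - p + C * (W2 \<mu> \<nu>)\<^sup>2)"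
      proof (rule SUP_least)
        fix \<gamma> assume "\<gamma> \<in> optimal_plans \<mu> \<nu>"
        then have "(\<nu>, \<gamma>) \<in> I" using False \<nu> by (simp add: I_def)
        from \<xi>(3)[OF this] show "ereal (\<integral>z. \<xi> (fst z) \<bullet> (snd z - fst z) \<partial>\<gamma>)
            \<le> ereal (real_of_ereal (\<phi> \<nu>) - p + C * (W2 \<mu> \<nu>)\<^sup>2)"
          by (simp add: displacement_pairing_def a_def)
      qed
      then have "(SUP \<gamma>\<in>optimal_plans \<mu> \<nu>. ereal (\<integral>z. \<xi> (fst z) \<bullet> (snd z - fst z) \<partial>\<gamma>))
          + ereal (- C * (W2 \<mu> \<nu>)\<^sup>2)
          \<le> ereal (real_of_ereal (\<phi> \<nu>) - p + C * (W2 \<mu> \<nu>)\<^sup>2) + ereal (- C * (W2 \<mu> \<nu>)\<^sup>2)"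
        by (rule add_right_mono)
      also have "\<dots> = \<phi> \<nu> - \<phi> \<mu>" by (subst (2) r) (simp add: \<phi>\<mu>)
      finally show ?thesis .
    qed
  qed
  have rate: "((\<lambda>s. (- C * s\<^sup>2) / s) \<longlongrightarrow> 0) (at_right 0)"
  proof -
    have "((\<lambda>s. - C * s) \<longlongrightarrow> - C * 0) (at_right 0)" by (intro tendsto_intros)
    moreover have "\<forall>\<^sub>F s :: real in at_right 0. - C * s = (- C * s\<^sup>2) / s"
      using eventually_at_right_less[of "0::real"] by eventually_elim (simp add: power2_eq_square)
    ultimately have "((\<lambda>s. (- C * s\<^sup>2) / s) \<longlongrightarrow> - C * 0) (at_right 0)"
      by (rule Lim_transform_eventually)
    then show ?thesis by simp
  qed
  show thesis
  proof (rule that)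
    show "\<xi> \<in> frechet_subdiff \<phi> \<mu>"
      unfolding frechet_subdiff_def
    proof (intro CollectI conjI exI ballI)
      show "\<mu> \<in> domain \<phi>" using \<mu> by (simp add: domain_def \<phi>\<mu>)
    qed (fact maps rate ineq)+
    show "L2_norm \<mu> \<xi> \<le> b" using \<xi>(2) by (simp add: L2_norm_def l2norm_def)
  qed
qed

section \<open>One step of the forward-backward scheme\<close>

text \<open>In the application \<open>\<Phi>\<close> is the sum of the functional that is convex along generalized geodesics and
  the potential energy of the convex function \<open>G\<close>.\<close>

locale forward_backward = smooth_convex H g L
  for H :: "'a::euclidean_space \<Rightarrow> real" and g L +
  fixes \<Phi> :: "'a measure \<Rightarrow> ereal"
  assumes H_growth: "quadratic_growth H"
    and Phi_not_MInfty: "\<And>\<mu>. \<mu> \<in> P2 \<Longrightarrow> \<Phi> \<mu> \<noteq> -\<infinity>"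
begin

definition F :: "'a measure \<Rightarrow> ereal" where
  "F \<mu> = \<Phi> \<mu> - ereal (potential_energy H \<mu>)"

definition forward :: "real \<Rightarrow> 'a measure \<Rightarrow> 'a measure" where
  "forward \<tau> \<mu> = distr \<mu> borel (\<lambda>x. x + \<tau> *\<^sub>R g x)"

text \<open>The transport part of the backward step, rewritten on plans that start at \<open>\<mu>\<close> instead of
  \<open>forward \<tau> \<mu>\<close>: up to a constant, \<open>norm (w + \<tau> *\<^sub>R g w - y)\<^sup>2 / (2 * \<tau>)\<close>.\<close>

definition step_cost :: "real \<Rightarrow> 'a \<Rightarrow> 'a \<Rightarrow> real" where
  "step_cost \<tau> w y = (norm (w - y))\<^sup>2 / (2 * \<tau>) - g w \<bullet> (y - w)"

definition plan_cost :: "real \<Rightarrow> ('a \<times> 'a) measure \<Rightarrow> real" where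
  "plan_cost \<tau> \<gamma> = (\<integral>z. step_cost \<tau> (fst z) (snd z) \<partial>\<gamma>)"

text \<open>For \<open>e = 0\<close> this is joint minimality of \<open>\<sigma>\<close> and \<open>\<gamma>\<close>; a positive \<open>e\<close> leaves room for plans that are
  only almost optimal.\<close>

definition near_minimal :: "real \<Rightarrow> real \<Rightarrow> 'a measure \<Rightarrow> 'a measure \<Rightarrow> ('a \<times> 'a) measure \<Rightarrow> bool" where
  "near_minimal \<tau> e \<mu> \<sigma> \<gamma> \<longleftrightarrow> \<gamma> \<in> couplings \<mu> \<sigma> \<and> (\<forall>\<rho>\<in>P2. \<forall>\<gamma>'\<in>couplings \<mu> \<rho>.
     \<Phi> \<sigma> + ereal (plan_cost \<tau> \<gamma>) \<le> \<Phi> \<rho> + ereal (plan_cost \<tau> \<gamma>' + e))"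

text \<open>The residual of the optimality condition of the backward step, the gradient of \<open>H\<close> at the new
  point subtracted.\<close>

definition residual :: "real \<Rightarrow> 'a \<times> 'a \<Rightarrow> 'a" where
  "residual \<tau> z = (1 / \<tau>) *\<^sub>R (fst z - snd z) + (g (fst z) - g (snd z))"

lemma sq_integrable_g:
  assumes "prob_space M" "sq_integrable M X"
  shows "sq_integrable M (\<lambda>\<omega>. g (X \<omega>))"
proof -
  interpret prob_space M by fact
  note [measurable] = sq_integrableD(1)[OF assms(2)]
  show ?thesis
    by (rule sq_integrable_linear_growth[OF assms(2), where a = "norm (g 0)" and b = L])
       (measurable, rule g_linear_growth)
qed

lemma integrable_H:
  assumes "prob_space M" "sq_integrable M X"
  shows "integrable M (\<lambda>\<omega>. H (X \<omega>))"
  using prob_space.integrable_quadratic_growth[OF assms(1) H_growth measurable_H assms(2)] .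

lemma integrable_step_cost:
  assumes "prob_space M" "sq_integrable M X" "sq_integrable M Y"
  shows "integrable M (\<lambda>\<omega>. step_cost \<tau> (X \<omega>) (Y \<omega>))"
  unfolding step_cost_def
  using sq_integrableD(2)[OF sq_integrable_diff[OF assms(2,3)]]
    integrable_inner_sq[OF sq_integrable_g[OF assms(1,2)] sq_integrable_diff[OF assms(3,2)]]
  by (intro Bochner_Integration.integrable_diff) auto

lemma sq_integrable_residual:
  assumes "prob_space M" "sq_integrable M fst" "sq_integrable M snd"
  shows "sq_integrable M (residual \<tau>)"
  unfolding residual_def[abs_def]
  by (intro sq_integrable_add sq_integrable_scaleR sq_integrable_diff sq_integrable_g assms)

lemma step_cost_measurable: "(\<lambda>z. step_cost \<tau> (fst z) (snd z)) \<in> borel_measurable borel"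
  unfolding step_cost_def borel_prod[symmetric] by measurable

lemma plan_cost_distr:
  assumes "X \<in> borel_measurable M" "Y \<in> borel_measurable M"
  shows "plan_cost \<tau> (distr M borel (\<lambda>\<omega>. (X \<omega>, Y \<omega>))) = (\<integral>\<omega>. step_cost \<tau> (X \<omega>) (Y \<omega>) \<partial>M)"
  unfolding plan_cost_def
  using assms step_cost_measurable by (subst integral_distr) (auto simp: borel_prod[symmetric])

lemma forward_in_P2:
  assumes "\<mu> \<in> P2" shows "forward \<tau> \<mu> \<in> P2"
  unfolding forward_def
  by (intro distr_in_P2 P2D(1)[OF assms] sq_integrable_add sq_integrable_scaleR sq_integrable_g P2D(3)[OF assms])

lemma forward_cost:
  assumes \<tau>: "0 < \<tau>" and M: "prob_space M" "sq_integrable M X" "sq_integrable M Y"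
  shows "(l2norm M (\<lambda>\<omega>. (X \<omega> + \<tau> *\<^sub>R g (X \<omega>)) - Y \<omega>))\<^sup>2
    = 2 * \<tau> * ((\<integral>\<omega>. step_cost \<tau> (X \<omega>) (Y \<omega>) \<partial>M) + \<tau> / 2 * (l2norm M (\<lambda>\<omega>. g (X \<omega>)))\<^sup>2)"
proof -
  have "(norm ((x + \<tau> *\<^sub>R g x) - y))\<^sup>2 = 2 * \<tau> * (step_cost \<tau> x y + \<tau> / 2 * (norm (g x))\<^sup>2)" for x y
  proof -
    have "(norm ((x + \<tau> *\<^sub>R g x) - y))\<^sup>2
        = (norm (x - y))\<^sup>2 - 2 * \<tau> * (g x \<bullet> (y - x)) + \<tau> * \<tau> * (norm (g x))\<^sup>2"
      by (simp add: power2_norm_eq_inner inner_simps inner_commute algebra_simps)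
    also have "\<dots> = 2 * \<tau> * (step_cost \<tau> x y + \<tau> / 2 * (norm (g x))\<^sup>2)"
      using \<tau> by (simp add: step_cost_def field_simps)
    finally show ?thesis .
  qed
  then show ?thesis
    using integrable_step_cost[OF M] sq_integrableD(2)[OF sq_integrable_g[OF M(1,2)]]
    by (simp add: l2norm_power2)
qed

lemma W2_near_optimal_power2:
  assumes "\<mu> \<in> P2" "\<nu> \<in> P2" "0 < e"
  obtains \<gamma> where "\<gamma> \<in> couplings \<mu> \<nu>" "(l2norm \<gamma> (\<lambda>z. fst z - snd z))\<^sup>2 \<le> (W2 \<mu> \<nu>)\<^sup>2 + e"
proof -
  define W where "W = W2 \<mu> \<nu>"
  have W: "0 \<le> W" by (simp add: W_def)
  define d where "d = min 1 (e / (2 * W + 1))"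
  have "d * (2 * W + 1) \<le> e / (2 * W + 1) * (2 * W + 1)"
    using W by (intro mult_right_mono) (simp_all add: d_def)
  then have d: "0 < d" "d \<le> 1" "d * (2 * W + 1) \<le> e"
    using assms(3) W by (simp_all add: d_def)
  obtain \<gamma> where \<gamma>: "\<gamma> \<in> couplings \<mu> \<nu>" "l2norm \<gamma> (\<lambda>z. fst z - snd z) < W + d"
    using W2_near_optimal[OF assms(1,2) d(1)] unfolding W_def by blast
  have "(l2norm \<gamma> (\<lambda>z. fst z - snd z))\<^sup>2 \<le> (W + d)\<^sup>2"
    using \<gamma>(2) by (intro power_mono) auto
  also have "\<dots> = W\<^sup>2 + d * (2 * W + d)" by (simp add: power2_eq_square algebra_simps)
  also have "d * (2 * W + d) \<le> d * (2 * W + 1)" using d by (intro mult_left_mono) auto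
  finally show thesis using that[OF \<gamma>(1)] d(3) by (simp add: W_def)
qed

text \<open>Minimality in the backward step, transferred to plans that start at \<open>\<mu>\<close>: a plan between
  \<open>forward \<tau> \<mu>\<close> and \<open>\<sigma>\<close>, optimal up to \<open>2 * \<tau> * e\<close>, is pulled back along the inverse of the forward
  map.\<close>

lemma near_minimal_exists:
  assumes \<tau>: "0 < \<tau>" and \<mu>: "\<mu> \<in> P2" and \<sigma>: "\<sigma> \<in> JKO \<tau> \<Phi> (forward \<tau> \<mu>)" and e: "0 < e"
  obtains \<gamma> where "near_minimal \<tau> e \<mu> \<sigma> \<gamma>"
proof -
  define \<nu> where "\<nu> = forward \<tau> \<mu>"
  have \<nu>: "\<nu> \<in> P2" unfolding \<nu>_def by (rule forward_in_P2[OF \<mu>])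
  have \<sigma>P: "\<sigma> \<in> P2" using \<sigma> by (simp add: JKO_def is_arg_min_def)
  have min: "\<Phi> \<sigma> + ereal (1 / (2 * \<tau>) * (W2 \<nu> \<sigma>)\<^sup>2) \<le> \<Phi> \<rho> + ereal (1 / (2 * \<tau>) * (W2 \<nu> \<rho>)\<^sup>2)"
    if "\<rho> \<in> P2" for \<rho>
    using \<sigma> that unfolding JKO_def is_arg_min_def \<nu>_def by (auto simp: not_less)
  obtain R where R [measurable]: "R \<in> borel_measurable borel" and RS: "\<And>x. R (x + \<tau> *\<^sub>R g x) = x"
    using forward_step_inverse[of \<tau>] \<tau> by auto
  define S where "S x = x + \<tau> *\<^sub>R g x" for x
  have [measurable]: "S \<in> borel_measurable borel" unfolding S_def by measurable
  have \<nu>S: "\<nu> = distr \<mu> borel S" by (simp add: \<nu>_def forward_def S_def[abs_def])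
  have S\<mu>: "S \<in> borel_measurable \<mu>" by (simp add: measurable_cong_sets[OF P2D(2)[OF \<mu>] refl])
  have "AE x in \<mu>. S (R (S x)) = S x" using RS by (simp add: S_def)
  then have SR: "AE x in \<nu>. S (R x) = x"
    unfolding \<nu>S using S\<mu> by (subst AE_distr_iff) auto
  define k where "k = \<tau> / 2 * (l2norm \<mu> g)\<^sup>2"
  have cost: "(l2norm \<gamma> (\<lambda>z. S (fst z) - snd z))\<^sup>2 / (2 * \<tau>) = plan_cost \<tau> \<gamma> + k"
    if "\<gamma> \<in> couplings \<mu> \<rho>" "\<rho> \<in> P2" for \<gamma> \<rho>
  proof -
    note c = couplingsD[OF that(1) \<mu> that(2)]
    have "l2norm \<gamma> (\<lambda>z. g (fst z)) = l2norm \<mu> g"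
      using l2norm_distr[OF c(6) measurable_g] c(4) by simp
    then show ?thesis
      unfolding S_def forward_cost[OF \<tau> c(1,8,9)] plan_cost_def k_def using \<tau> by simp
  qed
  obtain \<gamma>0 where \<gamma>0: "\<gamma>0 \<in> couplings \<nu> \<sigma>" "(l2norm \<gamma>0 (\<lambda>z. fst z - snd z))\<^sup>2 \<le> (W2 \<nu> \<sigma>)\<^sup>2 + 2 * \<tau> * e"
    using W2_near_optimal_power2[OF \<nu> \<sigma>P, of "2 * \<tau> * e"] e \<tau> by auto
  note c0 = couplingsD[OF \<gamma>0(1) \<nu> \<sigma>P]
  note [measurable] = c0(6,7)
  define \<gamma> where "\<gamma> = distr \<gamma>0 borel (\<lambda>z. (R (fst z), snd z))"
  have "distr \<gamma>0 borel (\<lambda>z. R (fst z)) = distr (distr \<gamma>0 borel fst) borel R"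
    by (subst distr_distr) (auto simp: comp_def)
  also have "\<dots> = distr \<mu> borel (\<lambda>x. R (S x))"
    unfolding c0(4) \<nu>S using S\<mu> by (subst distr_distr) (auto simp: comp_def)
  also have "\<dots> = \<mu>"
    using distr_id2[of borel \<mu>] P2D(2)[OF \<mu>] RS by (simp add: S_def)
  finally have "distr \<gamma>0 borel (\<lambda>z. R (fst z)) = \<mu>" .
  then have \<gamma>: "\<gamma> \<in> couplings \<mu> \<sigma>"
    using distr_pair_in_couplings[of "\<lambda>z. R (fst z)" \<gamma>0 snd] c0(5) by (simp add: \<gamma>_def)
  have "AE z in \<gamma>0. S (R (fst z)) = fst z"
    using SR unfolding c0(4)[symmetric] by (rule AE_distrD[OF c0(6)])
  then have "(l2norm \<gamma>0 (\<lambda>z. S (R (fst z)) - snd z))\<^sup>2 = (l2norm \<gamma>0 (\<lambda>z. fst z - snd z))\<^sup>2"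
    unfolding l2norm_power2 by (intro integral_cong_AE) auto
  moreover have "l2norm \<gamma> (\<lambda>z. S (fst z) - snd z) = l2norm \<gamma>0 (\<lambda>z. S (R (fst z)) - snd z)"
    unfolding \<gamma>_def by (subst l2norm_distr) (auto simp: borel_prod[symmetric])
  ultimately have "(l2norm \<gamma> (\<lambda>z. S (fst z) - snd z))\<^sup>2 \<le> (W2 \<nu> \<sigma>)\<^sup>2 + 2 * \<tau> * e"
    using \<gamma>0(2) by simp
  then have "(l2norm \<gamma> (\<lambda>z. S (fst z) - snd z))\<^sup>2 / (2 * \<tau>) \<le> ((W2 \<nu> \<sigma>)\<^sup>2 + 2 * \<tau> * e) / (2 * \<tau>)"
    using \<tau> by (intro divide_right_mono) auto
  also have "\<dots> = 1 / (2 * \<tau>) * (W2 \<nu> \<sigma>)\<^sup>2 + e" using \<tau> by (simp add: field_simps)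
  finally have up: "plan_cost \<tau> \<gamma> + k \<le> 1 / (2 * \<tau>) * (W2 \<nu> \<sigma>)\<^sup>2 + e"
    using cost[OF \<gamma> \<sigma>P] by simp
  have "\<Phi> \<sigma> + ereal (plan_cost \<tau> \<gamma>) \<le> \<Phi> \<rho> + ereal (plan_cost \<tau> \<gamma>' + e)"
    if \<rho>: "\<rho> \<in> P2" and \<gamma>': "\<gamma>' \<in> couplings \<mu> \<rho>" for \<rho> \<gamma>'
  proof -
    note c = couplingsD[OF \<gamma>' \<mu> \<rho>]
    have S\<gamma>: "sq_integrable \<gamma>' (\<lambda>z. S (fst z))"
      unfolding S_def by (intro sq_integrable_add sq_integrable_scaleR sq_integrable_g c)
    have "distr \<gamma>' borel (\<lambda>z. S (fst z)) = distr (distr \<gamma>' borel fst) borel S"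
      using c(6) by (subst distr_distr) (auto simp: comp_def)
    then have "W2 \<nu> \<rho> \<le> l2norm \<gamma>' (\<lambda>z. S (fst z) - snd z)"
      using W2_le_random_variables[OF c(1) S\<gamma> c(9)] c(4,5) by (simp add: \<nu>S)
    then have "(W2 \<nu> \<rho>)\<^sup>2 \<le> (l2norm \<gamma>' (\<lambda>z. S (fst z) - snd z))\<^sup>2"
      by (intro power_mono) simp_all
    then have "1 / (2 * \<tau>) * (W2 \<nu> \<rho>)\<^sup>2 \<le> (l2norm \<gamma>' (\<lambda>z. S (fst z) - snd z))\<^sup>2 / (2 * \<tau>)"
      using \<tau> by (simp add: divide_right_mono)
    then have lo: "1 / (2 * \<tau>) * (W2 \<nu> \<rho>)\<^sup>2 \<le> plan_cost \<tau> \<gamma>' + k"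
      using cost[OF \<gamma>' \<rho>] by simp
    show ?thesis
    proof (cases "\<Phi> \<rho>")
      case (real q)
      then obtain p where p: "\<Phi> \<sigma> = ereal p"
        using min[OF \<rho>] Phi_not_MInfty[OF \<sigma>P] by (cases "\<Phi> \<sigma>") auto
      show ?thesis using min[OF \<rho>] up lo by (simp add: real p)
    qed (use Phi_not_MInfty[OF \<rho>] in auto)
  qed
  then show thesis using that \<gamma> unfolding near_minimal_def by blast
qed

text \<open>The expansion of the step cost around \<open>y\<close>: the residual is its linear coefficient once the
  decrease of \<open>H\<close> is included.\<close>

lemma residual_identity:
  assumes "0 < \<tau>"
  shows "step_cost \<tau> w y - step_cost \<tau> w z - (H z - H y)
    = residual \<tau> (w, y) \<bullet> (z - y) - (norm (z - y))\<^sup>2 / (2 * \<tau>) - bregman H g z y"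
proof -
  have "(norm (w - z))\<^sup>2 = (norm (w - y))\<^sup>2 - 2 * ((w - y) \<bullet> (z - y)) + (norm (z - y))\<^sup>2"
    by (simp add: power2_norm_eq_inner inner_simps inner_commute algebra_simps)
  then have "(norm (w - y))\<^sup>2 / (2 * \<tau>) - (norm (w - z))\<^sup>2 / (2 * \<tau>)
      = (1 / \<tau>) * ((w - y) \<bullet> (z - y)) - (norm (z - y))\<^sup>2 / (2 * \<tau>)"
    using assms by (simp add: field_simps)
  then show ?thesis
    by (simp add: step_cost_def residual_def bregman_def inner_add_left inner_diff_left inner_diff_right
        diff_divide_distrib)
qed

text \<open>The cell averages of the residual of an almost minimal plan are approximate subgradients.
  Gluing with a plan from \<open>\<sigma>\<close> to \<open>\<nu>\<close> yields a competitor plan from \<open>\<mu>\<close> to \<open>\<nu>\<close>; the linear part of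
  the expansion of its cost is the pairing with the residual.\<close>

lemma approximate_subgradient:
  assumes \<tau>: "0 < \<tau>" and \<mu>: "\<mu> \<in> P2" and \<sigma>: "\<sigma> \<in> P2" and p: "\<Phi> \<sigma> = ereal p"
    and \<gamma>: "near_minimal \<tau> e \<mu> \<sigma> \<gamma>" and e': "0 < e'"
  obtains \<xi> where "sq_integrable \<sigma> \<xi>" "l2norm \<sigma> \<xi> \<le> l2norm \<gamma> (residual \<tau>)"
    "\<And>\<nu> \<gamma>'. \<nu> \<in> P2 \<Longrightarrow> \<gamma>' \<in> optimal_plans \<sigma> \<nu> \<Longrightarrow>
      ereal (p - potential_energy H \<sigma> + displacement_pairing \<gamma>' \<xi> - (1 / \<tau> + L) * (W2 \<sigma> \<nu>)\<^sup>2 - (e + e')) \<le> F \<nu>"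
proof -
  have \<gamma>c: "\<gamma> \<in> couplings \<mu> \<sigma>" using \<gamma> by (simp add: near_minimal_def)
  note c1 = couplingsD[OF \<gamma>c \<mu> \<sigma>]
  have res: "sq_integrable \<gamma> (residual \<tau>)" by (rule sq_integrable_residual[OF c1(1,8,9)])
  define K where "K = 1 / (2 * \<tau>) + L / 2"
  have K: "0 < K" using \<tau> L_nonneg by (simp add: K_def add_pos_nonneg)
  define N where "N = (\<integral>z. norm (residual \<tau> z) \<partial>\<gamma>)"
  have N: "0 \<le> N" by (simp add: N_def)
  define \<delta> where "\<delta> = min 1 (e' / (N + 2 * K))"
  have \<delta>: "0 < \<delta>" "\<delta> \<le> 1" "\<delta> * N + K * (2 * \<delta>) \<le> e'"
  proof -
    have pos: "0 < N + 2 * K" using N K by linarith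
    then show "0 < \<delta>" "\<delta> \<le> 1" using e' by (simp_all add: \<delta>_def)
    have "\<delta> * (N + 2 * K) \<le> e' / (N + 2 * K) * (N + 2 * K)"
      using pos by (intro mult_right_mono) (simp_all add: \<delta>_def)
    also have "\<dots> = e'" using pos by simp
    finally show "\<delta> * N + K * (2 * \<delta>) \<le> e'" by (simp add: algebra_simps)
  qed
  obtain idx :: "'a \<Rightarrow> nat" where idx: "idx \<in> measurable borel (count_space UNIV)"
    and cells: "\<And>x y. idx x = idx y \<Longrightarrow> dist x y \<le> \<delta>"
    using countable_cells[OF \<delta>(1)] by blast
  define \<xi> where "\<xi> = gluing.cell_average \<gamma> snd \<sigma> idx (residual \<tau>)"
  interpret self: gluing \<gamma> snd \<gamma> snd \<sigma> idx
    by (rule gluing.intro[OF c1(1) c1(1) c1(7) c1(7) c1(5) c1(5) idx])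
  have \<xi>: "sq_integrable \<sigma> \<xi>" "l2norm \<sigma> \<xi> \<le> l2norm \<gamma> (residual \<tau>)"
    unfolding \<xi>_def by (rule self.sq_integrable_cell_average[OF res])+
  have main: "ereal (p - potential_energy H \<sigma> + displacement_pairing \<gamma>' \<xi> - (1 / \<tau> + L) * (W2 \<sigma> \<nu>)\<^sup>2 - (e + e')) \<le> F \<nu>"
    if \<nu>: "\<nu> \<in> P2" and \<gamma>'o: "\<gamma>' \<in> optimal_plans \<sigma> \<nu>" for \<nu> \<gamma>'
  proof (cases "\<Phi> \<nu>")
    case PInf then show ?thesis by (simp add: F_def)
  next
    case MInf then show ?thesis using Phi_not_MInfty[OF \<nu>] by simp
  next
    case (real q)
    have \<gamma>': "\<gamma>' \<in> couplings \<sigma> \<nu>" using \<gamma>'o by (simp add: optimal_plans_def)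
    note c2 = couplingsD[OF \<gamma>' \<sigma> \<nu>]
    interpret gluing \<gamma> snd \<gamma>' fst \<sigma> idx
      by (rule gluing.intro[OF c1(1) c2(1) c1(7) c2(6) c1(5) c2(4) idx])
    interpret glued: prob_space glued by (rule prob_glued)
    define w y y' z where "w = (\<lambda>p :: ('a \<times> 'a) \<times> ('a \<times> 'a). fst (fst p))"
      and "y = (\<lambda>p :: ('a \<times> 'a) \<times> ('a \<times> 'a). snd (fst p))"
      and "y' = (\<lambda>p :: ('a \<times> 'a) \<times> ('a \<times> 'a). fst (snd p))"
      and "z = (\<lambda>p :: ('a \<times> 'a) \<times> ('a \<times> 'a). snd (snd p))"
    have sq: "sq_integrable glued w" "sq_integrable glued y" "sq_integrable glued y'" "sq_integrable glued z"
      unfolding w_def y_def y'_def z_def using c1(6-9) c2(6-9) by (simp_all add: glued_fst glued_snd)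
    note [measurable] = sq[THEN sq_integrableD(1)]
    have d1: "distr glued borel (\<lambda>p. f (fst p)) = distr \<gamma> borel f" if "f \<in> borel_measurable \<gamma>" for f :: "_ \<Rightarrow> 'a"
    proof -
      have "distr glued borel (\<lambda>p. f (fst p)) = distr (distr glued \<gamma> fst) borel f"
        using that by (subst distr_distr) (auto simp: comp_def)
      then show ?thesis by (simp add: distr_glued_fst)
    qed
    have d2: "distr glued borel (\<lambda>p. f (snd p)) = distr \<gamma>' borel f" if "f \<in> borel_measurable \<gamma>'" for f :: "_ \<Rightarrow> 'a"
    proof -
      have "distr glued borel (\<lambda>p. f (snd p)) = distr (distr glued \<gamma>' snd) borel f"
        using that by (subst distr_distr) (auto simp: comp_def)
      then show ?thesis by (simp add: distr_glued_snd)
    qed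
    have law: "distr glued borel w = \<mu>" "distr glued borel y = \<sigma>" "distr glued borel z = \<nu>"
      unfolding w_def y_def z_def using d1[OF c1(6)] d1[OF c1(7)] d2[OF c2(7)] c1(4,5) c2(5) by simp_all
    have "distr glued borel (\<lambda>p. (w p, z p)) \<in> couplings \<mu> \<nu>"
      using distr_pair_in_couplings[of w glued z] by (simp add: law)
    then have "\<Phi> \<sigma> + ereal (plan_cost \<tau> \<gamma>)
        \<le> \<Phi> \<nu> + ereal (plan_cost \<tau> (distr glued borel (\<lambda>p. (w p, z p))) + e)"
      using \<gamma> \<nu> unfolding near_minimal_def by blast
    moreover have "plan_cost \<tau> \<gamma> = (\<integral>p. step_cost \<tau> (w p) (y p) \<partial>glued)"
    proof -
      have "(\<lambda>z. step_cost \<tau> (fst z) (snd z)) \<in> borel_measurable \<gamma>"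
        using step_cost_measurable by (simp add: measurable_cong_sets[OF c1(2) refl])
      then have "(\<integral>x. step_cost \<tau> (fst x) (snd x) \<partial>distr glued \<gamma> fst) = (\<integral>p. step_cost \<tau> (w p) (y p) \<partial>glued)"
        unfolding w_def y_def by (subst integral_distr) auto
      then show ?thesis by (simp add: plan_cost_def distr_glued_fst)
    qed
    ultimately have min: "p + (\<integral>p. step_cost \<tau> (w p) (y p) \<partial>glued) \<le> q + (\<integral>p. step_cost \<tau> (w p) (z p) \<partial>glued) + e"
      by (simp add: p real plan_cost_distr)
    have EH: "potential_energy H \<sigma> = (\<integral>p. H (y p) \<partial>glued)" "potential_energy H \<nu> = (\<integral>p. H (z p) \<partial>glued)"
      using potential_energy_distr[of y glued H] potential_energy_distr[of z glued H] law by simp_all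
    define \<zeta> where "\<zeta> p = residual \<tau> (fst p)" for p :: "('a \<times> 'a) \<times> ('a \<times> 'a)"
    have \<zeta>: "sq_integrable glued \<zeta>"
      unfolding \<zeta>_def using glued_fst(1)[OF sq_integrableD(1)[OF res]] res by simp
    have int: "integrable glued (\<lambda>p. step_cost \<tau> (w p) (y p))" "integrable glued (\<lambda>p. step_cost \<tau> (w p) (z p))"
      "integrable glued (\<lambda>p. H (y p))" "integrable glued (\<lambda>p. H (z p))"
      "integrable glued (\<lambda>p. \<zeta> p \<bullet> (z p - y' p))" "integrable glued (\<lambda>p. norm (\<zeta> p))"
      "integrable glued (\<lambda>p. (norm (z p - y' p))\<^sup>2)"
      by (intro integrable_step_cost integrable_H integrable_inner_sq glued.integrable_norm_sq
          sq_integrableD(2)[OF sq_integrable_diff] sq_integrable_diff sq \<zeta> prob_glued)+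
    have "(\<integral>p. \<zeta> p \<bullet> (z p - y' p) - \<delta> * norm (\<zeta> p) - K * (2 * (norm (z p - y' p))\<^sup>2 + 2 * \<delta>) \<partial>glued)
        \<le> (\<integral>p. step_cost \<tau> (w p) (y p) - step_cost \<tau> (w p) (z p) - (H (z p) - H (y p)) \<partial>glued)"
    proof (rule integral_mono_AE)
      show "AE p in glued. \<zeta> p \<bullet> (z p - y' p) - \<delta> * norm (\<zeta> p) - K * (2 * (norm (z p - y' p))\<^sup>2 + 2 * \<delta>)
          \<le> step_cost \<tau> (w p) (y p) - step_cost \<tau> (w p) (z p) - (H (z p) - H (y p))"
        using AE_glued_same_cell
      proof eventually_elim
        case (elim p)
        \<comment> \<open>Replacing the base point \<open>y\<close> by its copy \<open>y'\<close> in the same cell costs at most terms of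
          order \<open>\<delta>\<close> and a factor \<open>2\<close> in the quadratic remainder.\<close>
        have near: "norm (y' p - y p) \<le> \<delta>"
          using cells[OF elim] by (simp add: y_def y'_def dist_norm norm_minus_commute)
        have split: "z p - y p = (z p - y' p) + (y' p - y p)" by simp
        have "\<bar>\<zeta> p \<bullet> (y' p - y p)\<bar> \<le> norm (\<zeta> p) * norm (y' p - y p)"
          by (rule Cauchy_Schwarz_ineq2)
        also have "\<dots> \<le> \<delta> * norm (\<zeta> p)"
          using mult_left_mono[OF near, of "norm (\<zeta> p)"] by (simp add: mult.commute)
        finally have 1: "\<zeta> p \<bullet> (z p - y' p) - \<delta> * norm (\<zeta> p) \<le> \<zeta> p \<bullet> (z p - y p)"
          unfolding split inner_add_right by linarith
        have "(norm (z p - y p))\<^sup>2 \<le> 2 * (norm (z p - y' p))\<^sup>2 + 2 * (norm (y' p - y p))\<^sup>2"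
          unfolding split by (rule norm_add_sq_le)
        also have "(norm (y' p - y p))\<^sup>2 \<le> \<delta>\<^sup>2" using near by (intro power_mono) auto
        also have "\<delta>\<^sup>2 \<le> \<delta>" using \<delta>(1,2) by (simp add: power2_eq_square mult_left_le)
        finally have 2: "K * (norm (z p - y p))\<^sup>2 \<le> K * (2 * (norm (z p - y' p))\<^sup>2 + 2 * \<delta>)"
          using K by simp
        have "\<zeta> p = residual \<tau> (w p, y p)" by (simp add: \<zeta>_def w_def y_def)
        then have "step_cost \<tau> (w p) (y p) - step_cost \<tau> (w p) (z p) - (H (z p) - H (y p))
            = \<zeta> p \<bullet> (z p - y p) - (norm (z p - y p))\<^sup>2 / (2 * \<tau>) - bregman H g (z p) (y p)"
          using residual_identity[OF \<tau>, of "w p" "y p" "z p"] by simp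
        also have "\<dots> \<ge> \<zeta> p \<bullet> (z p - y p) - (norm (z p - y p))\<^sup>2 / (2 * \<tau>) - L / 2 * (norm (z p - y p))\<^sup>2"
          using bregman_le[of "z p" "y p"] by simp
        also have "(norm (z p - y p))\<^sup>2 / (2 * \<tau>) = 1 / (2 * \<tau>) * (norm (z p - y p))\<^sup>2" by simp
        finally have "\<zeta> p \<bullet> (z p - y p) - K * (norm (z p - y p))\<^sup>2
            \<le> step_cost \<tau> (w p) (y p) - step_cost \<tau> (w p) (z p) - (H (z p) - H (y p))"
          by (simp add: K_def algebra_simps)
        then show ?case using 1 2 by linarith
      qed
    qed (intro Bochner_Integration.integrable_diff Bochner_Integration.integrable_add
        integrable_mult_right int glued.integrable_const)+
    moreover have "(\<integral>p. \<zeta> p \<bullet> (z p - y' p) - \<delta> * norm (\<zeta> p) - K * (2 * (norm (z p - y' p))\<^sup>2 + 2 * \<delta>) \<partial>glued)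
        = displacement_pairing \<gamma>' \<xi> - \<delta> * N - ((1 / \<tau> + L) * (W2 \<sigma> \<nu>)\<^sup>2 + K * (2 * \<delta>))"
    proof -
      have 1: "(\<integral>p. \<zeta> p \<bullet> (z p - y' p) \<partial>glued) = displacement_pairing \<gamma>' \<xi>"
        using integral_inner_glued[OF res sq_integrable_diff[OF c2(9,8)]]
        by (simp add: \<zeta>_def z_def y'_def displacement_pairing_def \<xi>_def)
      have "(\<integral>x. norm (residual \<tau> x) \<partial>distr glued \<gamma> fst) = (\<integral>p. norm (\<zeta> p) \<partial>glued)"
        unfolding \<zeta>_def using sq_integrableD(1)[OF res] by (subst integral_distr) auto
      then have 2: "(\<integral>p. norm (\<zeta> p) \<partial>glued) = N" by (simp add: N_def distr_glued_fst)
      have "l2norm glued (\<lambda>p. z p - y' p) = l2norm \<gamma>' (\<lambda>x. snd x - fst x)"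
        unfolding z_def y'_def by (rule glued_snd(2)) (intro borel_measurable_diff c2)
      also have "\<dots> = W2 \<sigma> \<nu>"
        using optimal_plan_cost[OF \<gamma>'o \<sigma> \<nu>] by (simp add: l2norm_def norm_minus_commute)
      finally have 3: "(\<integral>p. (norm (z p - y' p))\<^sup>2 \<partial>glued) = (W2 \<sigma> \<nu>)\<^sup>2"
        by (simp add: l2norm_power2[symmetric])
      have "(\<integral>p. \<zeta> p \<bullet> (z p - y' p) - \<delta> * norm (\<zeta> p) - K * (2 * (norm (z p - y' p))\<^sup>2 + 2 * \<delta>) \<partial>glued)
          = (\<integral>p. \<zeta> p \<bullet> (z p - y' p) \<partial>glued) - \<delta> * (\<integral>p. norm (\<zeta> p) \<partial>glued)
            - K * (2 * (\<integral>p. (norm (z p - y' p))\<^sup>2 \<partial>glued) + 2 * \<delta>)"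
        using int glued.prob_space by simp
      also have "\<dots> = displacement_pairing \<gamma>' \<xi> - \<delta> * N - K * (2 * (W2 \<sigma> \<nu>)\<^sup>2 + 2 * \<delta>)"
        unfolding 1 2 3 ..
      also have "K * (2 * (W2 \<sigma> \<nu>)\<^sup>2 + 2 * \<delta>) = (1 / \<tau> + L) * (W2 \<sigma> \<nu>)\<^sup>2 + K * (2 * \<delta>)"
        by (simp add: K_def algebra_simps)
      finally show ?thesis .
    qed
    moreover have "(\<integral>p. step_cost \<tau> (w p) (y p) - step_cost \<tau> (w p) (z p) - (H (z p) - H (y p)) \<partial>glued)
        = (\<integral>p. step_cost \<tau> (w p) (y p) \<partial>glued) - (\<integral>p. step_cost \<tau> (w p) (z p) \<partial>glued)
          - (potential_energy H \<nu> - potential_energy H \<sigma>)"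
      using int by (simp add: EH)
    ultimately have "p - potential_energy H \<sigma> + displacement_pairing \<gamma>' \<xi> - (1 / \<tau> + L) * (W2 \<sigma> \<nu>)\<^sup>2 - (e + e')
        \<le> q - potential_energy H \<nu>"
      using min \<delta>(3) by linarith
    then show ?thesis by (simp add: F_def real)
  qed
  show thesis by (rule that[OF \<xi> main])
qed

end

text \<open>The real inequality behind the constant for the exponent \<open>1/2\<close>.  There \<open>P\<close> is the sum
  of the transport cost and the Bregman divergence of the full step, \<open>Y\<close> the part gained between the step sizes \<open>\<eta> / 2\<close> and \<open>\<eta>\<close>, \<open>a\<close> the gap,
  \<open>l = \<eta> * L\<close> and \<open>s = \<eta> * c\<^sup>2\<close>.  The hypotheses give \<open>s * a \<le> 2 * (2 + l)\<^sup>2 * Y\<close>; adding the bound on \<open>P\<close>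
  leaves an inequality between polynomials in \<open>l\<close>, and the difference of its two sides is twice
  \<open>(l + 1) * (2 * l - 1)\<^sup>2 + l\<^sup>2 + l ^ 4\<close>.\<close>

lemma dissipation_inequality:
  fixes l s a P Y :: real
  assumes l: "0 \<le> l" and s: "0 < s" and a: "0 \<le> a"
    and P: "s * a \<le> 2 * (1 + l) * P"
    and Y: "s * a + s * P \<le> (2 * (2 + l)\<^sup>2 + s * (1 + l)) * Y"
  shows "s * a \<le> 2 * (1 + l\<^sup>2) * (P + Y)"
proof -
  define v where "v = 2 * (2 + l)\<^sup>2"
  have v: "0 < v" "2 * (1 + l) * (1 + l) \<le> v"
    using l by (simp_all add: v_def power2_eq_square algebra_simps add_pos_nonneg)
  have Y': "s * a \<le> v * Y"
  proof -
    have "s * a * (1 + l) \<le> v * P"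
    proof -
      have "s * a * (1 + l) \<le> (2 * (1 + l) * P) * (1 + l)" using P l by (intro mult_right_mono) auto
      also have "\<dots> = (2 * (1 + l) * (1 + l)) * P" by (simp add: algebra_simps)
      also have "\<dots> \<le> v * P"
      proof (rule mult_right_mono[OF v(2)])
        have "0 \<le> 2 * (1 + l) * P" using P s a by (meson mult_nonneg_nonneg less_imp_le order_trans)
        then show "0 \<le> P" using l by (simp add: zero_le_mult_iff)
      qed
      finally show ?thesis .
    qed
    then have "s * (s * a * (1 + l)) \<le> s * (v * P)" using s by (intro mult_left_mono) auto
    then have "(v + s * (1 + l)) * (s * a) \<le> v * (s * a + s * P)" by (simp add: algebra_simps)
    also have "\<dots> \<le> v * ((v + s * (1 + l)) * Y)"
      using Y v(1) unfolding v_def by (intro mult_left_mono) auto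
    finally have "(v + s * (1 + l)) * (s * a) \<le> (v + s * (1 + l)) * (v * Y)" by (simp add: algebra_simps)
    moreover have "0 < v + s * (1 + l)" using v(1) s l by (simp add: add_pos_nonneg)
    ultimately show ?thesis by simp
  qed
  have poly: "(1 + l) * v \<le> (1 + l\<^sup>2) * (v + 2 * (1 + l))"
  proof -
    have eq: "(1 + l\<^sup>2) * (v + 2 * (1 + l)) - (1 + l) * v = 2 * ((l + 1) * (2 * l - 1)\<^sup>2 + l\<^sup>2 + l ^ 4)"
      by (simp add: v_def power2_eq_square power4_eq_xxxx algebra_simps)
    have "0 \<le> (1 + l\<^sup>2) * (v + 2 * (1 + l)) - (1 + l) * v"
      unfolding eq using l by simp
    then show ?thesis by (simp only: diff_ge_0_iff_ge)
  qed
  have "(1 + l) * v * (s * a) \<le> (1 + l\<^sup>2) * (v + 2 * (1 + l)) * (s * a)"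
    using poly s a by (intro mult_right_mono) auto
  also have "\<dots> = (1 + l\<^sup>2) * (v * (s * a) + 2 * (1 + l) * (s * a))" by (simp add: algebra_simps)
  also have "\<dots> \<le> (1 + l\<^sup>2) * (v * (2 * (1 + l) * P) + 2 * (1 + l) * (v * Y))"
    using P Y' v(1) l by (intro mult_left_mono add_mono) auto
  also have "\<dots> = (1 + l) * v * (2 * (1 + l\<^sup>2) * (P + Y))" by (simp add: algebra_simps)
  finally show ?thesis
    using v(1) l by (simp add: mult_le_cancel_left_pos add_pos_nonneg)
qed

lemma le_of_forall_le_add_mult:
  fixes x y k :: real
  assumes "\<And>e. 0 < e \<Longrightarrow> x \<le> y + k * e"
  shows "x \<le> y"
proof (rule field_le_epsilon)
  fix e :: real assume e: "0 < e"
  have "k * (e / (\<bar>k\<bar> + 1)) \<le> \<bar>k\<bar> * (e / (\<bar>k\<bar> + 1))" using e by (intro mult_right_mono) auto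
  also have "\<dots> \<le> e" using e by (simp add: field_simps)
  finally show "x \<le> y + e" using assms[of "e / (\<bar>k\<bar> + 1)"] e by (simp add: add_pos_nonneg)
qed

context forward_backward
begin

definition plan_bregman :: "('a \<times> 'a) measure \<Rightarrow> real" where
  "plan_bregman \<gamma> = (\<integral>z. bregman H g (snd z) (fst z) \<partial>\<gamma>)"

definition sq_cost :: "('a \<times> 'a) measure \<Rightarrow> real" where
  "sq_cost \<gamma> = (l2norm \<gamma> (\<lambda>z. fst z - snd z))\<^sup>2"

lemma sq_cost_nonneg [simp]: "0 \<le> sq_cost \<gamma>"
  by (simp add: sq_cost_def)

lemma plan_integrable:
  assumes "\<gamma> \<in> couplings \<mu> \<sigma>" "\<mu> \<in> P2" "\<sigma> \<in> P2"
  shows "integrable \<gamma> (\<lambda>z. (norm (fst z - snd z))\<^sup>2)" "integrable \<gamma> (\<lambda>z. bregman H g (snd z) (fst z))"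
    "integrable \<gamma> (\<lambda>z. H (fst z))" "integrable \<gamma> (\<lambda>z. H (snd z))"
    "integrable \<gamma> (\<lambda>z. g (fst z) \<bullet> (snd z - fst z))" "sq_integrable \<gamma> (residual \<tau>)"
proof -
  note c = couplingsD[OF assms]
  show "integrable \<gamma> (\<lambda>z. (norm (fst z - snd z))\<^sup>2)"
    by (intro sq_integrableD(2) sq_integrable_diff c)
  show H: "integrable \<gamma> (\<lambda>z. H (fst z))" "integrable \<gamma> (\<lambda>z. H (snd z))"
    by (intro integrable_H c)+
  show i: "integrable \<gamma> (\<lambda>z. g (fst z) \<bullet> (snd z - fst z))"
    by (intro integrable_inner_sq sq_integrable_diff sq_integrable_g c)
  show "integrable \<gamma> (\<lambda>z. bregman H g (snd z) (fst z))"
    unfolding bregman_def by (intro Bochner_Integration.integrable_diff H i)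
  show "sq_integrable \<gamma> (residual \<tau>)" by (rule sq_integrable_residual[OF c(1,8,9)])
qed

lemma plan_cost_eq:
  assumes "\<gamma> \<in> couplings \<mu> \<sigma>" "\<mu> \<in> P2" "\<sigma> \<in> P2"
  shows "plan_cost \<tau> \<gamma> = sq_cost \<gamma> / (2 * \<tau>) + plan_bregman \<gamma> - (potential_energy H \<sigma> - potential_energy H \<mu>)"
proof -
  note i = plan_integrable[OF assms]
  have "plan_cost \<tau> \<gamma> = (\<integral>z. (norm (fst z - snd z))\<^sup>2 / (2 * \<tau>) + bregman H g (snd z) (fst z) - (H (snd z) - H (fst z)) \<partial>\<gamma>)"
    unfolding plan_cost_def step_cost_def bregman_def by (intro Bochner_Integration.integral_cong) auto
  also have "\<dots> = (\<integral>z. (norm (fst z - snd z))\<^sup>2 \<partial>\<gamma>) / (2 * \<tau>) + plan_bregman \<gamma>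
      - ((\<integral>z. H (snd z) \<partial>\<gamma>) - (\<integral>z. H (fst z) \<partial>\<gamma>))"
    using i by (simp add: plan_bregman_def)
  finally show ?thesis
    using potential_energy_coupling[OF assms measurable_H] by (simp add: sq_cost_def l2norm_power2)
qed

lemma plan_bregman_bounds:
  assumes "\<gamma> \<in> couplings \<mu> \<sigma>" "\<mu> \<in> P2" "\<sigma> \<in> P2"
  shows "0 \<le> plan_bregman \<gamma>" "plan_bregman \<gamma> \<le> L / 2 * sq_cost \<gamma>"
proof -
  note i = plan_integrable[OF assms]
  show "0 \<le> plan_bregman \<gamma>" unfolding plan_bregman_def by (intro integral_nonneg_AE) (simp add: bregman_nonneg)
  have "plan_bregman \<gamma> \<le> (\<integral>z. L / 2 * (norm (fst z - snd z))\<^sup>2 \<partial>\<gamma>)"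
    unfolding plan_bregman_def
  proof (rule integral_mono[OF i(2)])
    show "bregman H g (snd z) (fst z) \<le> L / 2 * (norm (fst z - snd z))\<^sup>2" for z
      using bregman_le[of "snd z" "fst z"] by (simp add: norm_minus_commute)
  qed (intro integrable_mult_right i)
  then show "plan_bregman \<gamma> \<le> L / 2 * sq_cost \<gamma>" by (simp add: sq_cost_def l2norm_power2)
qed

text \<open>Co-coercivity makes the Bregman part of the dissipation control the gradient part of the
  residual.\<close>

lemma residual_le_dissipation:
  assumes "\<gamma> \<in> couplings \<mu> \<sigma>" "\<mu> \<in> P2" "\<sigma> \<in> P2" and \<tau>: "0 < \<tau>"
  shows "(l2norm \<gamma> (residual \<tau>))\<^sup>2 \<le> (2 / \<tau>) * (1 + \<tau> * L) * (sq_cost \<gamma> / (2 * \<tau>) + plan_bregman \<gamma>)"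
    and "(l2norm \<gamma> (residual \<tau>))\<^sup>2 \<le> (1 / \<tau> + L)\<^sup>2 * sq_cost \<gamma>"
proof -
  note i = plan_integrable[OF assms(1-3)]
  have tri: "norm (residual \<tau> (w, y)) \<le> (1 / \<tau>) * norm (w - y) + norm (g w - g y)" for w y
    using norm_triangle_ineq[of "(1 / \<tau>) *\<^sub>R (w - y)" "g w - g y"] \<tau> by (simp add: residual_def)
  have "(norm (residual \<tau> (w, y)))\<^sup>2 \<le> (2 / \<tau>) * (1 + \<tau> * L) * ((norm (w - y))\<^sup>2 / (2 * \<tau>) + bregman H g y w)" for w y
  proof -
    define a b B where "a = norm (w - y)" and "b = norm (g w - g y)" and "B = bregman H g y w"
    have ab: "0 \<le> a" "0 \<le> b" by (simp_all add: a_def b_def)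
    have b2: "b\<^sup>2 \<le> 2 * L * B"
      using bregman_ge[of y w] by (simp add: b_def B_def norm_minus_commute)
    have cross: "2 * a * b \<le> L * a\<^sup>2 + 2 * B"
    proof (cases "L = 0")
      case True
      then have "b = 0" using b2 by simp
      then show ?thesis using bregman_nonneg[of y w] by (simp add: True B_def)
    next
      case False
      then have L: "0 < L" using L_nonneg by simp
      have "L * (2 * a * b) = 2 * (L * a) * b" by simp
      also have "\<dots> \<le> (L * a)\<^sup>2 + b\<^sup>2" by (rule sum_squares_bound)
      also have "\<dots> \<le> L * (L * a\<^sup>2 + 2 * B)" using b2 by (simp add: power2_eq_square algebra_simps)
      finally show ?thesis using L by (simp only: mult_le_cancel_left_pos)
    qed
    have "(norm (residual \<tau> (w, y)))\<^sup>2 \<le> ((1 / \<tau>) * a + b)\<^sup>2"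
      using tri[of w y] unfolding a_def b_def by (rule power_mono) simp
    also have "\<dots> = a\<^sup>2 / \<tau>\<^sup>2 + (1 / \<tau>) * (2 * a * b) + b\<^sup>2"
      by (simp add: power2_eq_square algebra_simps)
    also have "\<dots> \<le> a\<^sup>2 / \<tau>\<^sup>2 + (1 / \<tau>) * (L * a\<^sup>2 + 2 * B) + 2 * L * B"
      using b2 cross \<tau> by (intro add_mono mult_left_mono) auto
    also have "\<dots> = (2 / \<tau>) * (1 + \<tau> * L) * (a\<^sup>2 / (2 * \<tau>) + B)"
      using \<tau> by (simp add: field_simps power2_eq_square)
    finally show ?thesis by (simp add: a_def B_def)
  qed
  then have "(norm (residual \<tau> z))\<^sup>2 \<le> (2 / \<tau>) * (1 + \<tau> * L) * ((norm (fst z - snd z))\<^sup>2 / (2 * \<tau>) + bregman H g (snd z) (fst z))" for z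
    by (metis prod.collapse)
  then have "(\<integral>z. (norm (residual \<tau> z))\<^sup>2 \<partial>\<gamma>)
      \<le> (\<integral>z. (2 / \<tau>) * (1 + \<tau> * L) * ((norm (fst z - snd z))\<^sup>2 / (2 * \<tau>) + bregman H g (snd z) (fst z)) \<partial>\<gamma>)"
    using i sq_integrableD(2)[OF i(6)] by (intro integral_mono) auto
  also have "\<dots> = (2 / \<tau>) * (1 + \<tau> * L) * (sq_cost \<gamma> / (2 * \<tau>) + plan_bregman \<gamma>)"
    using i by (simp add: sq_cost_def l2norm_power2 plan_bregman_def)
  finally show "(l2norm \<gamma> (residual \<tau>))\<^sup>2 \<le> (2 / \<tau>) * (1 + \<tau> * L) * (sq_cost \<gamma> / (2 * \<tau>) + plan_bregman \<gamma>)"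
    by (simp add: l2norm_power2)
  have "(norm (residual \<tau> (w, y)))\<^sup>2 \<le> (1 / \<tau> + L)\<^sup>2 * (norm (w - y))\<^sup>2" for w y
  proof -
    have "norm (residual \<tau> (w, y)) \<le> (1 / \<tau> + L) * norm (w - y)"
      using tri[of w y] lipschitz[of w y] by (simp add: distrib_right)
    then have "(norm (residual \<tau> (w, y)))\<^sup>2 \<le> ((1 / \<tau> + L) * norm (w - y))\<^sup>2" by (rule power_mono) simp
    then show ?thesis by (simp add: power_mult_distrib)
  qed
  then have "(norm (residual \<tau> z))\<^sup>2 \<le> (1 / \<tau> + L)\<^sup>2 * (norm (fst z - snd z))\<^sup>2" for z
    by (metis prod.collapse)
  then have "(\<integral>z. (norm (residual \<tau> z))\<^sup>2 \<partial>\<gamma>) \<le> (\<integral>z. (1 / \<tau> + L)\<^sup>2 * (norm (fst z - snd z))\<^sup>2 \<partial>\<gamma>)"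
    using i sq_integrableD(2)[OF i(6)] by (intro integral_mono) auto
  then show "(l2norm \<gamma> (residual \<tau>))\<^sup>2 \<le> (1 / \<tau> + L)\<^sup>2 * sq_cost \<gamma>"
    by (simp add: sq_cost_def l2norm_power2)
qed

lemma near_minimalD:
  assumes "near_minimal \<tau> e \<mu> \<sigma> \<gamma>" "\<rho> \<in> P2" "\<gamma>' \<in> couplings \<mu> \<rho>" "\<Phi> \<sigma> = ereal p" "\<Phi> \<rho> = ereal q"
  shows "p + plan_cost \<tau> \<gamma> \<le> q + plan_cost \<tau> \<gamma>' + e"
proof -
  have "\<Phi> \<sigma> + ereal (plan_cost \<tau> \<gamma>) \<le> \<Phi> \<rho> + ereal (plan_cost \<tau> \<gamma>' + e)"
    using assms(1-3) unfolding near_minimal_def by blast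
  then show ?thesis by (simp add: assms(4,5))
qed

lemma near_minimal_mono: "near_minimal \<tau> e \<mu> \<sigma> \<gamma> \<Longrightarrow> e \<le> e' \<Longrightarrow> near_minimal \<tau> e' \<mu> \<sigma> \<gamma>"
  unfolding near_minimal_def by (force intro: order_trans add_left_mono)

text \<open>If the residuals of all almost minimal plans stayed below the slope, the limit of their cell
  averages would be a Frechet subgradient that is too short.\<close>

lemma near_minimal_with_slope:
  assumes \<tau>: "0 < \<tau>" and \<mu>: "\<mu> \<in> P2" and \<sigma>: "\<sigma> \<in> JKO \<tau> \<Phi> (forward \<tau> \<mu>)" and p: "\<Phi> \<sigma> = ereal p"
    and b: "0 \<le> b" "\<And>\<xi>. \<xi> \<in> frechet_subdiff F \<sigma> \<Longrightarrow> b \<le> L2_norm \<sigma> \<xi>" and e: "0 < e"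
  obtains \<gamma> where "near_minimal \<tau> e \<mu> \<sigma> \<gamma>" "b\<^sup>2 \<le> (l2norm \<gamma> (residual \<tau>))\<^sup>2 + e"
proof (rule ccontr)
  assume "\<not> thesis"
  then have no: "(l2norm \<gamma> (residual \<tau>))\<^sup>2 + e < b\<^sup>2" if "near_minimal \<tau> e \<mu> \<sigma> \<gamma>" for \<gamma>
    using that \<open>\<And>\<gamma>. near_minimal \<tau> e \<mu> \<sigma> \<gamma> \<Longrightarrow> b\<^sup>2 \<le> (l2norm \<gamma> (residual \<tau>))\<^sup>2 + e \<Longrightarrow> thesis\<close> by force
  define b' where "b' = sqrt (b\<^sup>2 - e)"
  have \<sigma>P: "\<sigma> \<in> P2" using \<sigma> by (simp add: JKO_def is_arg_min_def)
  have F\<sigma>: "F \<sigma> = ereal (p - potential_energy H \<sigma>)" by (simp add: F_def p)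
  have approx: "\<exists>\<xi>. sq_integrable \<sigma> \<xi> \<and> l2norm \<sigma> \<xi> \<le> b' \<and> (\<forall>\<nu>\<in>P2. \<forall>\<gamma>\<in>optimal_plans \<sigma> \<nu>.
      ereal (p - potential_energy H \<sigma> + displacement_pairing \<gamma> \<xi> - (1 / \<tau> + L) * (W2 \<sigma> \<nu>)\<^sup>2 - d) \<le> F \<nu>)"
    if d: "0 < d" for d
  proof -
    obtain \<gamma> where \<gamma>: "near_minimal \<tau> (min e (d / 2)) \<mu> \<sigma> \<gamma>"
      using near_minimal_exists[OF \<tau> \<mu> \<sigma>, of "min e (d / 2)"] e d by auto
    have "near_minimal \<tau> e \<mu> \<sigma> \<gamma>" by (rule near_minimal_mono[OF \<gamma>]) simp
    then have "(l2norm \<gamma> (residual \<tau>))\<^sup>2 \<le> b\<^sup>2 - e" using no by fastforce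
    then have small: "l2norm \<gamma> (residual \<tau>) \<le> b'" unfolding b'_def by (rule real_le_rsqrt)
    have \<gamma>d: "near_minimal \<tau> (d / 2) \<mu> \<sigma> \<gamma>" by (rule near_minimal_mono[OF \<gamma>]) simp
    have d2: "0 < d / 2" using d by simp
    obtain \<xi> where \<xi>: "sq_integrable \<sigma> \<xi>" "l2norm \<sigma> \<xi> \<le> l2norm \<gamma> (residual \<tau>)"
      "\<And>\<nu> \<gamma>'. \<nu> \<in> P2 \<Longrightarrow> \<gamma>' \<in> optimal_plans \<sigma> \<nu> \<Longrightarrow>
        ereal (p - potential_energy H \<sigma> + displacement_pairing \<gamma>' \<xi> - (1 / \<tau> + L) * (W2 \<sigma> \<nu>)\<^sup>2 - (d / 2 + d / 2)) \<le> F \<nu>"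
      by (rule approximate_subgradient[OF \<tau> \<mu> \<sigma>P p \<gamma>d d2]) blast
    show ?thesis
    proof (intro exI[of _ \<xi>] conjI ballI)
      show "l2norm \<sigma> \<xi> \<le> b'" using \<xi>(2) small by linarith
      show "ereal (p - potential_energy H \<sigma> + displacement_pairing \<gamma>' \<xi> - (1 / \<tau> + L) * (W2 \<sigma> \<nu>)\<^sup>2 - d) \<le> F \<nu>"
        if "\<nu> \<in> P2" "\<gamma>' \<in> optimal_plans \<sigma> \<nu>" for \<nu> \<gamma>'
        using \<xi>(3)[OF that] by simp
    qed (rule \<xi>(1))
  qed
  obtain \<xi> where \<xi>: "\<xi> \<in> frechet_subdiff F \<sigma>" "L2_norm \<sigma> \<xi> \<le> b'"
    by (rule frechet_subdiff_of_approximate[where \<phi> = F and p = "p - potential_energy H \<sigma>" and b = b'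
          and C = "1 / \<tau> + L", OF \<sigma>P F\<sigma> approx])
  obtain \<gamma> where "near_minimal \<tau> e \<mu> \<sigma> \<gamma>" using near_minimal_exists[OF \<tau> \<mu> \<sigma> e] by blast
  then have "0 \<le> b\<^sup>2 - e" using no[of \<gamma>] by (meson less_diff_eq less_imp_le order_trans zero_le_power2)
  then have "b'\<^sup>2 < b\<^sup>2" using e by (simp add: b'_def)
  then have "b' < b" using b(1) by (rule power2_less_imp_less)
  then show False using b(2)[OF \<xi>(1)] \<xi>(2) by simp
qed

text \<open>Comparison with the plan that moves nothing.\<close>

lemma near_minimal_descent:
  assumes "0 < \<tau>" "\<mu> \<in> P2" "\<sigma> \<in> P2" "\<Phi> \<mu> = ereal p0" "\<Phi> \<sigma> = ereal p" "near_minimal \<tau> e \<mu> \<sigma> \<gamma>"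
  shows "p + plan_cost \<tau> \<gamma> \<le> p0 + e"
proof -
  have m: "(\<lambda>x. x) \<in> borel_measurable \<mu>" using sq_integrableD(1)[OF P2D(3)[OF assms(2)]] .
  have "distr \<mu> borel (\<lambda>x. x) = \<mu>"
    using distr_id2[of borel \<mu>] P2D(2)[OF assms(2)] by simp
  then have diag: "distr \<mu> borel (\<lambda>x. (x, x)) \<in> couplings \<mu> \<mu>"
    using distr_pair_in_couplings[OF m m] by simp
  have "plan_cost \<tau> (distr \<mu> borel (\<lambda>x. (x, x))) = 0"
    using plan_cost_distr[OF m m] by (simp add: step_cost_def)
  then show ?thesis using near_minimalD[OF assms(6,2) diag assms(5,4)] by simp
qed

lemma JKO_finite:
  assumes \<tau>: "0 < \<tau>" and \<mu>: "\<mu> \<in> P2" "\<Phi> \<mu> = ereal p0" and \<sigma>: "\<sigma> \<in> JKO \<tau> \<Phi> (forward \<tau> \<mu>)"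
  obtains p where "\<sigma> \<in> P2" "\<Phi> \<sigma> = ereal p"
proof -
  have \<sigma>P: "\<sigma> \<in> P2" using \<sigma> by (simp add: JKO_def is_arg_min_def)
  have "\<Phi> \<sigma> + ereal (1 / (2 * \<tau>) * (W2 (forward \<tau> \<mu>) \<sigma>)\<^sup>2) \<le> \<Phi> \<mu> + ereal (1 / (2 * \<tau>) * (W2 (forward \<tau> \<mu>) \<mu>)\<^sup>2)"
    using \<sigma> \<mu>(1) unfolding JKO_def is_arg_min_def by (auto simp: not_less)
  then have "\<Phi> \<sigma> \<noteq> \<infinity>" by (auto simp: \<mu>(2))
  then show thesis using that \<sigma>P Phi_not_MInfty[OF \<sigma>P] by (cases "\<Phi> \<sigma>") auto
qed

text \<open>Along \<open>e\<close>-minimal plans both bounds hold up to a multiple of \<open>e\<close>.\<close>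

lemma step_estimate:
  assumes \<tau>: "0 < \<tau>" and \<mu>: "\<mu> \<in> P2" "F \<mu> = ereal f0" and \<sigma>: "\<sigma> \<in> JKO \<tau> \<Phi> (forward \<tau> \<mu>)"
  obtains f1 where "\<sigma> \<in> P2" "F \<sigma> = ereal f1" "(W2 \<mu> \<sigma>)\<^sup>2 \<le> 2 * \<tau> * (f0 - f1)"
    "\<And>b. 0 \<le> b \<Longrightarrow> (\<And>\<xi>. \<xi> \<in> frechet_subdiff F \<sigma> \<Longrightarrow> b \<le> L2_norm \<sigma> \<xi>) \<Longrightarrow>
      b\<^sup>2 \<le> (2 / \<tau>) * (1 + \<tau> * L) * (f0 - f1)"
proof -
  obtain p0 where p0: "\<Phi> \<mu> = ereal p0" "f0 = p0 - potential_energy H \<mu>"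
    using \<mu>(2) by (cases "\<Phi> \<mu>") (auto simp: F_def)
  obtain p where p: "\<sigma> \<in> P2" "\<Phi> \<sigma> = ereal p" by (rule JKO_finite[OF \<tau> \<mu>(1) p0(1) \<sigma>])
  define f1 where "f1 = p - potential_energy H \<sigma>"
  have descent: "sq_cost \<gamma> / (2 * \<tau>) + plan_bregman \<gamma> \<le> f0 - f1 + e" if "near_minimal \<tau> e \<mu> \<sigma> \<gamma>" for \<gamma> e
  proof -
    have "\<gamma> \<in> couplings \<mu> \<sigma>" using that by (simp add: near_minimal_def)
    from plan_cost_eq[OF this \<mu>(1) p(1), of \<tau>] show ?thesis
      using near_minimal_descent[OF \<tau> \<mu>(1) p(1) p0(1) p(2) that] by (simp add: f1_def p0(2))
  qed
  show thesis
  proof (rule that[OF p(1)])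
    show "F \<sigma> = ereal f1" by (simp add: F_def p(2) f1_def)
    show "(W2 \<mu> \<sigma>)\<^sup>2 \<le> 2 * \<tau> * (f0 - f1)"
    proof (rule le_of_forall_le_add_mult[where k = "2 * \<tau>"])
      fix e :: real assume "0 < e"
      then obtain \<gamma> where \<gamma>: "near_minimal \<tau> e \<mu> \<sigma> \<gamma>" using near_minimal_exists[OF \<tau> \<mu>(1) \<sigma>] by blast
      then have c: "\<gamma> \<in> couplings \<mu> \<sigma>" by (simp add: near_minimal_def)
      have "(W2 \<mu> \<sigma>)\<^sup>2 \<le> sq_cost \<gamma>"
        unfolding sq_cost_def using W2_le_coupling[OF c \<mu>(1) p(1)] by (intro power_mono) auto
      also have "\<dots> = 2 * \<tau> * (sq_cost \<gamma> / (2 * \<tau>))" using \<tau> by simp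
      also have "\<dots> \<le> 2 * \<tau> * (f0 - f1 + e)"
        using descent[OF \<gamma>] plan_bregman_bounds(1)[OF c \<mu>(1) p(1)] \<tau> by (intro mult_left_mono) auto
      finally show "(W2 \<mu> \<sigma>)\<^sup>2 \<le> 2 * \<tau> * (f0 - f1) + 2 * \<tau> * e" by (simp add: algebra_simps)
    qed
    fix b assume b: "0 \<le> b" "\<And>\<xi>. \<xi> \<in> frechet_subdiff F \<sigma> \<Longrightarrow> b \<le> L2_norm \<sigma> \<xi>"
    let ?k = "(2 / \<tau>) * (1 + \<tau> * L)"
    have k: "0 \<le> ?k" using \<tau> L_nonneg by simp
    show "b\<^sup>2 \<le> ?k * (f0 - f1)"
    proof (rule le_of_forall_le_add_mult[where k = "?k + 1"])
      fix e :: real assume e: "0 < e"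
      obtain \<gamma> where \<gamma>: "near_minimal \<tau> e \<mu> \<sigma> \<gamma>" "b\<^sup>2 \<le> (l2norm \<gamma> (residual \<tau>))\<^sup>2 + e"
        by (rule near_minimal_with_slope[OF \<tau> \<mu>(1) \<sigma> p(2) b e])
      then have c: "\<gamma> \<in> couplings \<mu> \<sigma>" by (simp add: near_minimal_def)
      have "(l2norm \<gamma> (residual \<tau>))\<^sup>2 \<le> ?k * (sq_cost \<gamma> / (2 * \<tau>) + plan_bregman \<gamma>)"
        by (rule residual_le_dissipation(1)[OF c \<mu>(1) p(1) \<tau>])
      also have "\<dots> \<le> ?k * (f0 - f1 + e)" by (rule mult_left_mono[OF descent[OF \<gamma>(1)] k])
      finally show "b\<^sup>2 \<le> ?k * (f0 - f1) + (?k + 1) * e"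
        using \<gamma>(2) by (simp only: distrib_left distrib_right)
    qed
  qed
qed

text \<open>The estimate for the exponent \<open>1/2\<close>, with \<open>1 + (\<eta> * L)\<^sup>2\<close> in place of \<open>1 + \<eta> * L\<close>.  As in De
  Giorgi's interpolation, the minimal value of the backward problem drops between the step sizes
  \<open>\<eta> / 2\<close> and \<open>\<eta>\<close> by at least the transport cost at \<open>\<eta> / 2\<close>, and there the slope inequality is
  available as well.\<close>

lemma step_estimate_half:
  assumes \<eta>: "0 < \<eta>" and \<mu>: "\<mu> \<in> P2" "F \<mu> = ereal f0"
    and \<sigma>: "\<sigma> \<in> JKO \<eta> \<Phi> (forward \<eta> \<mu>)" "F \<sigma> = ereal f1"
    and \<sigma>h: "\<sigma>h \<in> JKO (\<eta> / 2) \<Phi> (forward (\<eta> / 2) \<mu>)" "F \<sigma>h = ereal fh"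
    and c: "0 < c" and f: "fs \<le> f1" "fs \<le> fh"
    and slope: "\<And>\<xi>. \<xi> \<in> frechet_subdiff F \<sigma> \<Longrightarrow> c * sqrt (f1 - fs) \<le> L2_norm \<sigma> \<xi>"
    and slope_h: "\<And>\<xi>. \<xi> \<in> frechet_subdiff F \<sigma>h \<Longrightarrow> c * sqrt (fh - fs) \<le> L2_norm \<sigma>h \<xi>"
  shows "\<eta> * c\<^sup>2 * (f1 - fs) \<le> 2 * (1 + (\<eta> * L)\<^sup>2) * (f0 - f1)"
proof -
  have \<eta>2: "0 < \<eta> / 2" using \<eta> by simp
  obtain p0 where p0: "\<Phi> \<mu> = ereal p0" "f0 = p0 - potential_energy H \<mu>"
    using \<mu>(2) by (cases "\<Phi> \<mu>") (auto simp: F_def)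
  obtain p where p: "\<sigma> \<in> P2" "\<Phi> \<sigma> = ereal p" by (rule JKO_finite[OF \<eta> \<mu>(1) p0(1) \<sigma>(1)])
  obtain ph where ph: "\<sigma>h \<in> P2" "\<Phi> \<sigma>h = ereal ph" by (rule JKO_finite[OF \<eta>2 \<mu>(1) p0(1) \<sigma>h(1)])
  have f1: "f1 = p - potential_energy H \<sigma>" and fh: "fh = ph - potential_energy H \<sigma>h"
    using \<sigma>(2) \<sigma>h(2) by (simp_all add: F_def p ph)
  define l s a where "l = \<eta> * L" and "s = \<eta> * c\<^sup>2" and "a = f1 - fs"
  have l: "0 \<le> l" and s: "0 < s" and a: "0 \<le> a"
    using \<eta> L_nonneg c f by (simp_all add: l_def s_def a_def)
  define v where "v = 2 * (2 + l)\<^sup>2 + s * (1 + l)"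
  have v: "0 < v" using l s by (simp add: v_def add_pos_nonneg)
  define k where "k = \<eta> / (2 * (1 + l)) + (\<eta> + s + s * (\<eta> / (2 * (1 + l)))) / v + 2"
  have "s * a \<le> 2 * (1 + l\<^sup>2) * (f0 - f1)"
  proof (rule le_of_forall_le_add_mult[where k = "2 * (1 + l\<^sup>2) * k"])
    fix e :: real assume e: "0 < e"
    have nn: "0 \<le> c * sqrt (f1 - fs)" "0 \<le> c * sqrt (fh - fs)" using c f by simp_all
    obtain \<gamma> where \<gamma>: "near_minimal \<eta> e \<mu> \<sigma> \<gamma>" "(c * sqrt (f1 - fs))\<^sup>2 \<le> (l2norm \<gamma> (residual \<eta>))\<^sup>2 + e"
      by (rule near_minimal_with_slope[OF \<eta> \<mu>(1) \<sigma>(1) p(2) nn(1) slope e])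
    obtain \<gamma>h where \<gamma>h: "near_minimal (\<eta> / 2) e \<mu> \<sigma>h \<gamma>h"
      "(c * sqrt (fh - fs))\<^sup>2 \<le> (l2norm \<gamma>h (residual (\<eta> / 2)))\<^sup>2 + e"
      by (rule near_minimal_with_slope[OF \<eta>2 \<mu>(1) \<sigma>h(1) ph(2) nn(2) slope_h e])
    have cg: "\<gamma> \<in> couplings \<mu> \<sigma>" and ch: "\<gamma>h \<in> couplings \<mu> \<sigma>h"
      using \<gamma>(1) \<gamma>h(1) by (simp_all add: near_minimal_def)
    define P Y Bh where "P = sq_cost \<gamma> / (2 * \<eta>) + plan_bregman \<gamma>"
      and "Y = sq_cost \<gamma>h / (2 * \<eta>)" and "Bh = plan_bregman \<gamma>h"
    have cost: "plan_cost \<eta> \<gamma> = P - (potential_energy H \<sigma> - potential_energy H \<mu>)"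
      using plan_cost_eq[OF cg \<mu>(1) p(1)] by (simp add: P_def)
    have cost_h: "plan_cost \<eta> \<gamma>h = Y + Bh - (potential_energy H \<sigma>h - potential_energy H \<mu>)"
      using plan_cost_eq[OF ch \<mu>(1) ph(1)] by (simp add: Y_def Bh_def)
    have cost_h2: "plan_cost (\<eta> / 2) \<gamma>h = plan_cost \<eta> \<gamma>h + Y"
      unfolding plan_cost_eq[OF ch \<mu>(1) ph(1)] using \<eta> by (simp add: Y_def field_simps)
    have Bh: "Bh \<le> l * Y"
      using plan_bregman_bounds(2)[OF ch \<mu>(1) ph(1)] \<eta> by (simp add: Bh_def l_def Y_def field_simps)
    have m1: "ph + plan_cost (\<eta> / 2) \<gamma>h \<le> p0 + e"
      by (rule near_minimal_descent[OF \<eta>2 \<mu>(1) ph(1) p0(1) ph(2) \<gamma>h(1)])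
    have m2: "p + plan_cost \<eta> \<gamma> \<le> ph + plan_cost \<eta> \<gamma>h + e"
      by (rule near_minimalD[OF \<gamma>(1) ph(1) ch p(2) ph(2)])
    have D: "P + Y \<le> f0 - f1 + 2 * e"
      using m1 m2 cost cost_h2 by (simp add: f1 p0(2))
    have I: "a \<le> (fh - fs) + (1 + l) * Y - P + e"
      using m2 cost cost_h Bh by (simp add: f1 fh a_def distrib_right)
    have S1: "s * a \<le> 2 * (1 + l) * P + \<eta> * e"
    proof -
      have "c\<^sup>2 * a \<le> (2 / \<eta>) * (1 + \<eta> * L) * P + e"
        using residual_le_dissipation(1)[OF cg \<mu>(1) p(1) \<eta>] \<gamma>(2) f
        by (simp add: P_def a_def power_mult_distrib)
      then have "\<eta> * (c\<^sup>2 * a) \<le> \<eta> * ((2 / \<eta>) * (1 + \<eta> * L) * P + e)" using \<eta> by (intro mult_left_mono) auto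
      also have "\<dots> = 2 * (1 + l) * P + \<eta> * e" using \<eta> by (simp add: l_def field_simps)
      finally show ?thesis by (simp add: s_def algebra_simps)
    qed
    have S2: "s * (fh - fs) \<le> 2 * (2 + l)\<^sup>2 * Y + \<eta> * e"
    proof -
      have "c\<^sup>2 * (fh - fs) \<le> (1 / (\<eta> / 2) + L)\<^sup>2 * sq_cost \<gamma>h + e"
        using residual_le_dissipation(2)[OF ch \<mu>(1) ph(1) \<eta>2] \<gamma>h(2) f by (simp add: power_mult_distrib)
      also have "sq_cost \<gamma>h = 2 * \<eta> * Y" using \<eta> by (simp add: Y_def)
      finally have "\<eta> * (c\<^sup>2 * (fh - fs)) \<le> \<eta> * ((1 / (\<eta> / 2) + L)\<^sup>2 * (2 * \<eta> * Y) + e)"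
        using \<eta> by (intro mult_left_mono) auto
      also have "\<dots> = 2 * (\<eta> * (1 / (\<eta> / 2) + L))\<^sup>2 * Y + \<eta> * e"
        by (simp add: power2_eq_square algebra_simps)
      also have "\<eta> * (1 / (\<eta> / 2) + L) = 2 + l" using \<eta> by (simp add: l_def field_simps)
      finally show ?thesis by (simp add: s_def algebra_simps)
    qed
    \<comment> \<open>Absorb all errors of order \<open>e\<close> into \<open>P\<close> and \<open>Y\<close>.\<close>
    define P' where "P' = P + \<eta> / (2 * (1 + l)) * e"
    define Y' where "Y' = Y + (\<eta> + s + s * (\<eta> / (2 * (1 + l)))) / v * e"
    have "2 * (1 + l) * P' = 2 * (1 + l) * P + \<eta> * e"
      using l by (simp add: P'_def field_simps add_pos_nonneg)
    then have 1: "s * a \<le> 2 * (1 + l) * P'" using S1 by simp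
    have "v * Y' = v * Y + (\<eta> + s + s * (\<eta> / (2 * (1 + l)))) * e"
      using v by (simp add: Y'_def distrib_left)
    moreover have "s * P' = s * P + s * (\<eta> / (2 * (1 + l))) * e" by (simp add: P'_def algebra_simps)
    moreover have "s * a \<le> s * ((fh - fs) + (1 + l) * Y - P + e)" using I s by (intro mult_left_mono) auto
    then have "s * a \<le> s * (fh - fs) + s * (1 + l) * Y - s * P + s * e" by (simp add: algebra_simps)
    ultimately have 2: "s * a + s * P' \<le> v * Y'"
      using S2 unfolding v_def by (simp add: algebra_simps)
    have "s * a \<le> 2 * (1 + l\<^sup>2) * (P' + Y')"
      by (rule dissipation_inequality[OF l s a 1 2[unfolded v_def]])
    also have "\<dots> \<le> 2 * (1 + l\<^sup>2) * ((f0 - f1) + k * e)"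
    proof (intro mult_left_mono)
      show "P' + Y' \<le> (f0 - f1) + k * e"
        using D by (simp add: P'_def Y'_def k_def algebra_simps)
    qed simp
    finally show "s * a \<le> 2 * (1 + l\<^sup>2) * (f0 - f1) + 2 * (1 + l\<^sup>2) * k * e"
      by (simp add: algebra_simps)
  qed
  then show ?thesis by (simp add: s_def a_def l_def)
qed

end

section \<open>Real sequences under a Lojasiewicz inequality\<close>

text \<open>Concavity of \<open>t \<mapsto> t powr (1 - \<theta>)\<close>, multiplied by \<open>x powr \<theta>\<close> so that it is the weighted inequality
  between the geometric and the arithmetic mean.\<close>

lemma powr_diff_ge:
  fixes x y :: real
  assumes "0 < x" "0 \<le> y" "y \<le> x" "0 \<le> \<theta>" "\<theta> < 1"
  shows "(1 - \<theta>) * (x - y) \<le> x powr \<theta> * (x powr (1 - \<theta>) - y powr (1 - \<theta>))"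
proof -
  have "x powr \<theta> * y powr (1 - \<theta>) \<le> \<theta> * x + (1 - \<theta>) * y"
    using Youngs_inequality_0[of \<theta> "1 - \<theta>" x y] assms by (cases "y = 0") simp_all
  moreover have "x powr \<theta> * x powr (1 - \<theta>) = x"
    using assms by (simp add: powr_add[symmetric])
  ultimately show ?thesis by (simp add: algebra_simps)
qed

text \<open>In this locale \<open>a n\<close> is the gap to the optimal value after \<open>n\<close> steps.\<close>

locale lojasiewicz_sequence =
  fixes a :: "nat \<Rightarrow> real" and K \<theta> :: real
  assumes nonneg: "\<And>n. 0 \<le> a n" and decreasing: "\<And>n. a (Suc n) \<le> a n"
    and K: "0 < K" and theta: "0 \<le> \<theta>" "\<theta> < 1"
    and loj: "\<And>n. a (Suc n) powr \<theta> \<le> K * sqrt (a n - a (Suc n))"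
begin

definition d :: "nat \<Rightarrow> real" where "d n = sqrt (a n - a (Suc n))"

lemma d_nonneg [simp]: "0 \<le> d n"
  using decreasing by (simp add: d_def)

lemma d_power2: "(d n)\<^sup>2 = a n - a (Suc n)"
  using decreasing by (simp add: d_def)

lemma antimono: "m \<le> n \<Longrightarrow> a n \<le> a m"
  using lift_Suc_antimono_le[of a m n] decreasing by simp

lemma d_le_sqrt: "d n \<le> sqrt (a n)"
  using nonneg by (simp add: d_def)

lemma d_tendsto_0: "d \<longlonglongrightarrow> 0"
proof -
  have "decseq a" by (simp add: decseq_def antimono)
  then obtain l where l: "a \<longlonglongrightarrow> l" using decseq_convergent[of a 0] nonneg by blast
  have "(\<lambda>n. sqrt (a n - a (Suc n))) \<longlonglongrightarrow> sqrt (l - l)"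
    by (intro tendsto_intros l LIMSEQ_Suc)
  then show ?thesis by (simp add: d_def[abs_def])
qed

text \<open>The left side of the Lojasiewicz inequality is then \<open>1\<close> as long as the gap is positive, by
  the convention \<open>0 powr 0 = 0\<close>, while the right side tends to zero.\<close>

lemma eventually_zero: "\<theta> = 0 \<Longrightarrow> \<exists>N. \<forall>n\<ge>N. a n = 0"
proof -
  assume \<theta>: "\<theta> = 0"
  have "(\<lambda>n. K * d n) \<longlonglongrightarrow> K * 0" by (intro tendsto_intros d_tendsto_0)
  then have "\<forall>\<^sub>F n in sequentially. K * d n < 1" by (rule order_tendstoD(2)) simp
  then obtain N where N: "\<And>n. N \<le> n \<Longrightarrow> K * d n < 1" unfolding eventually_sequentially by blast
  have "a (Suc n) = 0" if "N \<le> n" for n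
  proof (rule ccontr)
    assume "a (Suc n) \<noteq> 0"
    then have "a (Suc n) powr \<theta> = 1" by (simp add: \<theta>)
    then show False using loj[of n] N[OF that] by (simp add: d_def)
  qed
  then have "a n = 0" if "Suc N \<le> n" for n
    using that by (cases n) auto
  then show ?thesis by blast
qed

lemma tendsto_0: "a \<longlonglongrightarrow> 0"
proof (cases "\<theta> = 0")
  case True
  then obtain N where "\<forall>n\<ge>N. a n = 0" using eventually_zero by blast
  then show ?thesis by (intro tendsto_eventually) (auto simp: eventually_sequentially)
next
  case False
  then have \<theta>: "0 < \<theta>" using theta by simp
  have "(\<lambda>n. a (Suc n) powr \<theta>) \<longlonglongrightarrow> 0"
  proof (rule tendsto_sandwich[of "\<lambda>_. 0" _ _ "\<lambda>n. K * d n"])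
    show "(\<lambda>n. K * d n) \<longlonglongrightarrow> 0" using tendsto_mult[OF tendsto_const[of K] d_tendsto_0] by simp
  qed (use loj in \<open>simp_all add: d_def\<close>)
  then have "(\<lambda>n. (a (Suc n) powr \<theta>) powr (1 / \<theta>)) \<longlonglongrightarrow> 0 powr (1 / \<theta>)"
    by (rule tendsto_powr') (use \<theta> in auto)
  moreover have "(a (Suc n) powr \<theta>) powr (1 / \<theta>) = a (Suc n)" for n
    using \<theta> nonneg[of "Suc n"] by (simp add: powr_powr)
  ultimately have "(\<lambda>n. a (Suc n)) \<longlonglongrightarrow> 0" by simp
  then show ?thesis by (rule LIMSEQ_imp_Suc)
qed

definition C :: real where "C = K / (1 - \<theta>)"

lemma C_nonneg: "0 \<le> C"
  using K theta by (simp add: C_def)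

text \<open>Concavity of \<open>t \<mapsto> t powr (1 - \<theta>)\<close> and the arithmetic-geometric mean inequality: each step
  length is at most half of the previous one plus a telescoping term.\<close>

lemma step_length:
  "2 * d (Suc n) \<le> d n + C * (a (Suc n) powr (1 - \<theta>) - a (Suc (Suc n)) powr (1 - \<theta>))"
proof (cases "a (Suc n) = 0")
  case True
  then have "a (Suc (Suc n)) = 0" using decreasing[of "Suc n"] nonneg[of "Suc (Suc n)"] by simp
  then show ?thesis using True nonneg[of n] by (simp add: d_def)
next
  case False
  define x y where "x = a (Suc n)" and "y = a (Suc (Suc n))"
  define D where "D = x powr (1 - \<theta>) - y powr (1 - \<theta>)"
  have xy: "0 < x" "0 \<le> y" "y \<le> x"
    using False nonneg[of "Suc n"] nonneg[of "Suc (Suc n)"] decreasing[of "Suc n"] by (simp_all add: x_def y_def)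
  have D: "0 \<le> D" unfolding D_def using xy theta by (simp add: powr_mono2)
  have "(1 - \<theta>) * (d (Suc n))\<^sup>2 \<le> x powr \<theta> * D"
    using powr_diff_ge[OF xy theta] unfolding d_power2 by (simp add: x_def y_def D_def)
  also have "\<dots> \<le> (K * d n) * D"
    using loj[of n] D by (intro mult_right_mono) (simp_all add: x_def d_def)
  finally have sq: "(d (Suc n))\<^sup>2 \<le> d n * (C * D)"
    using theta by (simp add: C_def field_simps)
  have "(2 * d (Suc n))\<^sup>2 = 4 * (d (Suc n))\<^sup>2" by (simp add: power_mult_distrib)
  also have "\<dots> \<le> 4 * (d n * (C * D))" using sq by simp
  also have "\<dots> \<le> (d n + C * D)\<^sup>2"
    using zero_le_power2[of "d n - C * D"] by (simp add: power2_eq_square algebra_simps)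
  finally have "2 * d (Suc n) \<le> d n + C * D"
    by (rule power2_le_imp_le) (use C_nonneg D in simp)
  then show ?thesis by (simp add: D_def x_def y_def)
qed

text \<open>Summing the step estimate absorbs half of the sum on its left side.\<close>

lemma partial_sum: "(\<Sum>k<m. d (Suc n + k)) \<le> d n + C * a (Suc n) powr (1 - \<theta>)"
proof -
  have "2 * (\<Sum>k<m. d (Suc n + k)) \<le> (\<Sum>k<m. d (n + k)) + C * (a (Suc n) powr (1 - \<theta>) - a (Suc n + m) powr (1 - \<theta>))"
  proof (induction m)
    case (Suc m)
    then show ?case using step_length[of "n + m"] by (simp add: algebra_simps)
  qed simp
  moreover have "(\<Sum>k<m. d (n + k)) \<le> d n + (\<Sum>k<m. d (Suc n + k))"
  proof (cases m)
    case (Suc j)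
    have "(\<Sum>k<Suc j. d (n + k)) = d n + (\<Sum>k<j. d (Suc n + k))"
      by (subst sum.lessThan_Suc_shift) simp
    then show ?thesis by (simp add: Suc)
  qed simp
  moreover have "0 \<le> C * a (Suc n + m) powr (1 - \<theta>)" using C_nonneg by simp
  ultimately show ?thesis by (simp add: right_diff_distrib)
qed

lemma summable_d: "summable d"
proof -
  have "summable (\<lambda>k. d (Suc 0 + k))"
  proof (rule bounded_imp_summable)
    show "(\<Sum>k\<le>n. d (Suc 0 + k)) \<le> d 0 + C * a (Suc 0) powr (1 - \<theta>)" for n
      using partial_sum[where n = 0 and m = "Suc n"] by (simp only: lessThan_Suc_atMost)
  qed simp
  then show ?thesis by (simp add: summable_Suc_iff)
qed

definition R :: "nat \<Rightarrow> real" where "R n = (\<Sum>k. d (n + k))"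

lemma summable_shift: "summable (\<lambda>k. d (n + k))"
  using summable_d summable_iff_shift[of d n] by (simp add: add.commute)

lemma R_nonneg: "0 \<le> R n"
  unfolding R_def by (intro suminf_nonneg summable_shift) simp

lemma R_le: "R n \<le> 2 * sqrt (a n) + C * a n powr (1 - \<theta>)"
proof -
  have "R (Suc n) \<le> d n + C * a (Suc n) powr (1 - \<theta>)"
    unfolding R_def using partial_sum[of n] summable_shift[of "Suc n"] by (intro suminf_le_const) auto
  moreover have "R n = d n + R (Suc n)"
    using suminf_split_head[OF summable_shift[of n]] by (simp add: R_def)
  moreover have "C * a (Suc n) powr (1 - \<theta>) \<le> C * a n powr (1 - \<theta>)"
    using C_nonneg theta nonneg decreasing by (intro mult_left_mono powr_mono2) auto
  ultimately show ?thesis using d_le_sqrt[of n] by linarith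
qed

lemma eventually_le_1: "\<forall>\<^sub>F n in sequentially. a n \<le> 1"
  using order_tendstoD(2)[OF tendsto_0, of 1] by (rule eventually_mono) simp_all

lemma R_zero: "a n = 0 \<Longrightarrow> R n = 0"
  using R_le[of n] R_nonneg[of n] by simp

text \<open>For \<open>\<theta> \<le> 1/2\<close> the square root dominates, and a geometric decay of the gaps with ratio \<open>q\<^sup>2\<close> is
  inherited by the remaining length with ratio \<open>q\<close>.\<close>

lemma R_linear_rate:
  assumes \<theta>: "\<theta> \<le> 1 / 2" and q: "0 < q" and ratio: "\<forall>\<^sub>F n in sequentially. a (Suc n) \<le> q\<^sup>2 * a n"
  shows "R \<in> O(\<lambda>n. q ^ n)"
proof -
  obtain N where N: "\<And>n. N \<le> n \<Longrightarrow> a (Suc n) \<le> q\<^sup>2 * a n" "\<And>n. N \<le> n \<Longrightarrow> a n \<le> 1"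
    using eventually_conj[OF ratio eventually_le_1] unfolding eventually_sequentially by blast
  have geo: "sqrt (a (N + k)) \<le> q ^ k * sqrt (a N)" for k
  proof (induction k)
    case (Suc k)
    have "sqrt (a (N + Suc k)) \<le> sqrt (q\<^sup>2 * a (N + k))" using N(1)[of "N + k"] by simp
    also have "\<dots> = q * sqrt (a (N + k))" using q by (simp add: real_sqrt_mult)
    also have "\<dots> \<le> q * (q ^ k * sqrt (a N))" using Suc q by (intro mult_left_mono) auto
    finally show ?case by simp
  qed simp
  define c where "c = (2 + C) * sqrt (a N) / q ^ N"
  have "norm (R n) \<le> c * norm (q ^ n)" if n: "N \<le> n" for n
  proof -
    have "a n powr (1 - \<theta>) \<le> a n powr (1 / 2)"
      using \<theta> nonneg N(2)[OF n] by (intro powr_mono') auto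
    then have "a n powr (1 - \<theta>) \<le> sqrt (a n)" using nonneg by (simp add: powr_half_sqrt)
    from mult_left_mono[OF this C_nonneg] have "R n \<le> 2 * sqrt (a n) + C * sqrt (a n)"
      using R_le[of n] by linarith
    also have "\<dots> = (2 + C) * sqrt (a n)" by (simp add: algebra_simps)
    also have "\<dots> \<le> (2 + C) * (q ^ (n - N) * sqrt (a N))"
      using geo[of "n - N"] n C_nonneg by (intro mult_left_mono) auto
    also have "\<dots> = c * q ^ n" using q n by (simp add: c_def power_diff)
    finally show ?thesis using R_nonneg[of n] q by simp
  qed
  then show ?thesis by (intro bigoI[of _ c] eventually_sequentiallyI[of N])
qed

text \<open>For \<open>\<theta> < 1/2\<close> the ratio of successive gaps tends to zero; \<open>(1/2)\<^sup>2\<close> is small enough because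
  \<open>M / (M + 1)\<close> is at least \<open>1/2\<close>.\<close>

lemma eventually_ratio:
  assumes \<theta>: "0 < \<theta>" "\<theta> < 1 / 2"
  shows "\<forall>\<^sub>F n in sequentially. a (Suc n) \<le> (1 / 2)\<^sup>2 * a n"
proof -
  have "(\<lambda>n. K\<^sup>2 * a (Suc n) powr (1 - 2 * \<theta>)) \<longlonglongrightarrow> K\<^sup>2 * 0 powr (1 - 2 * \<theta>)"
    using \<theta> by (intro tendsto_mult tendsto_const tendsto_powr' LIMSEQ_Suc[OF tendsto_0]) (auto simp: nonneg)
  then have "\<forall>\<^sub>F n in sequentially. K\<^sup>2 * a (Suc n) powr (1 - 2 * \<theta>) < 1 / 3"
    by (rule order_tendstoD(2)) simp
  then show ?thesis
  proof eventually_elim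
    case (elim n)
    have "(a (Suc n) powr \<theta>)\<^sup>2 \<le> (K * d n)\<^sup>2"
      using loj[of n] by (intro power_mono) (simp_all add: d_def)
    then have sq: "a (Suc n) powr (2 * \<theta>) \<le> K\<^sup>2 * (a n - a (Suc n))"
      unfolding power_mult_distrib d_power2 by (simp add: power2_eq_square powr_add[symmetric])
    have "a (Suc n) = a (Suc n) powr (1 - 2 * \<theta>) * a (Suc n) powr (2 * \<theta>)"
      using nonneg[of "Suc n"] by (simp add: powr_add[symmetric])
    also have "\<dots> \<le> a (Suc n) powr (1 - 2 * \<theta>) * (K\<^sup>2 * (a n - a (Suc n)))"
      using sq by (intro mult_left_mono) auto
    also have "\<dots> = (K\<^sup>2 * a (Suc n) powr (1 - 2 * \<theta>)) * (a n - a (Suc n))" by simp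
    also have "\<dots> \<le> 1 / 3 * (a n - a (Suc n))"
      using elim decreasing[of n] by (intro mult_right_mono) auto
    finally show ?case by (simp add: power2_eq_square)
  qed
qed

text \<open>Comparison with the sequence \<open>D * n powr (- r)\<close>, where \<open>r = 1 / (2 * \<theta> - 1)\<close>.  If the gap first
  exceeded it at \<open>Suc n\<close>, the recursion would force the gap at \<open>n\<close> above it too, provided
  \<open>(1 + 1 / n) powr r \<le> 1 + D powr (2 * \<theta> - 1) / (K\<^sup>2 * Suc n)\<close>; the chord of \<open>t \<mapsto> t powr r\<close> over \<open>[1, 2]\<close>
  shows that this holds for large \<open>D\<close>.\<close>

lemma sublinear_gap:
  assumes \<theta>: "1 / 2 < \<theta>"
  shows "\<exists>D>0. \<forall>n\<ge>1. a n \<le> D * real n powr (- 1 / (2 * \<theta> - 1))"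
proof -
  define p r where "p = 2 * \<theta> - 1" and "r = 1 / p"
  have p: "0 < p" "p < 1" using \<theta> theta by (simp_all add: p_def)
  have r: "1 \<le> r" using p by (simp add: r_def)
  define Q where "Q = 2 powr r - 1"
  have Q: "0 \<le> Q" using r ge_one_powr_ge_zero[of 2 r] by (simp add: Q_def)
  define D where "D = max (max 1 (a 1)) ((2 * K\<^sup>2 * Q) powr r)"
  have D: "0 < D" "a 1 \<le> D" by (auto simp: D_def)
  have Dp: "2 * K\<^sup>2 * Q \<le> D powr p"
  proof -
    have "((2 * K\<^sup>2 * Q) powr r) powr p \<le> D powr p"
      using p by (intro powr_mono2) (auto simp: D_def)
    then show ?thesis using p Q by (simp add: powr_powr r_def)
  qed
  have "a n \<le> D * real n powr (- r)" if "1 \<le> n" for n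
    using that
  proof (induction n rule: dec_induct)
    case base then show ?case using D by simp
  next
    case (step n)
    define x where "x = D * real (Suc n) powr (- r)"
    have x: "0 < x" using D by (simp add: x_def)
    show ?case
    proof (rule ccontr)
      assume "\<not> a (Suc n) \<le> D * real (Suc n) powr (- r)"
      then have gt: "x < a (Suc n)" by (simp add: x_def)
      define t where "t = 1 / real n"
      have t: "0 < t" "t \<le> 1" using step(1) by (simp_all add: t_def)
      have "(1 + t) powr r \<le> 1 + Q * t"
      proof -
        have "((1 - t) *\<^sub>R 1 + t *\<^sub>R 2) powr r \<le> (1 - t) * 1 powr r + t * 2 powr r"
          using t by (intro convex_onD[OF powr_convex[OF r]]) auto
        then show ?thesis by (simp add: Q_def algebra_simps)
      qed
      also have "Q * t \<le> x powr p / K\<^sup>2"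
      proof -
        have xp: "x powr p = D powr p / real (Suc n)"
        proof -
          have "x powr p = D powr p * real (Suc n) powr (- r * p)"
            unfolding x_def by (simp add: powr_mult powr_powr del: of_nat_Suc)
          also have "- r * p = - 1" using p by (simp add: r_def)
          finally show ?thesis by (simp add: powr_minus_divide del: of_nat_Suc)
        qed
        have "t \<le> 2 / real (Suc n)" using step(1) by (simp add: t_def field_simps)
        from mult_left_mono[OF this Q] have "Q * t \<le> 2 * Q / real (Suc n)" by (simp add: mult.commute)
        also have "\<dots> \<le> (D powr p / K\<^sup>2) / real (Suc n)"
          using Dp K by (intro divide_right_mono) (simp_all add: field_simps)
        finally show ?thesis by (simp add: xp mult.commute)
      qed
      finally have pow: "(1 + t) powr r \<le> 1 + x powr p / K\<^sup>2" by simp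
      have "(a (Suc n) powr \<theta>)\<^sup>2 \<le> (K * d n)\<^sup>2"
        using loj[of n] by (intro power_mono) (simp_all add: d_def)
      then have "a (Suc n) powr (1 + p) \<le> K\<^sup>2 * (a n - a (Suc n))"
        unfolding power_mult_distrib d_power2 by (simp add: power2_eq_square powr_add[symmetric] p_def)
      moreover have "x powr (1 + p) \<le> a (Suc n) powr (1 + p)"
        using x gt p by (intro powr_mono2) auto
      ultimately have "x powr (1 + p) / K\<^sup>2 \<le> a n - a (Suc n)"
        using K by (simp add: field_simps)
      moreover have "x powr (1 + p) = x * x powr p" using x by (simp add: powr_add)
      ultimately have "x * (1 + x powr p / K\<^sup>2) < a n" using gt by (simp add: distrib_left)
      moreover have "x * (1 + t) powr r \<le> x * (1 + x powr p / K\<^sup>2)"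
        using pow x by (intro mult_left_mono) auto
      moreover have "x * (1 + t) powr r = D * real n powr (- r)"
      proof -
        have "1 + t = real (Suc n) / real n" using step(1) by (simp add: t_def field_simps)
        then show ?thesis
          using step(1) by (simp add: x_def powr_divide powr_minus_divide)
      qed
      ultimately show False using step(3) by simp
    qed
  qed
  then show ?thesis using D by (intro exI[of _ D]) (auto simp: r_def p_def)
qed

lemma R_sublinear_rate:
  assumes \<theta>: "1 / 2 < \<theta>"
  shows "R \<in> O(\<lambda>n. real n powr (- ((1 - \<theta>) / (2 * \<theta> - 1))))"
proof -
  from sublinear_gap[OF \<theta>] obtain D where D: "0 < D"
    and all: "\<forall>n\<ge>1. a n \<le> D * real n powr (- 1 / (2 * \<theta> - 1))"
    by (elim exE conjE)
  obtain N where N: "\<And>n. N \<le> n \<Longrightarrow> a n \<le> 1"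
    using eventually_le_1 unfolding eventually_sequentially by blast
  define c where "c = (2 + C) * D powr (1 - \<theta>)"
  have "norm (R n) \<le> c * norm (real n powr (- ((1 - \<theta>) / (2 * \<theta> - 1))))" if n: "max 1 N \<le> n" for n
  proof -
    have "a n powr (1 / 2) \<le> a n powr (1 - \<theta>)"
      using \<theta> nonneg[of n] N[of n] n by (intro powr_mono') simp_all
    then have "sqrt (a n) \<le> a n powr (1 - \<theta>)" using nonneg[of n] by (simp add: powr_half_sqrt)
    then have "R n \<le> 2 * a n powr (1 - \<theta>) + C * a n powr (1 - \<theta>)"
      using R_le[of n] by linarith
    also have "\<dots> = (2 + C) * a n powr (1 - \<theta>)" by (rule distrib_right[symmetric])
    also have "\<dots> \<le> (2 + C) * (D * real n powr (- 1 / (2 * \<theta> - 1))) powr (1 - \<theta>)"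
    proof (rule mult_left_mono)
      show "a n powr (1 - \<theta>) \<le> (D * real n powr (- 1 / (2 * \<theta> - 1))) powr (1 - \<theta>)"
        using all[rule_format, of n] n nonneg[of n] theta by (intro powr_mono2) simp_all
    qed (use C_nonneg in simp)
    also have "\<dots> = c * real n powr (- ((1 - \<theta>) / (2 * \<theta> - 1)))"
    proof -
      have "(- 1 / (2 * \<theta> - 1)) * (1 - \<theta>) = - ((1 - \<theta>) / (2 * \<theta> - 1))" by simp
      then show ?thesis using D by (simp only: c_def powr_mult powr_powr mult.assoc)
    qed
    finally show ?thesis using R_nonneg[of n] by simp
  qed
  then show ?thesis by (intro bigoI[of _ c] eventually_sequentiallyI[of "max 1 N"])
qed

end

section \<open>Continuity of potential energies\<close>

text \<open>Couple the two measures almost optimally and apply the Cauchy-Schwarz inequality to the local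
  Lipschitz bound, with \<open>norm x\<close> estimated by \<open>norm y + norm (x - y)\<close>.\<close>

lemma potential_energy_diff_le:
  fixes f :: "'a::euclidean_space \<Rightarrow> real"
  assumes f: "f \<in> borel_measurable borel" "quadratic_growth f"
    and C: "0 \<le> C" "\<And>x y. \<bar>f x - f y\<bar> \<le> C * (1 + norm x + norm y) * norm (x - y)"
    and P: "\<mu> \<in> P2" "\<nu> \<in> P2" and t: "W2 \<mu> \<nu> < t"
  shows "\<bar>potential_energy f \<mu> - potential_energy f \<nu>\<bar> \<le> C * ((1 + 2 * l2norm \<nu> (\<lambda>x. x) + t) * t)"
proof -
  obtain \<gamma> where \<gamma>: "\<gamma> \<in> couplings \<mu> \<nu>" "l2norm \<gamma> (\<lambda>z. fst z - snd z) < t"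
    using W2_near_optimal[OF P, of "t - W2 \<mu> \<nu>"] t by auto
  note c = couplingsD[OF \<gamma>(1) P]
  interpret prob_space \<gamma> by (rule c(1))
  define u where "u z = 1 + 2 * norm (snd z) + norm (fst z - snd z)" for z :: "'a \<times> 'a"
  have sd: "sq_integrable \<gamma> (\<lambda>z. fst z - snd z)" by (intro sq_integrable_diff c)
  have norm_sq: "sq_integrable \<gamma> (\<lambda>z. norm (h z))" if "sq_integrable \<gamma> h" for h :: "'a \<times> 'a \<Rightarrow> 'a"
    using that unfolding sq_integrable_def by auto
  have s2: "sq_integrable \<gamma> (\<lambda>z. 2 * norm (snd z))"
    using sq_integrable_scaleR[OF norm_sq[OF c(9)], of 2] by simp
  have su: "sq_integrable \<gamma> u"
    unfolding u_def by (intro sq_integrable_add sq_integrable_const s2 norm_sq[OF sd])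
  have n2: "l2norm \<gamma> snd = l2norm \<nu> (\<lambda>x. x)"
    using l2norm_distr[OF c(7), of "\<lambda>x. x"] c(5) by simp
  have "l2norm \<gamma> u \<le> l2norm \<gamma> (\<lambda>z. 1 + 2 * norm (snd z)) + l2norm \<gamma> (\<lambda>z. norm (fst z - snd z))"
    unfolding u_def by (intro l2norm_triangle sq_integrable_add sq_integrable_const s2 norm_sq[OF sd])
  also have "l2norm \<gamma> (\<lambda>z. 1 + 2 * norm (snd z)) \<le> l2norm \<gamma> (\<lambda>z. 1 :: real) + l2norm \<gamma> (\<lambda>z. 2 * norm (snd z))"
    by (intro l2norm_triangle sq_integrable_const s2)
  also have "l2norm \<gamma> (\<lambda>z. 2 * norm (snd z)) = 2 * l2norm \<nu> (\<lambda>x. x)"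
    using l2norm_scaleR[of \<gamma> 2 "\<lambda>z. norm (snd z)"] n2 by (simp add: l2norm_def)
  also have "l2norm \<gamma> (\<lambda>z. norm (fst z - snd z)) = l2norm \<gamma> (\<lambda>z. fst z - snd z)"
    by (simp add: l2norm_def)
  finally have u: "l2norm \<gamma> u \<le> 1 + 2 * l2norm \<nu> (\<lambda>x. x) + t" using \<gamma>(2) by simp
  have int: "integrable \<gamma> (\<lambda>z. f (fst z))" "integrable \<gamma> (\<lambda>z. f (snd z))"
    by (intro integrable_quadratic_growth f c)+
  have "\<bar>potential_energy f \<mu> - potential_energy f \<nu>\<bar> = \<bar>\<integral>z. f (fst z) - f (snd z) \<partial>\<gamma>\<bar>"
    using int by (simp add: potential_energy_coupling[OF \<gamma>(1) P f(1)])
  also have "\<dots> \<le> (\<integral>z. \<bar>f (fst z) - f (snd z)\<bar> \<partial>\<gamma>)" by (rule integral_abs_bound)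
  also have "\<dots> \<le> (\<integral>z. C * (norm (u z) * norm (fst z - snd z)) \<partial>\<gamma>)"
  proof (rule integral_mono)
    show "integrable \<gamma> (\<lambda>z. \<bar>f (fst z) - f (snd z)\<bar>)" using int by auto
    show "integrable \<gamma> (\<lambda>z. C * (norm (u z) * norm (fst z - snd z)))"
      by (intro integrable_mult_right integrable_mult_norms su sd)
    fix z :: "'a \<times> 'a"
    have "1 + norm (fst z) + norm (snd z) \<le> u z"
      using norm_triangle_ineq[of "fst z - snd z" "snd z"] by (simp add: u_def)
    moreover have "0 \<le> u z" by (simp add: u_def)
    ultimately have "C * (1 + norm (fst z) + norm (snd z)) * norm (fst z - snd z) \<le> C * norm (u z) * norm (fst z - snd z)"
      using C(1) by (intro mult_right_mono mult_left_mono) auto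
    then show "\<bar>f (fst z) - f (snd z)\<bar> \<le> C * (norm (u z) * norm (fst z - snd z))"
      using C(2)[of "fst z" "snd z"] by (simp add: mult.assoc)
  qed
  also have "\<dots> = C * (\<integral>z. norm (u z) * norm (fst z - snd z) \<partial>\<gamma>)" by simp
  also have "\<dots> \<le> C * (l2norm \<gamma> u * l2norm \<gamma> (\<lambda>z. fst z - snd z))"
    by (intro mult_left_mono integral_mult_norms_le su sd C(1))
  also have "\<dots> \<le> C * ((1 + 2 * l2norm \<nu> (\<lambda>x. x) + t) * t)"
    using u \<gamma>(2) C(1) order_trans[OF l2norm_nonneg u] by (intro mult_left_mono mult_mono) auto
  finally show ?thesis .
qed

lemma potential_energy_continuous:
  fixes f :: "'a::euclidean_space \<Rightarrow> real"
  assumes f: "convex_on UNIV f" "quadratic_growth f"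
    and P: "\<And>n. \<mu> n \<in> P2" "\<nu> \<in> P2" and lim: "(\<lambda>n. W2 (\<mu> n) \<nu>) \<longlonglongrightarrow> 0"
  shows "(\<lambda>n. potential_energy f (\<mu> n)) \<longlonglongrightarrow> potential_energy f \<nu>"
proof -
  have m: "f \<in> borel_measurable borel"
    using convex_on_continuous[OF open_UNIV f(1)] by (rule borel_measurable_continuous_onI)
  obtain C where C: "0 \<le> C" "\<And>x y. \<bar>f x - f y\<bar> \<le> C * (1 + norm x + norm y) * norm (x - y)"
    by (rule convex_quadratic_growth_lipschitz_bound[OF f]) (rule that; assumption)
  define t where "t n = W2 (\<mu> n) \<nu> + 1 / real (Suc n)" for n
  have "(\<lambda>n. W2 (\<mu> n) \<nu> + 1 / real (Suc n)) \<longlonglongrightarrow> 0 + 0"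
    by (intro tendsto_add lim LIMSEQ_Suc[OF lim_1_over_n])
  then have t: "t \<longlonglongrightarrow> 0" by (simp add: t_def[abs_def])
  have "norm (potential_energy f (\<mu> n) - potential_energy f \<nu>) \<le> C * ((1 + 2 * l2norm \<nu> (\<lambda>x. x) + t n) * t n)" for n
    unfolding real_norm_def by (rule potential_energy_diff_le[OF m f(2) C P]) (simp add: t_def)
  then have "\<forall>\<^sub>F n in sequentially. norm (potential_energy f (\<mu> n) - potential_energy f \<nu>)
      \<le> C * ((1 + 2 * l2norm \<nu> (\<lambda>x. x) + t n) * t n)"
    by (intro always_eventually allI)
  moreover have "(\<lambda>n. C * ((1 + 2 * l2norm \<nu> (\<lambda>x. x) + t n) * t n)) \<longlonglongrightarrow> C * ((1 + 2 * l2norm \<nu> (\<lambda>x. x) + 0) * 0)"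
    by (intro tendsto_intros t)
  ultimately have "(\<lambda>n. potential_energy f (\<mu> n) - potential_energy f \<nu>) \<longlonglongrightarrow> 0"
    unfolding mult_zero_right by (rule Lim_null_comparison)
  then show ?thesis by (rule LIM_zero_cancel)
qed

section \<open>Convergence of the scheme\<close>

lemma W2_limit_le_suminf:
  assumes P: "\<And>n. \<mu> n \<in> P2" "\<nu> \<in> P2" and lim: "(\<lambda>n. W2 (\<mu> n) \<nu>) \<longlonglongrightarrow> 0"
    and b: "\<And>n. W2 (\<mu> n) (\<mu> (Suc n)) \<le> b n" "\<And>n. summable (\<lambda>k. b (n + k))"
  shows "W2 (\<mu> n) \<nu> \<le> (\<Sum>k. b (n + k))"
proof -
  have step: "W2 (\<mu> n) \<nu> \<le> (\<Sum>k<m. b (n + k)) + W2 (\<mu> (n + m)) \<nu>" for m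
  proof (induction m)
    case (Suc m)
    show ?case
      using Suc W2_triangle[OF P(1)[of "n + m"] P(1)[of "Suc (n + m)"] P(2)] b(1)[of "n + m"] by simp
  qed simp
  have b0: "0 \<le> b k" for k using b(1)[of k] W2_nonneg[of "\<mu> k" "\<mu> (Suc k)"] by linarith
  have "W2 (\<mu> n) \<nu> \<le> (\<Sum>k. b (n + k)) + W2 (\<mu> (n + m)) \<nu>" for m
    using step[of m] sum_le_suminf[OF b(2)[of n], of "{..<m}"] b0 by simp
  moreover have "(\<lambda>m. (\<Sum>k. b (n + k)) + W2 (\<mu> (n + m)) \<nu>) \<longlonglongrightarrow> (\<Sum>k. b (n + k)) + 0"
    using LIMSEQ_ignore_initial_segment[OF lim, of n] by (intro tendsto_intros) (simp add: add.commute)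
  ultimately show ?thesis by (intro LIMSEQ_le_const[of _ "\<Sum>k. b (n + k)"]) auto
qed

theorem theorem5:
  fixes G H :: "'a::euclidean_space \<Rightarrow> real"
    and \<H> \<F> :: "'a measure \<Rightarrow> ereal"
    and \<mu> \<nu> :: "nat \<Rightarrow> 'a measure"
    and r\<^sub>0 :: ereal
    and \<eta>\<^sub>0 \<eta> c \<theta> L\<^sub>H :: real
  assumes F_eq: "\<And>\<rho>. \<F> \<rho> = \<H> \<rho> + ereal (potential_energy G \<rho>) - ereal (potential_energy H \<rho>)"
    and F_bounded: "bounded_below \<F>"
    and G: "convex_on UNIV G" "quadratic_growth G"
    and H: "convex_on UNIV H" "quadratic_growth H"
    and Hfun: "extended_real_functional \<H>" "proper \<H>" "lsc_W2 \<H>" "convex_gen_geodesics \<H>"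
      "domain \<H> \<subseteq> P2_abs"
    and eta0: "\<eta>\<^sub>0 > 0"
    and JKO_nonempty: "\<And>\<tau> \<rho>. 0 < \<tau> \<Longrightarrow> \<tau> < \<eta>\<^sub>0 \<Longrightarrow> \<rho> \<in> P2 \<Longrightarrow>
      JKO \<tau> (\<lambda>\<sigma>. ereal (potential_energy G \<sigma>) + \<H> \<sigma>) \<rho> \<noteq> {}"
    and H_C2: "C2 H" "bounded (range (hessian H))"
    and Lip: "L\<^sub>H-lipschitz_on UNIV (grad H)"
    and Loj: "lojasiewicz \<F> r\<^sub>0 c \<theta>"
    and eta: "0 < \<eta>" "\<eta> < \<eta>\<^sub>0"
    and init: "\<mu> 0 \<in> P2_abs" "\<F> (\<mu> 0) - optimal_value \<F> < r\<^sub>0"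
    and forward: "\<And>n. \<nu> (Suc n) = distr (\<mu> n) borel (\<lambda>x. x + \<eta> *\<^sub>R grad H x)"
    and backward: "\<And>n. \<mu> (Suc n) \<in>
      JKO \<eta> (\<lambda>\<sigma>. ereal (potential_energy G \<sigma>) + \<H> \<sigma>) (\<nu> (Suc n))"
  shows "(\<forall>\<epsilon>>0. \<exists>N. \<forall>m\<ge>N. \<forall>n\<ge>N. W2 (\<mu> m) (\<mu> n) < \<epsilon>) \<and>
    (\<exists>\<mu>'\<in>P2. (\<lambda>n. W2 (\<mu> n) \<mu>') \<longlonglongrightarrow> 0 \<and>
       (\<forall>\<rho>\<in>P2. \<F> \<mu>' \<le> \<F> \<rho>) \<and>
       (\<theta> = 0 \<longrightarrow> (\<exists>N. \<forall>n\<ge>N. W2 (\<mu> n) \<mu>' = 0)) \<and>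
       (0 < \<theta> \<and> \<theta> \<le> 1/2 \<longrightarrow>
          (let M = 1 + (2 * (\<eta>\<^sup>2 * L\<^sub>H\<^sup>2 + 1)) powr (1 / (2 * \<theta>)) /
                     ((1 - \<theta>) * \<eta> powr ((1 - \<theta>) / \<theta>) * c powr (1 / \<theta>))
           in (\<lambda>n. W2 (\<mu> n) \<mu>') \<in> O(\<lambda>n. (M / (M + 1)) ^ n))) \<and>
       (1/2 < \<theta> \<and> \<theta> < 1 \<longrightarrow>
          (\<lambda>n. W2 (\<mu> n) \<mu>') \<in> O(\<lambda>n. real n powr (- ((1 - \<theta>) / (2 * \<theta> - 1))))))"
proof -
  define \<Phi> where "\<Phi> \<sigma> = ereal (potential_energy G \<sigma>) + \<H> \<sigma>" for \<sigma>
  define g where "g = grad H"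
  have L: "0 \<le> L\<^sub>H" "\<And>x y. norm (g x - g y) \<le> L\<^sub>H * norm (x - y)"
    using lipschitz_onD[OF Lip] lipschitz_on_nonneg[OF Lip] by (simp_all add: g_def dist_norm)
  interpret forward_backward H g L\<^sub>H \<Phi>
  proof
    show "GDERIV H x :> g x" for x
      using H_C2(1) unfolding g_def C2_def by (intro GDERIV_grad) blast
    show "\<Phi> \<rho> \<noteq> -\<infinity>" if "\<rho> \<in> P2" for \<rho>
      using Hfun(1) that by (auto simp: extended_real_functional_def \<Phi>_def)
  qed (fact H L)+
  have F_eq': "F = \<F>"
    by (rule ext) (simp add: F_def F_eq \<Phi>_def add.commute)
  have JKO_\<Phi>: "(\<lambda>\<sigma>. ereal (potential_energy G \<sigma>) + \<H> \<sigma>) = \<Phi>"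
    by (simp add: \<Phi>_def[abs_def])
  have next_step: "\<mu> (Suc n) \<in> JKO \<eta> \<Phi> (local.forward \<eta> (\<mu> n))" for n
  proof -
    have "\<nu> (Suc n) = local.forward \<eta> (\<mu> n)"
      unfolding local.forward_def unfolding g_def by (rule forward)
    then show ?thesis using backward[of n] by (simp add: JKO_\<Phi>)
  qed
  \<comment> \<open>The optimal value and the values along the sequence are real numbers.\<close>
  obtain lb where lb: "\<And>\<rho>. \<rho> \<in> P2 \<Longrightarrow> ereal lb \<le> \<F> \<rho>"
    using F_bounded unfolding bounded_below_def by blast
  have "ereal lb \<le> optimal_value \<F>"
    unfolding optimal_value_def by (rule INF_greatest) (rule lb)
  moreover have "optimal_value \<F> < \<infinity>"
    using Loj unfolding lojasiewicz_def by (auto intro: less_le_trans)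
  ultimately obtain fs where fs: "optimal_value \<F> = ereal fs"
    by (cases "optimal_value \<F>") auto
  have fs_le: "ereal fs \<le> \<F> \<rho>" if "\<rho> \<in> P2" for \<rho>
    unfolding fs[symmetric] optimal_value_def using that by (rule INF_lower)
  have \<theta>c: "0 \<le> \<theta>" "\<theta> < 1" "0 < c"
    using Loj by (auto simp: lojasiewicz_def)
  have slope: "c * (f - fs) powr \<theta> \<le> L2_norm \<sigma> \<xi>"
    if "\<sigma> \<in> P2" "F \<sigma> = ereal f" "ereal (f - fs) < r\<^sub>0" "\<xi> \<in> frechet_subdiff F \<sigma>" for \<sigma> f \<xi>
  proof -
    have "ereal (c * (f - fs) powr \<theta>) \<le> (INF \<xi>\<in>frechet_subdiff \<F> \<sigma>. ereal (L2_norm \<sigma> \<xi>))"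
      using Loj that(1-3) unfolding lojasiewicz_def F_eq' by (auto simp: fs)
    also have "\<dots> \<le> ereal (L2_norm \<sigma> \<xi>)"
      using that(4) unfolding F_eq' by (rule INF_lower)
    finally show ?thesis by simp
  qed
  have \<mu>0: "\<mu> 0 \<in> P2" using init(1) by (simp add: P2_abs_def)
  have "\<exists>f. \<mu> n \<in> P2 \<and> F (\<mu> n) = ereal f \<and> ereal (f - fs) < r\<^sub>0" for n
  proof (induction n)
    case 0
    have "\<F> (\<mu> 0) \<noteq> \<infinity>" using init(2) by (auto simp: fs)
    then obtain f where "\<F> (\<mu> 0) = ereal f" using fs_le[OF \<mu>0] by (cases "\<F> (\<mu> 0)") auto
    then show ?case using \<mu>0 init(2) by (auto simp: F_eq' fs)
  next
    case (Suc n)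
    then obtain f0 where f0: "\<mu> n \<in> P2" "F (\<mu> n) = ereal f0" "ereal (f0 - fs) < r\<^sub>0" by blast
    obtain f1 where f1: "\<mu> (Suc n) \<in> P2" "F (\<mu> (Suc n)) = ereal f1"
      "(W2 (\<mu> n) (\<mu> (Suc n)))\<^sup>2 \<le> 2 * \<eta> * (f0 - f1)"
      using step_estimate[OF eta(1) f0(1,2) next_step] by metis
    have "0 \<le> 2 * \<eta> * (f0 - f1)" using f1(3) by (rule order_trans[rotated]) simp
    then have "f1 \<le> f0" using eta(1) by (simp add: zero_le_mult_iff)
    then have "ereal (f1 - fs) \<le> ereal (f0 - fs)" by simp
    then have "ereal (f1 - fs) < r\<^sub>0" using f0(3) by (rule le_less_trans)
    then show ?case using f1 by blast
  qed
  then obtain f where P: "\<And>n. \<mu> n \<in> P2" and f: "\<And>n. F (\<mu> n) = ereal (f n)"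
    and below: "\<And>n. ereal (f n - fs) < r\<^sub>0"
    by metis
  define a where "a n = f n - fs" for n
  have a0: "0 \<le> a n" for n
    using fs_le[OF P[of n]] f[of n] by (simp add: a_def F_eq')
  define l where "l = \<eta> * L\<^sub>H"
  have l: "0 \<le> l" using eta(1) L(1) by (simp add: l_def)
  have est: "(W2 (\<mu> n) (\<mu> (Suc n)))\<^sup>2 \<le> 2 * \<eta> * (a n - a (Suc n))"
    "(c * a (Suc n) powr \<theta>)\<^sup>2 \<le> (2 / \<eta>) * (1 + l) * (a n - a (Suc n))" for n
  proof -
    obtain f1 where f1: "F (\<mu> (Suc n)) = ereal f1" "(W2 (\<mu> n) (\<mu> (Suc n)))\<^sup>2 \<le> 2 * \<eta> * (f n - f1)"
      "\<And>b. 0 \<le> b \<Longrightarrow> (\<And>\<xi>. \<xi> \<in> frechet_subdiff F (\<mu> (Suc n)) \<Longrightarrow> b \<le> L2_norm (\<mu> (Suc n)) \<xi>) \<Longrightarrow>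
        b\<^sup>2 \<le> (2 / \<eta>) * (1 + \<eta> * L\<^sub>H) * (f n - f1)"
      by (rule step_estimate[OF eta(1) P f next_step]) blast
    have "f1 = f (Suc n)" using f1(1) f by simp
    then show "(W2 (\<mu> n) (\<mu> (Suc n)))\<^sup>2 \<le> 2 * \<eta> * (a n - a (Suc n))"
      using f1(2) by (simp add: a_def)
    have "(c * a (Suc n) powr \<theta>)\<^sup>2 \<le> (2 / \<eta>) * (1 + \<eta> * L\<^sub>H) * (f n - f1)"
      using f1(3)[of "c * a (Suc n) powr \<theta>"] slope[OF P f below, of _ "Suc n"] \<theta>c by (simp add: a_def)
    then show "(c * a (Suc n) powr \<theta>)\<^sup>2 \<le> (2 / \<eta>) * (1 + l) * (a n - a (Suc n))"
      by (simp add: a_def l_def \<open>f1 = f (Suc n)\<close>)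
  qed
  define K where "K = sqrt ((2 / \<eta>) * (1 + l)) / c"
  have kpos: "0 < (2 / \<eta>) * (1 + l)" using eta(1) l by simp
  interpret seq: lojasiewicz_sequence a K \<theta>
  proof
    show "a (Suc n) \<le> a n" for n
    proof -
      have "0 \<le> 2 * \<eta> * (a n - a (Suc n))" using est(1)[of n] by (rule order_trans[rotated]) simp
      then show ?thesis using eta(1) by (simp add: zero_le_mult_iff)
    qed
    show "0 < K" using kpos \<theta>c by (simp add: K_def)
    show "a (Suc n) powr \<theta> \<le> K * sqrt (a n - a (Suc n))" for n
    proof -
      have "c * a (Suc n) powr \<theta> \<le> sqrt ((2 / \<eta>) * (1 + l) * (a n - a (Suc n)))"
        using est(2)[of n] by (rule real_le_rsqrt)
      then have "a (Suc n) powr \<theta> \<le> sqrt ((2 / \<eta>) * (1 + l)) * sqrt (a n - a (Suc n)) / c"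
        unfolding real_sqrt_mult[of "(2 / \<eta>) * (1 + l)"] pos_le_divide_eq[OF \<theta>c(3)]
        by (simp only: mult.commute)
      then show ?thesis by (simp only: K_def times_divide_eq_left)
    qed
  qed (fact a0 \<theta>c)+
  define B where "B = sqrt (2 * \<eta>)"
  have B: "0 \<le> B" using eta(1) by (simp add: B_def)
  have W2_d: "W2 (\<mu> n) (\<mu> (Suc n)) \<le> B * seq.d n" for n
    using est(1)[of n] unfolding B_def seq.d_def real_sqrt_mult[symmetric] by (rule real_le_rsqrt)
  have sum_W: "summable (\<lambda>n. W2 (\<mu> n) (\<mu> (Suc n)))"
    by (rule summable_comparison_test'[OF summable_mult[OF seq.summable_d, of B], of 0]) (simp add: W2_d)
  obtain \<mu>' where \<mu>': "\<mu>' \<in> P2" and lim: "(\<lambda>n. W2 (\<mu> n) \<mu>') \<longlonglongrightarrow> 0"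
    using W2_complete[OF P sum_W] by blast
  have W2_R: "W2 (\<mu> n) \<mu>' \<le> B * seq.R n" for n
    using W2_limit_le_suminf[OF P \<mu>' lim W2_d summable_mult[OF seq.summable_shift], of n]
      suminf_mult[OF seq.summable_shift[of n], of B] by (simp add: seq.R_def)
  have bigo: "(\<lambda>n. W2 (\<mu> n) \<mu>') \<in> O(h)" if "seq.R \<in> O(h)" for h :: "nat \<Rightarrow> real"
  proof -
    have "(\<lambda>n. W2 (\<mu> n) \<mu>') \<in> O(seq.R)"
      using W2_R seq.R_nonneg by (intro bigoI[of _ B]) auto
    then show ?thesis using that by (rule landau_o.big_trans)
  qed
  have Cauchy: "\<exists>N. \<forall>m\<ge>N. \<forall>n\<ge>N. W2 (\<mu> m) (\<mu> n) < \<epsilon>" if \<epsilon>: "0 < \<epsilon>" for \<epsilon>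
  proof -
    have "\<forall>\<^sub>F n in sequentially. W2 (\<mu> n) \<mu>' < \<epsilon> / 2"
      using lim by (rule order_tendstoD(2)) (use \<epsilon> in simp)
    then obtain N where N: "\<And>n. N \<le> n \<Longrightarrow> W2 (\<mu> n) \<mu>' < \<epsilon> / 2"
      unfolding eventually_sequentially by blast
    have "W2 (\<mu> m) (\<mu> n) < \<epsilon>" if "N \<le> m" "N \<le> n" for m n
      using W2_triangle[OF P \<mu>' P, of m n] W2_sym[OF \<mu>' P[of n]] N[OF that(1)] N[OF that(2)] by simp
    then show ?thesis by blast
  qed
  \<comment> \<open>The gaps tend to zero and the functional is lower semicontinuous, so the limit is a minimizer.\<close>
  have minimizer: "\<F> \<mu>' \<le> \<F> \<rho>" if "\<rho> \<in> P2" for \<rho>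
  proof -
    have EG: "(\<lambda>n. potential_energy G (\<mu> n)) \<longlonglongrightarrow> potential_energy G \<mu>'"
      by (rule potential_energy_continuous[OF G P \<mu>' lim])
    have EH: "(\<lambda>n. potential_energy H (\<mu> n)) \<longlonglongrightarrow> potential_energy H \<mu>'"
      by (rule potential_energy_continuous[OF H P \<mu>' lim])
    have H\<mu>: "\<H> (\<mu> n) = ereal (a n + fs - potential_energy G (\<mu> n) + potential_energy H (\<mu> n))" for n
      using f[of n] unfolding F_eq' F_eq by (cases "\<H> (\<mu> n)") (auto simp: a_def)
    have "(\<lambda>n. a n + fs - potential_energy G (\<mu> n) + potential_energy H (\<mu> n))
        \<longlonglongrightarrow> 0 + fs - potential_energy G \<mu>' + potential_energy H \<mu>'"
      by (intro tendsto_intros EG EH seq.tendsto_0)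
    then have "(\<lambda>n. \<H> (\<mu> n)) \<longlonglongrightarrow> ereal (0 + fs - potential_energy G \<mu>' + potential_energy H \<mu>')"
      unfolding H\<mu> by simp
    then have "liminf (\<lambda>n. \<H> (\<mu> n)) = ereal (fs - potential_energy G \<mu>' + potential_energy H \<mu>')"
      using lim_imp_Liminf[OF sequentially_bot] by simp
    then have "\<H> \<mu>' \<le> ereal (fs - potential_energy G \<mu>' + potential_energy H \<mu>')"
      using Hfun(3) \<mu>' P lim unfolding lsc_W2_def by metis
    then have "\<F> \<mu>' \<le> ereal fs"
      unfolding F_eq by (cases "\<H> \<mu>'") auto
    then show ?thesis using fs_le[OF that] by (rule order_trans)
  qed
  have case_zero: "\<exists>N. \<forall>n\<ge>N. W2 (\<mu> n) \<mu>' = 0" if zero: "\<theta> = 0"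
  proof -
    obtain N where "\<forall>n\<ge>N. a n = 0" using seq.eventually_zero[OF zero] by blast
    then have "W2 (\<mu> n) \<mu>' = 0" if "N \<le> n" for n
      using W2_R[of n] seq.R_zero[of n] that by (simp add: order_antisym)
    then show ?thesis by blast
  qed
  have case_linear: "(\<lambda>n. W2 (\<mu> n) \<mu>') \<in> O(\<lambda>n. (M / (M + 1)) ^ n)"
    if \<theta>: "0 < \<theta>" "\<theta> \<le> 1 / 2" and M: "M = 1 + (2 * (\<eta>\<^sup>2 * L\<^sub>H\<^sup>2 + 1)) powr (1 / (2 * \<theta>)) /
      ((1 - \<theta>) * \<eta> powr ((1 - \<theta>) / \<theta>) * c powr (1 / \<theta>))" for M
  proof -
    have M1: "1 \<le> M" using \<theta>c(2) unfolding M by simp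
    define q where "q = M / (M + 1)"
    have q: "1 / 2 \<le> q" using M1 by (simp add: q_def field_simps)
    \<comment> \<open>Below \<open>1/2\<close> any geometric ratio is eventually beaten; at \<open>1/2\<close> the ratio must match \<open>M\<close>.\<close>
    have "\<forall>\<^sub>F n in sequentially. a (Suc n) \<le> q\<^sup>2 * a n"
    proof (cases "\<theta> = 1 / 2")
      case False
      then have "\<forall>\<^sub>F n in sequentially. a (Suc n) \<le> (1 / 2)\<^sup>2 * a n"
        using \<theta> by (intro seq.eventually_ratio) auto
      then show ?thesis
      proof eventually_elim
        case (elim n)
        have "(1 / 2)\<^sup>2 * a n \<le> q\<^sup>2 * a n" using q a0[of n] by (intro mult_right_mono power_mono) auto
        then show ?case using elim by linarith
      qed
    next
      case True
      define A where "A = 2 * (1 + l\<^sup>2) / (\<eta> * c\<^sup>2)"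
      have A: "0 < A" using eta(1) \<theta>c(3) by (simp add: A_def add_pos_nonneg)
      have M_A: "M = 1 + 2 * A"
      proof -
        have "0 < 2 * (\<eta>\<^sup>2 * L\<^sub>H\<^sup>2 + 1)" by (simp add: add_nonneg_pos)
        then show ?thesis
          unfolding M True using eta(1) \<theta>c(3)
          by (simp add: A_def l_def power_mult_distrib algebra_simps)
      qed
      have "a (Suc n) \<le> q\<^sup>2 * a n" for n
      proof -
        have \<eta>2: "0 < \<eta> / 2" "\<eta> / 2 < \<eta>\<^sub>0" using eta by simp_all
        obtain \<sigma> where \<sigma>: "\<sigma> \<in> JKO (\<eta> / 2) \<Phi> (local.forward (\<eta> / 2) (\<mu> n))"
          using JKO_nonempty[OF \<eta>2 forward_in_P2[OF P[of n]]] unfolding JKO_\<Phi> by blast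
        obtain fh where fh: "\<sigma> \<in> P2" "F \<sigma> = ereal fh" "(W2 (\<mu> n) \<sigma>)\<^sup>2 \<le> 2 * (\<eta> / 2) * (f n - fh)"
          using step_estimate[OF \<eta>2(1) P f \<sigma>] by metis
        have "0 \<le> 2 * (\<eta> / 2) * (f n - fh)" using fh(3) by (rule order_trans[rotated]) simp
        then have "fh \<le> f n" using eta(1) by (simp add: zero_le_mult_iff)
        then have "ereal (fh - fs) \<le> ereal (f n - fs)" by simp
        then have below_h: "ereal (fh - fs) < r\<^sub>0" using below[of n] by (rule le_less_trans)
        have fh_ge: "fs \<le> fh" using fs_le[OF fh(1)] fh(2) by (simp add: F_eq')
        have f_ge: "fs \<le> f (Suc n)" using a0[of "Suc n"] by (simp add: a_def)
        have s1: "c * sqrt (f (Suc n) - fs) \<le> L2_norm (\<mu> (Suc n)) \<xi>" if "\<xi> \<in> frechet_subdiff F (\<mu> (Suc n))" for \<xi>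
          using slope[OF P f below that] f_ge by (simp add: True powr_half_sqrt)
        have s2: "c * sqrt (fh - fs) \<le> L2_norm \<sigma> \<xi>" if "\<xi> \<in> frechet_subdiff F \<sigma>" for \<xi>
          using slope[OF fh(1,2) below_h that] fh_ge by (simp add: True powr_half_sqrt)
        have "\<eta> * c\<^sup>2 * (f (Suc n) - fs) \<le> 2 * (1 + (\<eta> * L\<^sub>H)\<^sup>2) * (f n - f (Suc n))"
          by (rule step_estimate_half[OF eta(1) P f next_step f \<sigma> fh(2) \<theta>c(3) f_ge fh_ge s1 s2])
        then have "a (Suc n) \<le> A * (a n - a (Suc n))"
          using eta(1) \<theta>c(3) by (simp add: a_def A_def l_def field_simps)
        then have rec: "(1 + A) * a (Suc n) \<le> A * a n" by (simp add: algebra_simps)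
        \<comment> \<open>\<open>A / (1 + A) \<le> q\<^sup>2\<close> amounts to \<open>4 * A * (1 + A) \<le> (1 + 2 * A)\<^sup>2\<close>.\<close>
        have "A \<le> q\<^sup>2 * (1 + A)"
        proof -
          have "q\<^sup>2 * (1 + A) = (1 + 2 * A)\<^sup>2 / (4 * (1 + A))"
          proof -
            have "q = (1 + 2 * A) / (2 * (1 + A))" by (simp add: q_def M_A)
            moreover have "(2 * (1 + A))\<^sup>2 = 4 * (1 + A) * (1 + A)"
              by (simp add: power2_eq_square algebra_simps)
            ultimately have "q\<^sup>2 = (1 + 2 * A)\<^sup>2 / (4 * (1 + A) * (1 + A))"
              by (simp only: power_divide)
            moreover have "x / (y * z) * z = x / y" if "z \<noteq> 0" for x y z :: real
              using that by simp
            ultimately show ?thesis using A by simp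
          qed
          moreover have "A * (4 * (1 + A)) \<le> (1 + 2 * A)\<^sup>2"
            by (simp add: power2_eq_square algebra_simps)
          ultimately show ?thesis using A by (simp add: pos_le_divide_eq)
        qed
        then have "A * a n \<le> (q\<^sup>2 * (1 + A)) * a n" using a0[of n] by (rule mult_right_mono)
        then have "(1 + A) * a (Suc n) \<le> (1 + A) * (q\<^sup>2 * a n)" using rec by (simp add: mult_ac)
        then show ?thesis using A by simp
      qed
      then show ?thesis by simp
    qed
    then have "seq.R \<in> O(\<lambda>n. q ^ n)"
      using \<theta>(2) q by (intro seq.R_linear_rate) auto
    then show ?thesis unfolding q_def by (rule bigo)
  qed
  have case_sublinear: "(\<lambda>n. W2 (\<mu> n) \<mu>') \<in> O(\<lambda>n. real n powr (- ((1 - \<theta>) / (2 * \<theta> - 1))))"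
    if "1 / 2 < \<theta>"
    by (rule bigo[OF seq.R_sublinear_rate[OF that]])
  show ?thesis
    unfolding Let_def
    using Cauchy \<mu>' lim minimizer case_zero case_linear[OF _ _ refl] case_sublinear by blast
qed

end
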